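(* Let $h$ be univalent and analytic in $\mathbb H$ with $\lim_{z\to\infty}h(z)=\infty$ and let $h(\mathbb H)$ be a Jordan domain. Let $h$ satisfy $$\lim_{\mathrm{Re}\,z\to0^+}\tfrac12(2\,\mathrm{Re}\,z)^2\,|Sh(z)|=0.$$ Suppose that (A): both $h$ and $h^{-1}$ are locally uniformly continuous in a neighborhood of $\infty$. Let $\tau_0>0$ be the constant described in the context (for some fixed $k\in(0,1)$). Then there is a positive constant $\tau\le\tau_0$ such that the analytic function $h_t$ on $\mathbb H$ defined by $$h_t(z)=h(z+t)-\frac{2t\,h'(z+t)}{1+t\,Ph(z+t)}$$ is univalent for all $0\le t\le\tau$.
   Context: $\mathbb H=\{z=x+iy\in\mathbb C:x>0\}$ is the right half-plane. $Pf:=f''/f'$ is the pre-Schwarzian derivative and $Sf:=(Pf)'-(Pf)^2/2$ the Schwarzian derivative of a locally univalent analytic $f$. The limit $\lim_{\mathrm{Re}\,z\to0^+}$ is uniform in $\mathrm{Im}\,z$: the supremum over $0<\mathrm{Re}\,z\le t$ tends to $0$ as $t\to0^+$. A Jordan domain is a domain in $\overline{\mathbb C}$ bounded by a Jordan curve of $\overline{\mathbb C}$. Condition (A) means: for some $M>0$, $h$ is uniformly continuous (Euclidean metric) on $\{z\in\mathbb H:|z|>M\}$ and $h^{-1}$ is uniformly continuous on $\{w\in h(\mathbb H):|w|>M\}$. The constant $\tau_0$: if $h$ is univalent and analytic in $\mathbb H$ with $\lim_{z\to\infty}h(z)=\infty$ and $\lim_{\mathrm{Re}\,z\to0^+}\tfrac12(2\,\mathrm{Re}\,z)^2\,|Sh(z)|=0$,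 then for any $0<k<1$ there is $\tau_0>0$ such that for $0\le t\le\tau_0$ the functions $h_t(z)=h(z+t)-\frac{2t\,h'(z+t)}{1+t\,Ph(z+t)}$ are analytic on $\mathbb H$ and the family satisfies $h_0=h$ and $\frac{\partial}{\partial t}h_t(z)=-p(z,t)\,h_t'(z)$, where $h_t'=\frac{d h_t}{dz}$, for a Herglotz function $p$ with $\left|\frac{p(z,t)-1}{p(z,t)+1}\right|\le k$ for $z\in\mathbb H$, $0\le t\le\tau_0$. (A Herglotz function is one that is locally integrable in $t$ for each $z$, and analytic in $z$ with non-negative real part for almost every $t$.) Fix such a $k$ and $\tau_0$. *)

theory Defs
  imports "HOL-Complex_Analysis.Complex_Analysis"
begin

definition right_half_plane :: "complex set"  (\<open>\<H>\<close>) where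
  "\<H> = {z. 0 < Re z}"

definition univalent_on :: "(complex \<Rightarrow> complex) \<Rightarrow> complex set \<Rightarrow> bool" where
  "univalent_on f S \<longleftrightarrow> f holomorphic_on S \<and> inj_on f S"

definition pre_Schwarzian :: "(complex \<Rightarrow> complex) \<Rightarrow> complex \<Rightarrow> complex" where
  "pre_Schwarzian f z = deriv (deriv f) z / deriv f z"

definition Schwarzian :: "(complex \<Rightarrow> complex) \<Rightarrow> complex \<Rightarrow> complex" where
  "Schwarzian f z = deriv (pre_Schwarzian f) z - (pre_Schwarzian f z)\<^sup>2 / 2"

(* The supremum is taken in ereal, so that it is meaningful for unbounded sets as well. *)
definition Schwarzian_vanishes_at_boundary :: "(complex \<Rightarrow> complex) \<Rightarrow> bool" where
  "Schwarzian_vanishes_at_boundary h \<longleftrightarrow>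
     ((\<lambda>t::real. SUP z\<in>{z. 0 < Re z \<and> Re z \<le> t}.
         ereal (1/2 * (2 * Re z)\<^sup>2 * norm (Schwarzian h z))) \<longlongrightarrow> 0) (at_right 0)"

(* The one-point compactification of the plane; the point at infinity is None. *)
definition riemann_sphere :: "complex option topology" where
  "riemann_sphere = Alexandroff_compactification euclidean"

definition Jordan_curve_in :: "'a topology \<Rightarrow> 'a set \<Rightarrow> bool" where
  "Jordan_curve_in X J \<longleftrightarrow> J \<subseteq> topspace X \<and>
     subtopology X J homeomorphic_space top_of_set (sphere (0::complex) 1)"

definition Jordan_domain :: "complex option set \<Rightarrow> bool" where
  "Jordan_domain D \<longleftrightarrow> D \<noteq> {} \<and> openin riemann_sphere D \<and> connectedin riemann_sphere D \<and>
     Jordan_curve_in riemann_sphere (riemann_sphere frontier_of D)"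

definition condition_A :: "(complex \<Rightarrow> complex) \<Rightarrow> bool" where
  "condition_A h \<longleftrightarrow> (\<exists>M>0.
     uniformly_continuous_on {z \<in> \<H>. norm z > M} h \<and>
     uniformly_continuous_on {w \<in> h ` \<H>. norm w > M} (inv_into \<H> h))"

definition Loewner_family :: "(complex \<Rightarrow> complex) \<Rightarrow> real \<Rightarrow> complex \<Rightarrow> complex" where
  "Loewner_family h t z =
     h (z + of_real t) - 2 * of_real t * deriv h (z + of_real t)
       / (1 + of_real t * pre_Schwarzian h (z + of_real t))"

definition Herglotz_function :: "(complex \<Rightarrow> real \<Rightarrow> complex) \<Rightarrow> real set \<Rightarrow> bool" where
  "Herglotz_function p T \<longleftrightarrow>
     (\<forall>z\<in>\<H>. \<forall>K. compact K \<and> K \<subseteq> T \<longrightarrow> p z absolutely_integrable_on K) \<and>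
     (AE t in lebesgue. t \<in> T \<longrightarrow>
        (\<lambda>z. p z t) holomorphic_on \<H> \<and> (\<forall>z\<in>\<H>. 0 \<le> Re (p z t)))"

(* The requirements on tau_0. Since x / 0 = 0 in HOL, the quotients occurring in the
   Loewner family and in the bound on p are explicitly required to be well defined. *)
definition Loewner_admissible :: "(complex \<Rightarrow> complex) \<Rightarrow> real \<Rightarrow> real \<Rightarrow> bool" where
  "Loewner_admissible h k \<tau>\<^sub>0 \<longleftrightarrow> 0 < \<tau>\<^sub>0 \<and>
     (\<forall>t\<in>{0..\<tau>\<^sub>0}.
        (\<forall>z\<in>\<H>. 1 + of_real t * pre_Schwarzian h (z + of_real t) \<noteq> 0) \<and>
        Loewner_family h t holomorphic_on \<H>) \<and>
     (\<forall>z\<in>\<H>. Loewner_family h 0 z = h z) \<and>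
     (\<exists>p. Herglotz_function p {0..\<tau>\<^sub>0} \<and>
        (\<forall>z\<in>\<H>. \<forall>t\<in>{0..\<tau>\<^sub>0}.
           ((\<lambda>s. Loewner_family h s z) has_vector_derivative
              - p z t * deriv (Loewner_family h t) z) (at t within {0..\<tau>\<^sub>0}) \<and>
           p z t + 1 \<noteq> 0 \<and> norm ((p z t - 1) / (p z t + 1)) \<le> k))"

end

theory Submission
  imports Defs
begin

text \<open>
  Write \<open>P\<close> and \<open>S\<close> for the pre-Schwarzian and Schwarzian of \<open>h\<close>. Along a horizontal line
  \<open>P' = S + P\<^sup>2 / 2\<close>. If \<open>x\<^sup>2 S\<close> is small but \<open>x P\<close> is not small at some \<open>x\<close>, then \<open>1 / P\<close> stays close to
  \<open>- x / 2\<close> for all larger \<open>x\<close>, so that \<open>\<bar>h'\<bar>\<close> grows at least like \<open>x powr (- 3/2)\<close> as \<open>x\<close> decreases;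
  this is impossible for very small \<open>x\<close> when \<open>x \<bar>h'\<bar>\<close> is bounded. Hence \<open>x P \<rightarrow> 0\<close> at the boundary.

  The derivative of \<open>h\<^sub>t\<close> at \<open>z\<close> is \<open>h' (1 + 2 t\<^sup>2 S) / (1 + t P)\<^sup>2\<close> at \<open>z + t\<close>, so \<open>x P \<rightarrow> 0\<close> makes \<open>h\<^sub>t\<close> a
  near-isometry up to scale, and therefore injective, at all distances up to some \<open>\<rho>\<close> independent
  of \<open>t\<close>. At distances at least \<open>\<rho>\<close>, \<open>h\<^sub>t\<close> is uniformly close to \<open>h\<close>, whose values are
  uniformly separated.

  This needs \<open>h\<close> and its inverse to be uniformly continuous everywhere, not only near infinity.
  Choose \<open>a\<close> outside the closure of the Jordan domain. The bounded function \<open>1 / (h - a)\<close> has the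
  same Schwarzian, so it extends continuously to the closed half-plane, locally injectively on the
  boundary. If two boundary points had the same image, a crosscut joining them would be
  mapped to a Jordan curve separating the punctured boundary of the image, which is connected. So the extension
  is injective, and compactness gives the uniform continuity on bounded parts.
\<close>

section \<open>Riccati equation for the pre-Schwarzian\<close>

text \<open>The Riccati argument needs two inputs: an upper bound for x |h'| near the boundary and a
  lower bound for |h'| on one vertical line. For h both are consequences of global uniform
  continuity of h and of its inverse, which in turn has to be derived from boundary behaviour. The
  circle is broken by running the argument twice. The bounded function g = 1/(h - a) satisfies the
  upper bound by Cauchy's estimate and the lower bound by compactness, as long as Im z stays
  bounded. So the first run controls only strips of bounded height, which is enough to extend g to
  all finite boundary points; at infinity g tends to 0, and (A) supplies the uniformity for h there.
  The second run is for h itself, over all heights at once. Local injectivity of the extension is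
  obtained only at finite boundary points. The topological injectivity argument therefore has to
  tolerate one exceptional boundary point, the one corresponding to infinity.\<close>

lemma norm_exp_minus_1_le:
  fixes z :: complex
  shows "norm (exp z - 1) \<le> exp (norm z) - 1"
proof -
  have "norm (exp (of_real 1 * z) - exp (of_real 0 * z)) \<le> exp (1 * norm z) - exp (0 * norm z)"
  proof (rule differentiable_bound_general[where f' = "\<lambda>t. z * exp (of_real t * z)"
        and \<phi>' = "\<lambda>t. norm z * exp (t * norm z)"])
    show "((\<lambda>t. exp (of_real t * z)) has_vector_derivative z * exp (of_real t * z)) (at t)" for t
      by (auto intro!: derivative_eq_intros has_vector_derivative_real_field)
    show "((\<lambda>t. exp (t * norm z)) has_vector_derivative norm z * exp (t * norm z)) (at t)" for t :: real
      by (auto intro!: derivative_eq_intros simp flip: has_real_derivative_iff_has_vector_derivative)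
    show "norm (z * exp (of_real t * z)) \<le> norm z * exp (t * norm z)" if "0 < t" "t < 1" for t
      using complex_Re_le_cmod[of z] that by (auto simp: norm_mult intro!: mult_left_mono)
  qed (auto intro!: continuous_intros)
  then show ?thesis by simp
qed

text \<open>Passing to 1/P linearises the Riccati equation: the derivative of 1/P + u/2 is -S/P^2.
  The bounds on u^2 |S| and u |P| make this at most 1/64, whatever \<epsilon> is.\<close>

lemma inverse_riccati_estimate:
  fixes P S :: "real \<Rightarrow> complex"
  assumes "0 < x" "x \<le> y" "0 < \<epsilon>"
    and P': "\<And>u. x \<le> u \<Longrightarrow> u \<le> y \<Longrightarrow> (P has_vector_derivative S u + (P u)\<^sup>2 / 2) (at u)"
    and S: "\<And>u. x \<le> u \<Longrightarrow> u \<le> y \<Longrightarrow> u\<^sup>2 * norm (S u) \<le> \<epsilon>\<^sup>2 / 64"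
    and P: "\<And>u. x \<le> u \<Longrightarrow> u \<le> y \<Longrightarrow> \<epsilon> \<le> u * norm (P u)"
  shows "norm ((inverse (P y) + of_real y / 2) - (inverse (P x) + of_real x / 2)) \<le> (y - x) / 64"
proof (cases "x = y")
  case False
  have nz: "P u \<noteq> 0" if "x \<le> u" "u \<le> y" for u
    using P[OF that] \<open>0 < \<epsilon>\<close> by auto
  have "norm ((inverse (P y) + of_real y / 2) - (inverse (P x) + of_real x / 2)) \<le> y / 64 - x / 64"
  proof (rule differentiable_bound_general[where f = "\<lambda>u. inverse (P u) + of_real u / 2"
         and f' = "\<lambda>u. - (S u / (P u)\<^sup>2)" and \<phi> = "\<lambda>u. u/64" and \<phi>' = "\<lambda>u. 1/64"])
    show "x < y" using False assms by simp
    have der: "((\<lambda>u. inverse (P u) + of_real u / 2) has_vector_derivative - (S u / (P u)\<^sup>2)) (at u)"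
      if "x \<le> u" "u \<le> y" for u
    proof -
      have "((\<lambda>u. inverse (P u)) has_vector_derivative
               (S u + (P u)\<^sup>2 / 2) * - (inverse (P u) * 1 * inverse (P u))) (at u)"
        using field_vector_diff_chain_at[OF P'[OF that] DERIV_inverse'[OF DERIV_ident nz[OF that]]]
        by (simp add: o_def)
      moreover have "((\<lambda>u. complex_of_real u / 2) has_vector_derivative 1 / 2) (at u)"
        by (auto intro!: derivative_eq_intros has_vector_derivative_real_field)
      ultimately have "((\<lambda>u. inverse (P u) + of_real u / 2) has_vector_derivative
          (S u + (P u)\<^sup>2 / 2) * - (inverse (P u) * 1 * inverse (P u)) + 1 / 2) (at u)"
        by (rule has_vector_derivative_add)
      moreover have "(S u + (P u)\<^sup>2 / 2) * - (inverse (P u) * 1 * inverse (P u)) + 1 / 2 = - (S u / (P u)\<^sup>2)"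
        using nz[OF that] by (simp add: field_simps power2_eq_square)
      ultimately show ?thesis by simp
    qed
    show "continuous_on {x..y} (\<lambda>u. inverse (P u) + of_real u / 2)"
      by (rule continuous_on_vector_derivative) (use der has_vector_derivative_at_within in \<open>fastforce\<close>)
    show "((\<lambda>u. inverse (P u) + of_real u / 2) has_vector_derivative - (S u / (P u)\<^sup>2)) (at u)"
      if "x < u" "u < y" for u
      using der that by simp
    show "norm (- (S u / (P u)\<^sup>2)) \<le> 1 / 64" if "x < u" "u < y" for u
    proof -
      have u: "0 < u" using that assms by linarith
      have "\<epsilon>\<^sup>2 \<le> (u * norm (P u))\<^sup>2"
        using P[of u] that \<open>0 < \<epsilon>\<close> by (intro power_mono) auto
      then have "u\<^sup>2 * norm (S u) \<le> u\<^sup>2 * ((norm (P u))\<^sup>2 / 64)"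
        using S[of u] that by (simp add: power_mult_distrib)
      then have "norm (S u) \<le> (norm (P u))\<^sup>2 / 64"
        using u by (simp only: mult_le_cancel_left_pos[of "u\<^sup>2"] zero_less_power)
      then show ?thesis
        using nz[of u] that by (simp add: norm_divide norm_power divide_simps)
    qed
  qed (auto intro!: continuous_intros derivative_eq_intros simp flip: has_real_derivative_iff_has_vector_derivative)
  then show ?thesis by simp
qed simp

text \<open>At the first point z where u |P u| falls to \<epsilon>, |1/P| equals z/\<epsilon>. But
  |1/P| starts below x/\<epsilon> and 1/P moves at speed at most 1/2 + 1/64 = 33/64, less than
  1/\<epsilon>, so it cannot catch up with the line u/\<epsilon>.\<close>

lemma inverse_riccati_persistence:
  fixes P S :: "real \<Rightarrow> complex"
  assumes "0 < x" "x \<le> \<delta>" "0 < \<epsilon>" "\<epsilon> \<le> 1"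
    and P': "\<And>u. x \<le> u \<Longrightarrow> u \<le> \<delta> \<Longrightarrow> (P has_vector_derivative S u + (P u)\<^sup>2 / 2) (at u)"
    and S: "\<And>u. x \<le> u \<Longrightarrow> u \<le> \<delta> \<Longrightarrow> u\<^sup>2 * norm (S u) \<le> \<epsilon>\<^sup>2 / 64"
    and P: "\<epsilon> < x * norm (P x)"
    and y: "x \<le> y" "y \<le> \<delta>"
  shows "\<epsilon> < y * norm (P y)"
proof (rule ccontr)
  assume neg: "\<not> ?thesis"
  have cP: "continuous_on {x..\<delta>} P"
    by (rule continuous_on_vector_derivative) (use P' has_vector_derivative_at_within in \<open>fastforce\<close>)
  define r where "r = (\<lambda>u. u * norm (P u))"
  have cr: "continuous_on {x..\<delta>} r"
    unfolding r_def by (intro continuous_intros cP)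
  define B where "B = {u\<in>{x..\<delta>}. r u = \<epsilon>}"
  have below: "\<exists>v\<in>B. v \<le> u" if "x \<le> u" "u \<le> \<delta>" "r u \<le> \<epsilon>" for u
  proof -
    have "\<exists>v. x \<le> v \<and> v \<le> u \<and> r v = \<epsilon>"
      by (rule IVT2') (use that P in \<open>auto simp: r_def intro!: continuous_on_subset[OF cr[unfolded r_def]]\<close>)
    then show ?thesis using that by (auto simp: B_def)
  qed
  have "closed B"
    unfolding B_def using continuous_closed_preimage_constant[OF cr closed_atLeastAtMost] by simp
  then have "compact B"
    by (metis (no_types, lifting) B_def bounded_closed_interval bounded_subset compact_eq_bounded_closed mem_Collect_eq subsetI)
  moreover have "B \<noteq> {}"
    using below[of y] y neg by (auto simp: r_def)
  ultimately obtain z where z: "z \<in> B" "\<And>v. v \<in> B \<Longrightarrow> z \<le> v"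
    using compact_attains_inf[of B] by blast
  have zx: "x \<le> z" "z \<le> \<delta>" "z * norm (P z) = \<epsilon>"
    using z(1) by (auto simp: B_def r_def)
  have "x \<noteq> z" using P zx by auto
  then have "x < z" using zx by simp
  have ge: "\<epsilon> \<le> u * norm (P u)" if "x \<le> u" "u \<le> z" for u
  proof (rule ccontr)
    assume *: "\<not> ?thesis"
    then have "\<exists>v\<in>B. v \<le> u" using below[of u] that zx by (auto simp: r_def)
    then have "u = z" using z(2) that by force
    with * zx show False by simp
  qed
  have "norm ((inverse (P z) + of_real z / 2) - (inverse (P x) + of_real x / 2)) \<le> (z - x) / 64"
    by (rule inverse_riccati_estimate[of x z \<epsilon> P S]) (use assms zx ge in auto)
  moreover have "norm (inverse (P z)) = z / \<epsilon>"
  proof -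
    have "P z \<noteq> 0" using zx \<open>0 < \<epsilon>\<close> by auto
    then show ?thesis
      using zx \<open>0 < \<epsilon>\<close> by (simp add: norm_inverse norm_divide field_simps)
  qed
  moreover have "norm (inverse (P x)) < x / \<epsilon>"
  proof -
    have "P x \<noteq> 0" using P \<open>0 < \<epsilon>\<close> by auto
    then show ?thesis
      using P \<open>0 < \<epsilon>\<close> \<open>0 < x\<close> by (simp add: norm_inverse norm_divide field_simps)
  qed
  moreover have "norm (inverse (P z)) \<le> norm (inverse (P x)) + norm ((inverse (P z) + of_real z / 2) - (inverse (P x) + of_real x / 2))
       + norm (complex_of_real ((z - x) / 2))"
  proof -
    have "inverse (P z) = inverse (P x) + ((inverse (P z) + of_real z / 2) - (inverse (P x) + of_real x / 2)) - of_real ((z - x) / 2)"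
      by (simp add: field_simps)
    then show ?thesis
      by (metis (no_types, lifting) norm_triangle_ineq norm_triangle_ineq4 add_right_mono order_trans)
  qed
  moreover have "norm (complex_of_real ((z - x) / 2)) = (z - x) / 2"
    using \<open>x < z\<close> by (simp only: norm_of_real) simp
  ultimately have "z / \<epsilon> < x / \<epsilon> + (z - x) * (33/64)"
    by argo
  moreover have "(z - x) * 1 \<le> (z - x) * (1 / \<epsilon>)"
    using \<open>x < z\<close> assms by (intro mult_left_mono) auto
  ultimately show False using \<open>x < z\<close> by (simp add: diff_divide_distrib)
qed

text \<open>For \<phi> = -y/2 exactly, the value would be -4. The tolerance y/32 gives Re \<phi>
  \<le> -15y/32 and |\<phi>|^2 \<le> (17/32)^2 y^2 \<le> 5y^2/16, and 15/16 = 3 * 5/16 leaves -3,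
  which matches the exponent of |N|^2 y^3 in the next lemma.\<close>

lemma Re_inverse_near_neg_half:
  fixes \<phi> :: complex
  assumes "0 < y" and \<phi>: "norm (\<phi> + of_real y / 2) \<le> y / 32"
  shows "2 * y * Re (inverse \<phi>) \<le> -3"
proof -
  have "\<bar>Re (\<phi> + of_real y / 2)\<bar> \<le> y / 32"
    using abs_Re_le_cmod \<phi> order_trans by blast
  then have "\<bar>Re \<phi> + y / 2\<bar> \<le> y / 32" by simp
  then have re: "Re \<phi> \<le> - (15/32) * y" by linarith
  have "norm \<phi> \<le> norm (\<phi> + of_real y / 2) + norm (complex_of_real (y / 2))"
    by (metis norm_triangle_ineq4 add_diff_cancel of_real_divide of_real_numeral)
  also have "norm (complex_of_real (y / 2)) = y / 2"
    using \<open>0 < y\<close> by (simp only: norm_of_real)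
  finally have n: "norm \<phi> \<le> (17/32) * y" using \<phi> by simp
  have "(norm \<phi>)\<^sup>2 \<le> ((17/32) * y)\<^sup>2"
    using n by (intro power_mono) auto
  also have "\<dots> \<le> (5/16) * y\<^sup>2"
    by (simp add: power_mult_distrib power2_eq_square)
  finally have n2: "(norm \<phi>)\<^sup>2 \<le> (5/16) * y\<^sup>2" .
  have "\<phi> \<noteq> 0" using re \<open>0 < y\<close> by auto
  then have pos: "0 < (norm \<phi>)\<^sup>2" by simp
  have "2 * y * Re \<phi> \<le> 2 * y * (- (15/32) * y)"
    by (intro mult_left_mono re) (use \<open>0 < y\<close> in auto)
  also have "\<dots> = -(15/16) * y\<^sup>2" by (simp add: power2_eq_square)
  also have "\<dots> \<le> -3 * (norm \<phi>)\<^sup>2" using n2 by simp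
  finally have "2 * y * Re \<phi> / (norm \<phi>)\<^sup>2 \<le> -3"
    using pos by (simp add: divide_le_eq)
  then show ?thesis
    by (simp add: cmod_power2)
qed

text \<open>N stands for h', as N' = P N. Where 2 y Re P \<le> -3, the product |N|^2 y^3 is
  nonincreasing, so towards the boundary |N| grows at least like y^(-3/2) and outruns the bound C/y.
  Comparing X with \<delta> gives c^2 \<delta>^3 \<le> C^2 X, which fails for small x since X is a
  fixed multiple of x.\<close>

lemma riccati_smallness:
  fixes P S N :: "real \<Rightarrow> complex"
  assumes "0 < \<delta>" "0 < \<epsilon>" "\<epsilon> \<le> 1" "0 < C" "0 < c"
    and P': "\<And>u. 0 < u \<Longrightarrow> u \<le> \<delta> \<Longrightarrow> (P has_vector_derivative S u + (P u)\<^sup>2 / 2) (at u)"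
    and N': "\<And>u. 0 < u \<Longrightarrow> u \<le> \<delta> \<Longrightarrow> (N has_vector_derivative P u * N u) (at u)"
    and S: "\<And>u. 0 < u \<Longrightarrow> u \<le> \<delta> \<Longrightarrow> u\<^sup>2 * norm (S u) \<le> \<epsilon>\<^sup>2 / 64"
    and C: "\<And>u. 0 < u \<Longrightarrow> u \<le> \<delta> \<Longrightarrow> u * norm (N u) \<le> C"
    and c: "c \<le> norm (N \<delta>)"
    and x: "0 < x" "128 * x < \<epsilon> * \<delta>" "128 * x < \<epsilon> * (c\<^sup>2 * \<delta>^3 / C\<^sup>2)"
  shows "x * norm (P x) \<le> \<epsilon>"
proof (rule ccontr)
  assume neg: "\<not> ?thesis"
  have "\<epsilon> * \<delta> \<le> 1 * \<delta>" using assms by (intro mult_right_mono) auto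
  then have xd: "x \<le> \<delta>" using x by simp
  have big: "\<epsilon> < y * norm (P y)" if "x \<le> y" "y \<le> \<delta>" for y
    using inverse_riccati_persistence[of x \<delta> \<epsilon> P S y] assms neg that xd by auto
  \<comment> \<open>Beyond X the initial value of 1/P no longer matters: for y \<ge> X the errors (y
    - x)/64, x/\<epsilon> = X/128 and x/2 \<le> X/256 add up to less than y/32.\<close>
  define X where "X = 128 * x / \<epsilon>"
  have X: "X \<le> \<delta>" "X < c\<^sup>2 * \<delta>^3 / C\<^sup>2" "0 < X"
    using x \<open>0 < \<epsilon>\<close> by (auto simp: X_def field_simps)
  have "128 * x * \<epsilon> \<le> 128 * x * 1" using assms by (intro mult_left_mono) auto
  then have xX: "x \<le> X" using \<open>0 < \<epsilon>\<close> \<open>0 < x\<close> by (simp add: X_def field_simps)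
  have Re: "2 * y * Re (P y) \<le> -3" if y: "X \<le> y" "y \<le> \<delta>" for y
  proof -
    have y': "x \<le> y" using xX y by linarith
    have "norm ((inverse (P y) + of_real y / 2) - (inverse (P x) + of_real x / 2)) \<le> (y - x) / 64"
      by (rule inverse_riccati_estimate[of x y \<epsilon> P S]) (use assms y y' big in \<open>auto intro: less_imp_le\<close>)
    moreover have "norm (inverse (P x)) < x / \<epsilon>"
    proof -
      have "\<epsilon> < x * norm (P x)" using big[of x] xd by simp
      moreover from this have "P x \<noteq> 0" using \<open>0 < \<epsilon>\<close> by auto
      ultimately show ?thesis
        using \<open>0 < \<epsilon>\<close> \<open>0 < x\<close> by (simp add: norm_inverse norm_divide field_simps)
    qed
    moreover have "norm (inverse (P y) + of_real y / 2) \<le>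
        norm ((inverse (P y) + of_real y / 2) - (inverse (P x) + of_real x / 2)) + (norm (inverse (P x)) + norm (complex_of_real (x / 2)))"
    proof -
      have "norm (inverse (P y) + of_real y / 2) \<le> norm ((inverse (P y) + of_real y / 2) - (inverse (P x) + of_real x / 2))
           + norm (inverse (P x) + of_real (x / 2))"
        by (metis norm_triangle_sub add.commute of_real_divide of_real_numeral)
      also have "norm (inverse (P x) + of_real (x / 2)) \<le> norm (inverse (P x)) + norm (complex_of_real (x / 2))"
        by (rule norm_triangle_ineq)
      finally show ?thesis by simp
    qed
    moreover have "norm (complex_of_real (x / 2)) = x / 2"
      using \<open>0 < x\<close> by (simp only: norm_of_real)
    moreover have "x / \<epsilon> = X / 128" by (simp add: X_def)
    moreover have "x * \<epsilon> \<le> x * 1" using assms by (intro mult_left_mono) auto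
    then have "x \<le> X / 128" using \<open>0 < \<epsilon>\<close> by (simp add: X_def field_simps)
    ultimately have "norm (inverse (P y) + of_real y / 2) \<le> y / 32"
      using y X(3) \<open>0 < x\<close> by argo
    from Re_inverse_near_neg_half[OF _ this] show ?thesis
      using X y by simp
  qed
  define M where "M = (\<lambda>y. (N y \<bullet> N y) * y ^ 3)"
  have "M \<delta> \<le> M X"
  proof (rule DERIV_nonpos_imp_nonincreasing[OF X(1)])
    fix y assume y: "X \<le> y" "y \<le> \<delta>"
    then have y0: "0 < y" using X by linarith
    have N'': "(N has_derivative (\<lambda>h. h *\<^sub>R (P y * N y))) (at y)"
      using N'[OF y0 y(2)] by (simp add: has_vector_derivative_def)
    have ip: "N y \<bullet> (P y * N y) = Re (P y) * (N y \<bullet> N y)"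
      unfolding inner_complex_def by (simp add: algebra_simps power2_eq_square)
    from ip have ip': "N y \<bullet> (N y * P y) = Re (P y) * (N y \<bullet> N y)"
      by (simp add: mult.commute)
    have "(M has_real_derivative (2 * y * Re (P y) + 3) * (N y \<bullet> N y) * y\<^sup>2) (at y)"
      unfolding M_def has_field_derivative_def
      by (rule has_derivative_eq_rhs, (rule derivative_intros N'')+)
        (simp add: fun_eq_iff ip ip' inner_commute[of "P y * N y" "N y"] inner_commute[of "N y * P y" "N y"]
           power3_eq_cube power2_eq_square algebra_simps)
    moreover have "(2 * y * Re (P y) + 3) * (N y \<bullet> N y) * y\<^sup>2 \<le> 0"
      using Re[OF y] by (intro mult_nonpos_nonneg) auto
    ultimately show "\<exists>m. (M has_real_derivative m) (at y) \<and> m \<le> 0" by blast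
  qed
  then have "(norm (N \<delta>))\<^sup>2 * \<delta>^3 \<le> (X * norm (N X))\<^sup>2 * X"
    unfolding power_mult_distrib power2_norm_eq_inner by (simp add: M_def power3_eq_cube power2_eq_square algebra_simps)
  also have "\<dots> \<le> C\<^sup>2 * X"
    using C[of X] X by (intro mult_right_mono power_mono) auto
  finally have "(norm (N \<delta>))\<^sup>2 * \<delta>^3 \<le> C\<^sup>2 * X" .
  moreover have "c\<^sup>2 * \<delta>^3 \<le> (norm (N \<delta>))\<^sup>2 * \<delta>^3"
    using c assms by (intro mult_right_mono power_mono) auto
  ultimately have "c\<^sup>2 * \<delta>^3 \<le> C\<^sup>2 * X" by simp
  with X(2) \<open>0 < C\<close> show False by (simp add: field_simps)
qed


section \<open>Riccati bounds and logarithms on the half-plane\<close>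

lemma open_right_half_plane [simp]: "open \<H>"
  by (simp add: right_half_plane_def open_halfspace_Re_gt)

lemma convex_right_half_plane [simp]: "convex \<H>"
  by (simp add: right_half_plane_def convex_halfspace_Re_gt)

lemma deriv_univalent_nonzero:
  assumes "univalent_on f S" "open S" "z \<in> S"
  shows "deriv f z \<noteq> 0"
  using assms holomorphic_injective_imp_regular unfolding univalent_on_def by blast

lemma holomorphic_pre_Schwarzian:
  assumes "f holomorphic_on S" "open S" "\<And>z. z \<in> S \<Longrightarrow> deriv f z \<noteq> 0"
  shows "pre_Schwarzian f holomorphic_on S"
  unfolding pre_Schwarzian_def[abs_def] by (intro holomorphic_intros assms)

text \<open>The threshold \<eta> depends only on \<delta>, \<epsilon>, C and c, so it serves all
  horizontal lines with height in Y at once. Y is a parameter because both bounded intervals of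
  heights and all heights occur later.\<close>

lemma riccati_smallness_half_plane:
  assumes f: "f holomorphic_on \<H>" "\<And>z. z \<in> \<H> \<Longrightarrow> deriv f z \<noteq> 0"
    and "0 < \<delta>" "0 < \<epsilon>" "\<epsilon> \<le> 1" "0 < C" "0 < c"
    and S: "\<And>z. 0 < Re z \<Longrightarrow> Re z \<le> \<delta> \<Longrightarrow> Im z \<in> Y \<Longrightarrow> (Re z)\<^sup>2 * norm (Schwarzian f z) \<le> \<epsilon>\<^sup>2 / 64"
    and C: "\<And>z. 0 < Re z \<Longrightarrow> Re z \<le> \<delta> \<Longrightarrow> Im z \<in> Y \<Longrightarrow> Re z * norm (deriv f z) \<le> C"
    and c: "\<And>y. y \<in> Y \<Longrightarrow> c \<le> norm (deriv f (Complex \<delta> y))"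
  obtains \<eta> where "0 < \<eta>" "\<eta> \<le> \<delta>"
    "\<And>z. 0 < Re z \<Longrightarrow> Re z \<le> \<eta> \<Longrightarrow> Im z \<in> Y \<Longrightarrow> Re z * norm (pre_Schwarzian f z) \<le> \<epsilon>"
proof -
  define m where "m = min \<delta> (\<epsilon> * min \<delta> (c\<^sup>2 * \<delta>^3 / C\<^sup>2) / 256)"
  have min_pos: "0 < min \<delta> (c\<^sup>2 * \<delta>^3 / C\<^sup>2)" using assms by simp
  then have "0 < \<epsilon> * min \<delta> (c\<^sup>2 * \<delta>^3 / C\<^sup>2) / 256" using assms by simp
  then have "0 < m" "m \<le> \<delta>" using assms by (auto simp: m_def)
  moreover have "Re z * norm (pre_Schwarzian f z) \<le> \<epsilon>" if z: "0 < Re z" "Re z \<le> m" "Im z \<in> Y" for z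
  proof -
    have line: "((\<lambda>u. g (Complex u (Im z))) has_vector_derivative deriv g (Complex u (Im z))) (at u)"
      if "g holomorphic_on \<H>" "0 < u" for g u
    proof -
      have "(g has_field_derivative deriv g (Complex u (Im z))) (at (Complex u (Im z)))"
        using that holomorphic_derivI[of g \<H>] by (simp add: right_half_plane_def open_halfspace_Re_gt)
      moreover have "((\<lambda>u. Complex u (Im z)) has_vector_derivative 1) (at u)"
        by (auto simp: complex_eq_iff has_vector_derivative_complex_iff intro!: derivative_eq_intros)
      ultimately show ?thesis
        using field_vector_diff_chain_at[of "\<lambda>u. Complex u (Im z)" 1 u g] by (simp add: o_def)
    qed
    have "128 * Re z < \<epsilon> * min \<delta> (c\<^sup>2 * \<delta>^3 / C\<^sup>2)"
      using z min_pos assms by (simp add: m_def)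
    moreover have "\<epsilon> * min \<delta> (c\<^sup>2 * \<delta>^3 / C\<^sup>2) \<le> \<epsilon> * \<delta>"
      "\<epsilon> * min \<delta> (c\<^sup>2 * \<delta>^3 / C\<^sup>2) \<le> \<epsilon> * (c\<^sup>2 * \<delta>^3 / C\<^sup>2)"
      using assms by (intro mult_left_mono; simp)+
    ultimately have sm: "128 * Re z < \<epsilon> * \<delta>" "128 * Re z < \<epsilon> * (c\<^sup>2 * \<delta>^3 / C\<^sup>2)" by linarith+
    have "Re z * norm (pre_Schwarzian f (Complex (Re z) (Im z))) \<le> \<epsilon>"
    proof (rule riccati_smallness[where S = "\<lambda>u. Schwarzian f (Complex u (Im z))"
           and N = "\<lambda>u. deriv f (Complex u (Im z))" and C = C and c = c and \<delta> = \<delta>])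
      fix u assume u: "0 < u" "u \<le> \<delta>"
      show "((\<lambda>u. pre_Schwarzian f (Complex u (Im z))) has_vector_derivative
         Schwarzian f (Complex u (Im z)) + (pre_Schwarzian f (Complex u (Im z)))\<^sup>2 / 2) (at u)"
        using line[OF holomorphic_pre_Schwarzian[OF f(1) _ f(2)] u(1)] by (simp add: Schwarzian_def)
      show "((\<lambda>u. deriv f (Complex u (Im z))) has_vector_derivative
         pre_Schwarzian f (Complex u (Im z)) * deriv f (Complex u (Im z))) (at u)"
        using line[of "deriv f" u] f u
        by (simp add: pre_Schwarzian_def right_half_plane_def holomorphic_deriv open_halfspace_Re_gt)
      show "u\<^sup>2 * norm (Schwarzian f (Complex u (Im z))) \<le> \<epsilon>\<^sup>2 / 64"
        using S[of "Complex u (Im z)"] u z by simp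
      show "u * norm (deriv f (Complex u (Im z))) \<le> C"
        using C[of "Complex u (Im z)"] u z by simp
    qed (use assms z sm in auto)
    then show ?thesis by simp
  qed
  ultimately show ?thesis using that by blast
qed

lemma holomorphic_log_right_half_plane:
  assumes "A holomorphic_on \<H>" "\<And>z. z \<in> \<H> \<Longrightarrow> A z \<noteq> 0"
  obtains \<Lambda> where "\<And>z. z \<in> \<H> \<Longrightarrow> A z = exp (\<Lambda> z)"
    "\<And>z. z \<in> \<H> \<Longrightarrow> (\<Lambda> has_field_derivative deriv A z / A z) (at z)"
proof -
  obtain \<Lambda> where L: "\<Lambda> holomorphic_on \<H>" "\<And>z. z \<in> \<H> \<Longrightarrow> A z = exp (\<Lambda> z)"
    using contractible_imp_holomorphic_log[OF assms(1)] convex_imp_contractible[OF convex_right_half_plane] assms(2)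
    by blast
  have "(\<Lambda> has_field_derivative deriv A z / A z) (at z)" if z: "z \<in> \<H>" for z
  proof -
    have D: "(\<Lambda> has_field_derivative deriv \<Lambda> z) (at z)"
      using L(1) z holomorphic_derivI by auto
    then have "((\<lambda>w. exp (\<Lambda> w)) has_field_derivative exp (\<Lambda> z) * deriv \<Lambda> z) (at z)"
      by (auto intro!: derivative_eq_intros)
    then have "(A has_field_derivative exp (\<Lambda> z) * deriv \<Lambda> z) (at z)"
      by (rule has_field_derivative_transform_within_open[of _ _ _ \<H>]) (use z L(2) in auto)
    then have "deriv A z = A z * deriv \<Lambda> z" using L(2)[OF z] by (simp add: DERIV_imp_deriv)
    then have "deriv A z / A z = deriv \<Lambda> z" using assms(2)[OF z] by simp
    with D show ?thesis by simp
  qed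
  with L that show ?thesis by blast
qed

section \<open>Near-isometries of the half-plane\<close>

lemma log_growth_estimate:
  fixes \<Lambda> \<Lambda>' :: "complex \<Rightarrow> complex" and s d \<epsilon> :: real
  assumes "z \<in> \<H>" and s: "0 < s" "s \<le> d"
    and L': "\<And>w. w \<in> \<H> \<Longrightarrow> (\<Lambda> has_field_derivative \<Lambda>' w) (at w)"
    and bd: "\<And>s. 0 < s \<Longrightarrow> s \<le> d \<Longrightarrow> norm (\<Lambda>' (z + of_real s)) \<le> \<epsilon> / s"
  shows "norm (\<Lambda> (z + of_real s) - \<Lambda> (z + of_real d)) \<le> \<epsilon> * ln d - \<epsilon> * ln s"
proof (cases "s = d")
  case False
  have inH: "z + of_real s \<in> \<H>" if "0 \<le> s" for s
    using assms(1) that by (simp add: right_half_plane_def)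
  have shift: "((\<lambda>s. z + of_real s) has_vector_derivative 1) (at s)" for s
    by (auto intro!: derivative_eq_intros has_vector_derivative_real_field)
  have der: "((\<lambda>u. \<Lambda> (z + of_real u)) has_vector_derivative \<Lambda>' (z + of_real u)) (at u)" if "0 \<le> u" for u
    using field_vector_diff_chain_at[OF shift L'[OF inH[OF that]]] by (simp add: o_def)
  have "norm (\<Lambda> (z + of_real d) - \<Lambda> (z + of_real s)) \<le> \<epsilon> * ln d - \<epsilon> * ln s"
  proof (rule differentiable_bound_general[where f = "\<lambda>u. \<Lambda> (z + of_real u)" and \<phi> = "\<lambda>u. \<epsilon> * ln u"
        and f' = "\<lambda>u. \<Lambda>' (z + of_real u)" and \<phi>' = "\<lambda>u. \<epsilon> / u"])
    show "continuous_on {s..d} (\<lambda>u. \<Lambda> (z + of_real u))"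
      by (rule continuous_on_vector_derivative[OF has_vector_derivative_at_within[OF der]]) (use s in auto)
  next
    fix u assume "s < u" "u < d"
    then have "((\<lambda>u. \<epsilon> * ln u) has_real_derivative \<epsilon> * (1 / u)) (at u)"
      using s by (intro DERIV_cmult DERIV_ln_divide) auto
    then show "((\<lambda>u. \<epsilon> * ln u) has_vector_derivative \<epsilon> / u) (at u)"
      by (simp flip: has_real_derivative_iff_has_vector_derivative)
  qed (use s False bd der in \<open>auto intro!: continuous_intros\<close>)
  then show ?thesis by (simp add: norm_minus_commute)
qed simp

text \<open>At distance s from z, the derivative of f deviates from \<open>A (z + of_real d)\<close>
  by at most the relative amount (1 + \<epsilon>)(d/s)^\<epsilon> - 1. Although this is unbounded as
  s tends to 0, its integral over (0, d) is 2\<epsilon>d/(1 - \<epsilon>).\<close>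

lemma rightward_displacement_estimate:
  fixes f A B \<Lambda> \<Lambda>' :: "complex \<Rightarrow> complex" and d \<epsilon> :: real
  assumes "0 < d" "z \<in> \<H>" "0 \<le> \<epsilon>" "\<epsilon> < 1"
    and f': "\<And>w. w \<in> \<H> \<Longrightarrow> (f has_field_derivative A w * B w) (at w)"
    and A: "\<And>w. w \<in> \<H> \<Longrightarrow> A w = exp (\<Lambda> w)"
    and L': "\<And>w. w \<in> \<H> \<Longrightarrow> (\<Lambda> has_field_derivative \<Lambda>' w) (at w)"
    and B: "\<And>w. w \<in> \<H> \<Longrightarrow> norm (B w - 1) \<le> \<epsilon>"
    and bd: "\<And>s. 0 < s \<Longrightarrow> s \<le> d \<Longrightarrow> norm (\<Lambda>' (z + of_real s)) \<le> \<epsilon> / s"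
  shows "norm (f (z + of_real d) - f z - of_real d * A (z + of_real d))
           \<le> norm (A (z + of_real d)) * (d * (2 * \<epsilon> / (1 - \<epsilon>)))"
proof -
  have inH: "z + of_real s \<in> \<H>" if "0 \<le> s" for s
    using assms(2) that by (simp add: right_half_plane_def)
  have shift: "((\<lambda>s. z + of_real s) has_vector_derivative 1) (at s)" for s
    by (auto intro!: derivative_eq_intros has_vector_derivative_real_field)
  have Ldiff: "norm (\<Lambda> (z + of_real s) - \<Lambda> (z + of_real d)) \<le> \<epsilon> * ln d - \<epsilon> * ln s" if s: "0 < s" "s \<le> d" for s
    by (rule log_growth_estimate[where \<Lambda>' = \<Lambda>']) (use assms s in auto)
  define Ad where "Ad = A (z + of_real d)"
  \<comment> \<open>An explicit primitive of the bound \<open>\<phi>'\<close>; it is continuous up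
    to 0 because 1 - \<epsilon> > 0.\<close>
  define \<phi> where "\<phi> = (\<lambda>s. (1 + \<epsilon>) * d powr \<epsilon> / (1 - \<epsilon>) * s powr (1 - \<epsilon>) - s)"
  define \<phi>' where "\<phi>' = (\<lambda>s. (1 + \<epsilon>) * d powr \<epsilon> * s powr (- \<epsilon>) - 1)"
  have bound: "norm (A (z + of_real s) * B (z + of_real s) - Ad) \<le> norm Ad * \<phi>' s" if s: "0 < s" "s < d" for s
  proof -
    define r where "r = \<epsilon> * ln d - \<epsilon> * ln s"
    define D where "D = \<Lambda> (z + of_real s) - \<Lambda> (z + of_real d)"
    have D: "norm D \<le> r" using Ldiff s by (simp add: D_def r_def)
    have er: "exp r = d powr \<epsilon> * s powr (- \<epsilon>)"
      using s \<open>0 < d\<close> by (simp add: r_def powr_def exp_diff exp_minus field_simps)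
    have As: "A (z + of_real s) = Ad * exp D"
      using A[OF inH] s \<open>0 < d\<close> by (simp add: Ad_def D_def exp_diff)
    have "norm (exp D * B (z + of_real s) - 1) = norm (exp D * (B (z + of_real s) - 1) + (exp D - 1))"
      by (simp add: algebra_simps)
    also have "\<dots> \<le> norm (exp D) * norm (B (z + of_real s) - 1) + norm (exp D - 1)"
      by (metis norm_triangle_ineq norm_mult)
    also have "\<dots> \<le> exp r * \<epsilon> + (exp r - 1)"
    proof (intro add_mono mult_mono)
      show "norm (exp D) \<le> exp r" using D norm_exp[of D] by (meson exp_le_cancel_iff order_trans)
      show "norm (exp D - 1) \<le> exp r - 1" using norm_exp_minus_1_le[of D] D
        by (smt (verit) exp_le_cancel_iff)
      show "norm (B (z + of_real s) - 1) \<le> \<epsilon>" using B inH s by simp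
    qed auto
    also have "\<dots> = \<phi>' s" by (simp add: \<phi>'_def er algebra_simps)
    finally have "norm Ad * norm (exp D * B (z + of_real s) - 1) \<le> norm Ad * \<phi>' s"
      by (intro mult_left_mono) auto
    then show ?thesis by (simp add: As algebra_simps flip: norm_mult)
  qed
  have derf: "((\<lambda>s. f (z + of_real s) - of_real s * Ad) has_vector_derivative A (z + of_real s) * B (z + of_real s) - Ad) (at s)"
    if "0 \<le> s" for s
  proof -
    have "((\<lambda>s. f (z + of_real s)) has_vector_derivative A (z + of_real s) * B (z + of_real s)) (at s)"
      using field_vector_diff_chain_at[OF shift f'[OF inH[OF that]]] by (simp add: o_def)
    moreover have "((\<lambda>s. of_real s * Ad) has_vector_derivative Ad) (at s)"
      by (auto intro!: derivative_eq_intros has_vector_derivative_real_field)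
    ultimately show ?thesis by (rule has_vector_derivative_diff)
  qed
  have "norm ((f (z + of_real d) - of_real d * Ad) - (f (z + of_real 0) - of_real 0 * Ad)) \<le> norm Ad * \<phi> d - norm Ad * \<phi> 0"
  proof (rule differentiable_bound_general[where f = "\<lambda>s. f (z + of_real s) - of_real s * Ad" and \<phi> = "\<lambda>s. norm Ad * \<phi> s"
        and f' = "\<lambda>s. A (z + of_real s) * B (z + of_real s) - Ad" and \<phi>' = "\<lambda>s. norm Ad * \<phi>' s"])
    show "continuous_on {0..d} (\<lambda>s. f (z + of_real s) - of_real s * Ad)"
      by (rule continuous_on_vector_derivative) (use derf has_vector_derivative_at_within in \<open>fastforce\<close>)
    show "continuous_on {0..d} (\<lambda>s. norm Ad * \<phi> s)"
      unfolding \<phi>_def using assms by (intro continuous_intros continuous_on_powr') auto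
  next
    fix s assume s: "0 < s" "s < d"
    have "(\<phi> has_real_derivative (1 + \<epsilon>) * d powr \<epsilon> / (1 - \<epsilon>) * ((1 - \<epsilon>) * s powr ((1 - \<epsilon>) - 1)) - 1) (at s)"
      unfolding \<phi>_def using s by (intro DERIV_diff DERIV_cmult has_real_derivative_powr DERIV_ident)
    moreover have "(1 + \<epsilon>) * d powr \<epsilon> / (1 - \<epsilon>) * ((1 - \<epsilon>) * s powr ((1 - \<epsilon>) - 1)) - 1 = \<phi>' s"
      using assms by (simp add: \<phi>'_def)
    ultimately have "((\<lambda>s. norm Ad * \<phi> s) has_real_derivative norm Ad * \<phi>' s) (at s)"
      by (intro DERIV_cmult) simp
    then show "((\<lambda>s. norm Ad * \<phi> s) has_vector_derivative norm Ad * \<phi>' s) (at s)"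
      by (simp flip: has_real_derivative_iff_has_vector_derivative)
  qed (use assms derf bound in auto)
  moreover have "\<phi> d = d * (2 * \<epsilon> / (1 - \<epsilon>))" "\<phi> 0 = 0"
  proof -
    have "d powr \<epsilon> * d powr (1 - \<epsilon>) = d"
      using \<open>0 < d\<close> by (simp flip: powr_add)
    then have "\<phi> d = (1 + \<epsilon>) / (1 - \<epsilon>) * d - d"
      by (simp add: \<phi>_def)
    then show "\<phi> d = d * (2 * \<epsilon> / (1 - \<epsilon>))" using assms by (simp add: field_simps)
    show "\<phi> 0 = 0" by (simp add: \<phi>_def)
  qed
  ultimately show ?thesis
    by (simp add: Ad_def algebra_simps)
qed

text \<open>
  The path from \<open>z\<^sub>1\<close> to \<open>z\<^sub>2\<close> first moves right by \<open>d\<close>, then straight across, then back left: along the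
  horizontal pieces \<open>\<Lambda>'\<close> is only bounded by \<open>1 / (32 s)\<close> at distance \<open>s\<close> from the starting point, but the
  resulting growth \<open>(d / s) powr (1/32)\<close> of \<open>A\<close> is integrable. A straight segment would not do, since
  its points may all be much closer to the boundary than \<open>d\<close>.
\<close>

lemma near_isometry_estimate:
  fixes f A B \<Lambda> \<Lambda>' :: "complex \<Rightarrow> complex" and d :: real
  assumes d: "d = norm (z\<^sub>1 - z\<^sub>2)" and z: "z\<^sub>1 \<in> \<H>" "z\<^sub>2 \<in> \<H>"
    and f': "\<And>w. w \<in> \<H> \<Longrightarrow> (f has_field_derivative A w * B w) (at w)"
    and A: "\<And>w. w \<in> \<H> \<Longrightarrow> A w = exp (\<Lambda> w)"
    and L': "\<And>w. w \<in> \<H> \<Longrightarrow> (\<Lambda> has_field_derivative \<Lambda>' w) (at w)"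
    and B: "\<And>w. w \<in> \<H> \<Longrightarrow> norm (B w - 1) \<le> 1/32"
    and bd: "\<And>s. 0 < s \<Longrightarrow> s \<le> d \<Longrightarrow> norm (\<Lambda>' (z\<^sub>1 + of_real s)) \<le> (1/32) / s"
            "\<And>s. 0 < s \<Longrightarrow> s \<le> d \<Longrightarrow> norm (\<Lambda>' (z\<^sub>2 + of_real s)) \<le> (1/32) / s"
    and seg: "\<And>w. w \<in> closed_segment (z\<^sub>1 + of_real d) (z\<^sub>2 + of_real d) \<Longrightarrow> norm (\<Lambda>' w) \<le> (1/32) / d"
  shows "norm (f z\<^sub>1 - f z\<^sub>2 - A (z\<^sub>1 + of_real d) * (z\<^sub>1 - z\<^sub>2)) \<le> norm (A (z\<^sub>1 + of_real d)) * d / 2"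
proof (cases "z\<^sub>1 = z\<^sub>2")
  case False
  then have d0: "0 < d" using d by simp
  define p q where "p = z\<^sub>1 + of_real d" and "q = z\<^sub>2 + of_real d"
  have pq: "p \<in> \<H>" "q \<in> \<H>" using z d0 by (auto simp: p_def q_def right_half_plane_def)
  define S where "S = closed_segment p q"
  have SH: "S \<subseteq> \<H>" unfolding S_def using pq by (intro closed_segment_subset) auto
  have S: "convex S" "p \<in> S" "q \<in> S" by (auto simp: S_def)
  have npq: "norm (w - p) \<le> d" if "w \<in> S" for w
    using segment_bound(1)[of w p q] that by (simp add: S_def d p_def q_def norm_minus_commute)
  have Ldiff: "norm (\<Lambda> w - \<Lambda> p) \<le> 1/32" if w: "w \<in> S" for w
  proof -
    have "norm (\<Lambda> w - \<Lambda> p) \<le> (1/32) / d * norm (w - p)"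
      by (rule field_differentiable_bound[OF S(1), where f' = \<Lambda>'])
        (use w SH L' seg S in \<open>auto simp: S_def p_def q_def intro: has_field_derivative_at_within\<close>)
    also have "\<dots> \<le> (1/32) / d * d" using npq[OF w] d0 by (intro mult_left_mono) auto
    finally show ?thesis using d0 by simp
  qed
  have e1: "norm (exp D - 1) \<le> 1/16" "norm (exp D) \<le> 17/16" if "norm D \<le> 1/32" for D :: complex
  proof -
    have "exp (norm D) \<le> exp (1/32)" using that by simp
    also have "\<dots> \<le> 1 + 2 * (1/32)" by (rule real_exp_bound_lemma) auto
    finally have "exp (norm D) \<le> 17/16" by simp
    then show "norm (exp D - 1) \<le> 1/16" "norm (exp D) \<le> 17/16"
      using norm_exp_minus_1_le[of D] norm_exp[of D] by linarith+
  qed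
  have Aw: "A w = A p * exp (\<Lambda> w - \<Lambda> p)" if "w \<in> S" for w
    using A SH that S by (simp add: exp_diff subset_iff)
  have bound: "norm (A w * B w - A p) \<le> norm (A p) / 8" if w: "w \<in> S" for w
  proof -
    define D where "D = \<Lambda> w - \<Lambda> p"
    have "norm (exp D * B w - 1) = norm (exp D * (B w - 1) + (exp D - 1))"
      by (simp add: algebra_simps)
    also have "\<dots> \<le> norm (exp D) * norm (B w - 1) + norm (exp D - 1)"
      by (metis norm_triangle_ineq norm_mult)
    also have "\<dots> \<le> (17/16) * (1/32) + 1/16"
      using e1[of D] Ldiff[OF w] B[of w] w SH by (intro add_mono mult_mono) (auto simp: D_def)
    finally have "norm (A p) * norm (exp D * B w - 1) \<le> norm (A p) * (1/8)"
      by (intro mult_left_mono) auto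
    then show ?thesis by (simp add: Aw[OF w] D_def[symmetric] algebra_simps flip: norm_mult)
  qed
  have 1: "norm (f p - f q - A p * (z\<^sub>1 - z\<^sub>2)) \<le> norm (A p) * d / 8"
  proof -
    have "norm ((f p - A p * p) - (f q - A p * q)) \<le> norm (A p) / 8 * norm (p - q)"
      by (rule field_differentiable_bound[OF S(1), where f' = "\<lambda>w. A w * B w - A p" and f = "\<lambda>w. f w - A p * w"])
        (use S SH f' bound in \<open>auto intro!: derivative_eq_intros intro: has_field_derivative_at_within\<close>)
    moreover have "(f p - A p * p) - (f q - A p * q) = f p - f q - A p * (p - q)"
      by (simp add: algebra_simps)
    moreover have "p - q = z\<^sub>1 - z\<^sub>2" by (simp add: p_def q_def)
    ultimately show ?thesis using d by simp
  qed
  have 2: "norm (A q - A p) \<le> norm (A p) / 16"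
  proof -
    have "norm (A p) * norm (exp (\<Lambda> q - \<Lambda> p) - 1) \<le> norm (A p) * (1/16)"
      using e1[OF Ldiff[OF S(3)]] by (intro mult_left_mono) auto
    then show ?thesis by (simp add: Aw[OF S(3)] algebra_simps flip: norm_mult)
  qed
  have 3: "norm (f p - f z\<^sub>1 - of_real d * A p) \<le> norm (A p) * (d * (2 * (1/32) / (1 - 1/32)))"
    unfolding p_def by (rule rightward_displacement_estimate[where B = B and \<Lambda> = \<Lambda> and \<Lambda>' = \<Lambda>'])
      (use z d0 f' A L' B bd in auto)
  have 4: "norm (f q - f z\<^sub>2 - of_real d * A q) \<le> norm (A q) * (d * (2 * (1/32) / (1 - 1/32)))"
    unfolding q_def by (rule rightward_displacement_estimate[where B = B and \<Lambda> = \<Lambda> and \<Lambda>' = \<Lambda>'])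
      (use z d0 f' A L' B bd in auto)
  have "norm (A q) \<le> norm (A p) + norm (A q - A p)" by (rule norm_triangle_sub)
  then have Aq: "norm (A q) \<le> norm (A p) * (17/16)" using 2 by simp
  have 5: "norm (of_real d * (A q - A p)) \<le> norm (A p) * d / 16"
    using mult_left_mono[OF 2, of d] d0 by (simp add: norm_mult mult.commute)
  \<comment> \<open>The four pieces contribute 1/8, 2/31, (17/16)(2/31) and 1/16, each times |A p|
    d. Any total below 1 would exclude \<open>f z\<^sub>1 = f z\<^sub>2\<close>; the value 1/2 also
    gives the upper bound 3/2 |A p| d used for uniform continuity.\<close>
  have "f z\<^sub>1 - f z\<^sub>2 - A p * (z\<^sub>1 - z\<^sub>2) =
     (f p - f q - A p * (z\<^sub>1 - z\<^sub>2)) - (f p - f z\<^sub>1 - of_real d * A p) + (f q - f z\<^sub>2 - of_real d * A q)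
       + of_real d * (A q - A p)"
    unfolding right_diff_distrib by simp
  then have "norm (f z\<^sub>1 - f z\<^sub>2 - A p * (z\<^sub>1 - z\<^sub>2)) \<le>
     norm (f p - f q - A p * (z\<^sub>1 - z\<^sub>2)) + norm (f p - f z\<^sub>1 - of_real d * A p) + norm (f q - f z\<^sub>2 - of_real d * A q)
       + norm (of_real d * (A q - A p))"
    by (simp only:) (intro norm_triangle_le norm_triangle_le_diff add_mono order_refl)
  also have "\<dots> \<le> norm (A p) * d / 8 + norm (A p) * (d * (2/31)) + norm (A p) * (17/16) * (d * (2/31)) + norm (A p) * d / 16"
  proof -
    have "norm (A q) * (d * (2/31)) \<le> norm (A p) * (17/16) * (d * (2/31))"
      using Aq d0 by (intro mult_right_mono) auto
    then show ?thesis using 1 3 4 5 by (simp add: mult_ac)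
  qed
  also have "\<dots> = (1/8 + 2/31 + 17/16 * (2/31) + 1/16) * (norm (A p) * d)" by (simp add: algebra_simps)
  also have "\<dots> \<le> (1/2) * (norm (A p) * d)"
    using d0 by (intro mult_right_mono) auto
  finally show ?thesis by (simp add: p_def)
qed (use d in auto)

section \<open>Injectivity of boundary extensions to Jordan domains\<close>

lemma connected_punctured_circle_image:
  assumes "J homeomorphic sphere (0::complex) 1" "p \<in> J"
  shows "connected (J - {p})"
proof -
  obtain f g where fg: "homeomorphism J (sphere (0::complex) 1) f g"
    using assms(1) by (auto simp: homeomorphic_def)
  have fp: "f p \<in> sphere 0 1"
    using fg assms(2) by (auto simp: homeomorphism_def)
  have "sphere (0::complex) 1 - {f p} homeomorphic {x. (1::complex) \<bullet> x = 0}"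
    by (rule homeomorphic_punctured_sphere_hyperplane) (use fp in auto)
  then have "connected (sphere (0::complex) 1 - {f p})"
    using homeomorphic_connectedness convex_connected convex_hyperplane by blast
  moreover have "homeomorphism (J - {p}) (sphere 0 1 - {f p}) f g"
  proof (rule homeomorphism_of_subsets[OF fg])
    show "f ` (J - {p}) = sphere 0 1 - {f p}"
    proof -
      have "inj_on f J" using fg unfolding homeomorphism_def by (metis inj_on_inverseI)
      then have "f ` (J - {p}) = f ` J - f ` {p}"
        using assms(2) by (intro inj_on_image_set_diff) auto
      then show ?thesis using fg by (simp add: homeomorphism_image1)
    qed
  qed auto
  ultimately show ?thesis
    using homeomorphic_connectedness homeomorphic_def by blast
qed

text \<open>If G e = G z with |z| < 1, the open mapping theorem makes the image of a small disc
  around z a neighbourhood of G e. Points approaching e radially have values in it although they lie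
  outside that disc, against injectivity.\<close>

lemma injective_holomorphic_boundary_values:
  fixes G :: "complex \<Rightarrow> complex"
  assumes cont: "continuous_on (cball 0 1) G" and hol: "G holomorphic_on ball 0 1"
    and inj: "inj_on G (ball 0 1)" and e: "norm e = 1"
  shows "G e \<notin> G ` ball 0 1"
proof
  assume "G e \<in> G ` ball 0 1"
  then obtain z where z: "norm z < 1" "G e = G z" by auto
  define \<rho> where "\<rho> = (1 - norm z) / 2"
  have \<rho>: "0 < \<rho>" "norm z + \<rho> < 1" using z by (auto simp: \<rho>_def field_simps)
  have sub: "ball z \<rho> \<subseteq> ball 0 1"
  proof
    fix x assume "x \<in> ball z \<rho>"
    then have "norm (x - z) < \<rho>" by (simp add: dist_norm norm_minus_commute)
    then show "x \<in> ball 0 1" using \<rho> norm_triangle_sub[of x z] by simp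
  qed
  have "open (G ` ball z \<rho>)"
    by (rule open_mapping_thm3) (use hol inj sub in \<open>auto intro: holomorphic_on_subset inj_on_subset\<close>)
  moreover have "G e \<in> G ` ball z \<rho>" using z \<rho> by auto
  ultimately obtain \<epsilon> where \<epsilon>: "0 < \<epsilon>" "ball (G e) \<epsilon> \<subseteq> G ` ball z \<rho>"
    by (meson openE)
  obtain r where r: "0 < r" "\<And>x. x \<in> cball 0 1 \<Longrightarrow> dist x e < r \<Longrightarrow> dist (G x) (G e) < \<epsilon>"
    using cont \<epsilon>(1) e unfolding continuous_on_iff by (metis mem_cball_0 order_refl)
  \<comment> \<open>The first bound brings G x close to G e; the second keeps x = (1 - s) e outside
    the ball around z.\<close>
  define s where "s = min (r / 2) ((1 - (norm z + \<rho>)) / 2)"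
  have s: "0 < s" "s < r" "s < 1 - (norm z + \<rho>)" using r \<rho> by (auto simp: s_def min_def)
  then have s1: "s < 1" using \<rho> by (smt (verit) norm_ge_zero)
  define x where "x = of_real (1 - s) * e"
  have "norm (complex_of_real (1 - s)) = 1 - s" using s1 by (simp only: norm_of_real)
  then have nx: "norm x = 1 - s" unfolding x_def norm_mult e by simp
  have "x - e = - of_real s * e" by (simp add: x_def algebra_simps)
  then have dx: "dist x e = s" unfolding dist_norm using s e by (simp add: norm_mult)
  have "dist (G x) (G e) < \<epsilon>" using r(2)[of x] nx dx s by simp
  then have "G x \<in> G ` ball z \<rho>" using \<epsilon>(2) by (auto simp: dist_commute)
  moreover have "x \<in> ball 0 1" using nx s by simp
  ultimately have "x \<in> ball z \<rho>" using inj_onD[OF inj] sub by blast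
  then have "norm x \<le> norm z + \<rho>" using norm_triangle_sub[of x z]
    by (simp add: dist_norm norm_minus_commute)
  then show False using nx s by linarith
qed

text \<open>The vector c is normal to the chord, so the inner product condition puts x on its line.
  Writing x = e1 + s v with |e1| = |e1 + v| = 1 gives |x|^2 = 1 + s(s - 1)|v|^2, which locates the
  disc at 0 \<le> s \<le> 1 and the circle at the two ends.\<close>

lemma chord_eq:
  fixes e\<^sub>1 e\<^sub>2 x :: complex
  defines "c \<equiv> \<i> * (e\<^sub>2 - e\<^sub>1)"
  assumes e: "norm e\<^sub>1 = 1" "norm e\<^sub>2 = 1" "e\<^sub>1 \<noteq> e\<^sub>2" and x: "norm x \<le> 1" "x \<bullet> c = e\<^sub>1 \<bullet> c"
  obtains s where "0 \<le> s" "s \<le> 1" "x = linepath e\<^sub>1 e\<^sub>2 s" "norm x = 1 \<longrightarrow> s = 0 \<or> s = 1"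
proof -
  define v where "v = e\<^sub>2 - e\<^sub>1"
  have v0: "v \<noteq> 0" using e by (simp add: v_def)
  have "Im ((x - e\<^sub>1) / v) = 0"
    using x(2) by (simp add: c_def v_def inner_complex_def Im_divide algebra_simps)
  then have "(x - e\<^sub>1) / v = of_real (Re ((x - e\<^sub>1) / v))"
    by (simp add: complex_eq_iff)
  then obtain s where s: "(x - e\<^sub>1) / v = of_real s" by blast
  then have xs: "x = e\<^sub>1 + s *\<^sub>R v" using v0 by (simp add: field_simps scaleR_conv_of_real)
  have "(norm (e\<^sub>1 + v))\<^sup>2 = 1" using e by (simp add: v_def)
  then have "2 * (e\<^sub>1 \<bullet> v) = - (norm v)\<^sup>2"
    using e by (simp add: power2_norm_eq_inner inner_add_left inner_add_right inner_commute)
       (simp flip: power2_norm_eq_inner)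
  moreover have "(norm x)\<^sup>2 = 1 + s * (2 * (e\<^sub>1 \<bullet> v)) + s\<^sup>2 * (norm v)\<^sup>2"
    using e unfolding xs power2_norm_eq_inner
    by (simp add: inner_add_left inner_add_right inner_commute power2_eq_square algebra_simps)
       (simp flip: power2_norm_eq_inner)
  ultimately have eq: "(norm x)\<^sup>2 = 1 + (s * (s - 1)) * (norm v)\<^sup>2"
    by (simp add: power2_eq_square algebra_simps)
  moreover have "(norm x)\<^sup>2 \<le> 1" using x(1) by (simp add: power_le_one)
  ultimately have "(s * (s - 1)) * (norm v)\<^sup>2 \<le> 0" by simp
  then have "s * (s - 1) \<le> 0" using v0 by (simp add: mult_le_0_iff)
  then have "0 \<le> s" "s \<le> 1" by (auto simp: mult_le_0_iff)
  moreover have "x = linepath e\<^sub>1 e\<^sub>2 s"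
    unfolding xs v_def linepath_def by (simp add: algebra_simps)
  moreover have "norm x = 1 \<longrightarrow> s = 0 \<or> s = 1" using eq v0 by auto
  ultimately show ?thesis using that by blast
qed

lemma linepath_inside_ball:
  fixes e\<^sub>1 e\<^sub>2 :: complex
  assumes e: "norm e\<^sub>1 = 1" "norm e\<^sub>2 = 1" "e\<^sub>1 \<noteq> e\<^sub>2" and s: "0 < s" "s < 1"
  shows "norm (linepath e\<^sub>1 e\<^sub>2 s) < 1"
proof -
  have "linepath e\<^sub>1 e\<^sub>2 s \<in> open_segment e\<^sub>1 e\<^sub>2"
    using s e by (auto simp: in_segment linepath_def)
  moreover have "open_segment e\<^sub>1 e\<^sub>2 \<subseteq> interior (cball 0 1)"
  proof -
    have "open_segment e\<^sub>1 e\<^sub>2 \<subseteq> ball 0 1"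
    proof
      fix x assume "x \<in> open_segment e\<^sub>1 e\<^sub>2"
      then show "x \<in> ball 0 1"
        using dist_decreases_open_segment[of x e\<^sub>1 e\<^sub>2 0] e by (auto simp: dist_norm)
    qed
    then show ?thesis by simp
  qed
  ultimately show ?thesis by auto
qed

text \<open>Boundary values avoid the image D of the open disc, so a collision can only involve two
  boundary points with a common value p. The chord joining them is then mapped to a Jordan curve
  that meets the frontier of D in p alone. The images of the two half-discs cannot lie on the same
  side of this curve, since D meets both sides; and on opposite sides they would disconnect the
  frontier without p. The point 1 is exempt from local injectivity because it will represent
  infinity.\<close>

lemma injective_on_closed_disc:
  fixes G :: "complex \<Rightarrow> complex"
  assumes cont: "continuous_on (cball 0 1) G" and hol: "G holomorphic_on ball 0 1"
    and inj: "inj_on G (ball 0 1)"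
    and J: "frontier (G ` ball 0 1) homeomorphic sphere (0::complex) 1"
    and nc: "\<And>e. norm e = 1 \<Longrightarrow> e \<noteq> 1 \<Longrightarrow>
       \<exists>r>0. \<forall>e'. norm e' = 1 \<longrightarrow> e' \<noteq> e \<longrightarrow> dist e' e < r \<longrightarrow> G e' \<noteq> G e"
  shows "inj_on G (cball 0 1)"
proof -
  define D where "D = G ` ball 0 1"
  have "open D" unfolding D_def by (rule open_mapping_thm3) (use hol inj in auto)
  have bdry: "G e \<notin> D" if "norm e = 1" for e
    using injective_holomorphic_boundary_values[OF cont hol inj that] by (simp add: D_def)
  have clD: "closure D = G ` cball 0 1"
  proof
    show "closure D \<subseteq> G ` cball 0 1"
      unfolding D_def by (rule closure_minimal)
        (auto intro!: compact_imp_closed compact_continuous_image cont)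
    have "G ` closure (ball 0 1) \<subseteq> closure (G ` ball 0 1)"
      by (rule image_closure_subset) (use cont closure_subset[of "G ` ball 0 1"] in auto)
    then show "G ` cball 0 1 \<subseteq> closure D" by (simp add: D_def)
  qed
  have frD: "frontier D = G ` sphere 0 1"
  proof -
    have "frontier D = closure D - D" using \<open>open D\<close> by (simp add: frontier_def interior_open)
    moreover have "cball (0::complex) 1 = sphere 0 1 \<union> ball 0 1" by auto
    then have "closure D = G ` sphere 0 1 \<union> D" using clD by (simp add: D_def image_Un)
    moreover have "G ` sphere 0 1 \<inter> D = {}" using bdry by auto
    ultimately show ?thesis by blast
  qed
  \<comment> \<open>Since nothing is assumed at 1, first move to a nearby e other than 1; then e
    itself or a second boundary point near e has a value different from p.\<close>
  have arc: "\<exists>e. norm e = 1 \<and> e \<in> W \<and> G e \<noteq> p" if m: "norm m = 1" "open W" "m \<in> W" for m W p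
  proof -
    have lim: "e islimpt sphere (0::complex) 1" if "norm e = 1" for e
    proof (rule connected_imp_perfect)
      show "connected (sphere (0::complex) 1)" by (rule connected_sphere) simp
      have "- e \<in> sphere 0 1" "- e \<noteq> e" using that by auto
      then show "sphere (0::complex) 1 \<noteq> {x}" for x
        using that by (metis mem_sphere_0 singletonD)
    qed (use that in auto)
    obtain e where e: "norm e = 1" "e \<in> W" "e \<noteq> 1"
    proof (cases "m = 1")
      case True
      obtain e where "e \<in> sphere 0 1" "e \<in> W" "e \<noteq> m"
        using lim[OF m(1)] m unfolding islimpt_def by blast
      with True show thesis by (intro that) auto
    qed (use m in blast)
    obtain r where r: "0 < r" "\<And>e'. norm e' = 1 \<Longrightarrow> e' \<noteq> e \<Longrightarrow> dist e' e < r \<Longrightarrow> G e' \<noteq> G e"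
      using nc[OF e(1,3)] by blast
    have "open (W \<inter> ball e r)" "e \<in> W \<inter> ball e r" using m e r by auto
    then obtain e' where "e' \<in> sphere 0 1" "e' \<in> W \<inter> ball e r" "e' \<noteq> e"
      using lim[OF e(1)] unfolding islimpt_def by blast
    then have e': "norm e' = 1" "e' \<in> W" "G e' \<noteq> G e" using r(2)[of e'] by (auto simp: dist_commute)
    show ?thesis
    proof (cases "G e = p")
      case True
      then show ?thesis using e' by auto
    qed (use e in auto)
  qed
  have False if e: "norm e\<^sub>1 = 1" "norm e\<^sub>2 = 1" "e\<^sub>1 \<noteq> e\<^sub>2" and eq: "G e\<^sub>1 = G e\<^sub>2" for e\<^sub>1 e\<^sub>2
  proof -
    define p where "p = G e\<^sub>1"
    define c where "c = \<i> * (e\<^sub>2 - e\<^sub>1)"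
    define \<beta> where "\<beta> = e\<^sub>1 \<bullet> c"
    define U where "U = ball 0 1 \<inter> {x. c \<bullet> x > \<beta>}"
    define V where "V = ball 0 1 \<inter> {x. c \<bullet> x < \<beta>}"
    define \<gamma> where "\<gamma> = G \<circ> linepath e\<^sub>1 e\<^sub>2"
    define \<Gamma> where "\<Gamma> = path_image \<gamma>"
    have pD: "p \<notin> D" using bdry e by (simp add: p_def)
    have e2c: "e\<^sub>2 \<bullet> c = \<beta>"
      by (simp add: \<beta>_def c_def inner_complex_def algebra_simps)
    have lin: "linepath e\<^sub>1 e\<^sub>2 s \<bullet> c = \<beta>" for s
      using e2c by (simp add: linepath_def inner_add_left \<beta>_def algebra_simps)
    have \<gamma>_in: "\<gamma> s \<in> D" if "0 < s" "s < 1" for s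
      using linepath_inside_ball[OF e that] by (auto simp: \<gamma>_def D_def)
    have \<gamma>_ends: "\<gamma> 0 = p" "\<gamma> 1 = p" by (simp_all add: \<gamma>_def p_def eq linepath_def)
    have "closed_segment e\<^sub>1 e\<^sub>2 \<subseteq> cball 0 1"
      by (rule closed_segment_subset) (use e in auto)
    then have "path \<gamma>"
      unfolding \<gamma>_def by (intro path_continuous_image continuous_on_subset[OF cont]) auto
    \<comment> \<open>Interior points of the chord have values in D, which does not contain p, so
      the two ends are the only coincidence.\<close>
    moreover have "loop_free \<gamma>"
    proof -
      have *: "s = t \<or> s = 0 \<and> t = 1 \<or> s = 1 \<and> t = 0"
        if st: "s \<in> {0..1}" "t \<in> {0..1}" "\<gamma> s = \<gamma> t" for s t
      proof -
        consider "s \<in> {0<..<1}" "t \<in> {0<..<1}" | "s \<in> {0<..<1}" "t \<in> {0,1}" | "s \<in> {0,1}" "t \<in> {0<..<1}" | "s \<in> {0,1}" "t \<in> {0,1}"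
          using st by force
        then show ?thesis
        proof cases
          case 1
          then have "linepath e\<^sub>1 e\<^sub>2 s = linepath e\<^sub>1 e\<^sub>2 t"
            using st inj linepath_inside_ball[OF e] by (auto simp: \<gamma>_def inj_on_def)
          then show ?thesis using e
            by (metis inj_on_def inj_on_linepath st(1,2))
        next
          case 2
          then show ?thesis using \<gamma>_in[of s] \<gamma>_ends pD st by auto
        next
          case 3
          then show ?thesis using \<gamma>_in[of t] \<gamma>_ends pD st by auto
        qed auto
      qed
      then show ?thesis unfolding loop_free_def by blast
    qed
    ultimately have "simple_path \<gamma>" by (simp add: simple_path_def)
    moreover have "pathfinish \<gamma> = pathstart \<gamma>"
      using \<gamma>_ends by (simp add: pathfinish_def pathstart_def)
    ultimately have JCT: "open (inside \<Gamma>)" "open (outside \<Gamma>)" "inside \<Gamma> \<inter> outside \<Gamma> = {}"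
      "inside \<Gamma> \<union> outside \<Gamma> = - \<Gamma>" "frontier (inside \<Gamma>) = \<Gamma>" "frontier (outside \<Gamma>) = \<Gamma>"
      using Jordan_inside_outside[of \<gamma>] unfolding \<Gamma>_def by blast+
    have \<Gamma>_D: "\<exists>s\<in>{0<..<1}. w = G (linepath e\<^sub>1 e\<^sub>2 s)" if "w \<in> \<Gamma>" "w \<noteq> p" for w
    proof -
      obtain s where s: "s \<in> {0..1}" "w = \<gamma> s" using \<open>w \<in> \<Gamma>\<close> by (auto simp: \<Gamma>_def path_image_def)
      moreover from this have "s \<noteq> 0" "s \<noteq> 1" using \<gamma>_ends \<open>w \<noteq> p\<close> by auto
      ultimately show ?thesis by (auto simp: \<gamma>_def intro!: bexI[of _ s])
    qed
    have split: "D \<subseteq> G ` U \<union> G ` V \<union> \<Gamma>"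
    proof
      fix w assume "w \<in> D"
      then obtain x where x: "norm x < 1" "w = G x" by (auto simp: D_def)
      show "w \<in> G ` U \<union> G ` V \<union> \<Gamma>"
      proof (cases "x \<bullet> c = \<beta>")
        case True
        then obtain s where "0 \<le> s" "s \<le> 1" "x = linepath e\<^sub>1 e\<^sub>2 s"
          using chord_eq[OF e, of x] x unfolding \<beta>_def c_def by (metis less_imp_le)
        then show ?thesis using x by (auto simp: \<Gamma>_def path_image_def \<gamma>_def)
      next
        case False
        then have "x \<in> U \<union> V" using x by (auto simp: U_def V_def inner_commute[of c x])
        then show ?thesis using x by auto
      qed
    qed
    have side: "G ` X \<subseteq> inside \<Gamma> \<or> G ` X \<subseteq> outside \<Gamma>"
      if X: "convex X" "X \<subseteq> ball 0 1" "\<And>x. x \<in> X \<Longrightarrow> x \<bullet> c \<noteq> \<beta>" for X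
    proof -
      have "G ` X \<inter> \<Gamma> = {}"
      proof (rule ccontr)
        assume "G ` X \<inter> \<Gamma> \<noteq> {}"
        then obtain x where x: "x \<in> X" "G x \<in> \<Gamma>" by auto
        then have "G x \<in> D" using X by (auto simp: D_def)
        then obtain s where s: "s \<in> {0<..<1}" "G x = G (linepath e\<^sub>1 e\<^sub>2 s)"
          using \<Gamma>_D x pD by metis
        then have "x = linepath e\<^sub>1 e\<^sub>2 s"
          using inj x X linepath_inside_ball[OF e, of s] by (auto simp: inj_on_def)
        then show False using X(3)[OF x(1)] lin by simp
      qed
      moreover have "connected (G ` X)"
        using X(1) ball_subset_cball[of "0::complex" 1] X(2)
        by (intro connected_continuous_image convex_connected continuous_on_subset[OF cont]) auto
      ultimately show ?thesis
        using JCT connectedD[of "G ` X" "inside \<Gamma>" "outside \<Gamma>"] by blast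
    qed
    have U: "convex U" "U \<subseteq> ball 0 1" "\<And>x. x \<in> U \<Longrightarrow> x \<bullet> c \<noteq> \<beta>"
      unfolding U_def by (intro convex_Int convex_ball convex_halfspace_gt) (auto simp: inner_commute[of c])
    have V: "convex V" "V \<subseteq> ball 0 1" "\<And>x. x \<in> V \<Longrightarrow> x \<bullet> c \<noteq> \<beta>"
      unfolding V_def by (intro convex_Int convex_ball convex_halfspace_lt) (auto simp: inner_commute[of c])
    \<comment> \<open>q lies in D and on \<Gamma>, which is the frontier of both components; hence
      the open set D meets both.\<close>
    define q where "q = \<gamma> (1/2)"
    have q: "q \<in> D" "q \<in> \<Gamma>" using \<gamma>_in[of "1/2"] by (auto simp: q_def \<Gamma>_def path_image_def)
    have meets: "D \<inter> inside \<Gamma> \<noteq> {}" "D \<inter> outside \<Gamma> \<noteq> {}"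
    proof -
      have "q \<in> closure (inside \<Gamma>)" "q \<in> closure (outside \<Gamma>)"
        using q JCT(5,6) by (auto simp: frontier_def)
      then show "D \<inter> inside \<Gamma> \<noteq> {}" "D \<inter> outside \<Gamma> \<noteq> {}"
        using open_Int_closure_eq_empty[OF \<open>open D\<close>] q by blast+
    qed
    have no_sep: False
      if X: "X = inside \<Gamma> \<and> Y = outside \<Gamma> \<or> X = outside \<Gamma> \<and> Y = inside \<Gamma>" and sub: "G ` U \<subseteq> X" "G ` V \<subseteq> Y" for X Y
    proof -
      have XY: "open X" "open Y" "X \<inter> Y = {}" "frontier X = \<Gamma>" "frontier Y = \<Gamma>"
        using X JCT by (metis Int_commute)+
      \<comment> \<open>A boundary value is a limit of values from its half-disc, so it lies in the
        closure of the corresponding component. It is not on \<Gamma>, because the points of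
        \<Gamma> other than p lie in D.\<close>
      have pass: "G x \<in> Z"
        if h: "norm x = 1" "x \<in> W" "open W" "G ` (W \<inter> ball 0 1) \<subseteq> Z" "frontier Z = \<Gamma>" "G x \<noteq> p" for x W Z
      proof -
        have "x \<in> closure (W \<inter> ball 0 1)"
          using open_Int_closure_subset[OF \<open>open W\<close>, of "ball 0 1"] h by auto
        moreover have "closure (W \<inter> ball (0::complex) 1) \<subseteq> cball 0 1"
          by (metis Int_lower2 closure_mono closure_ball zero_less_one)
        then have "G ` closure (W \<inter> ball 0 1) \<subseteq> closure Z"
          using h(4) closure_subset[of Z]
          by (intro image_closure_subset) (auto intro: continuous_on_subset[OF cont])
        ultimately have "G x \<in> closure Z" by auto
        moreover have "G x \<notin> \<Gamma>"
        proof
          assume "G x \<in> \<Gamma>"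
          then obtain s where s: "s \<in> {0<..<1}" "G x = G (linepath e\<^sub>1 e\<^sub>2 s)"
            using \<Gamma>_D h(6) by metis
          then have "G x \<in> D" using linepath_inside_ball[OF e, of s] by (auto simp: D_def)
          with bdry[OF h(1)] show False by simp
        qed
        ultimately show ?thesis using h(5) closure_Un_frontier[of Z] by auto
      qed
      have KU: "G x \<in> X" if "norm x = 1" "c \<bullet> x > \<beta>" "G x \<noteq> p" for x
        by (rule pass[where W = "{x. c \<bullet> x > \<beta>}"])
          (use that sub(1)[unfolded U_def Int_commute[of "ball 0 1"]] XY in \<open>auto simp: open_halfspace_gt\<close>)
      have KV: "G x \<in> Y" if "norm x = 1" "c \<bullet> x < \<beta>" "G x \<noteq> p" for x
        by (rule pass[where W = "{x. c \<bullet> x < \<beta>}"])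
          (use that sub(2)[unfolded V_def Int_commute[of "ball 0 1"]] XY in \<open>auto simp: open_halfspace_lt\<close>)
      have cover: "frontier D - {p} \<subseteq> X \<union> Y"
      proof
        fix w assume "w \<in> frontier D - {p}"
        then obtain x where x: "norm x = 1" "w = G x" "G x \<noteq> p" by (auto simp: frD)
        have "c \<bullet> x \<noteq> \<beta>"
        proof
          assume "c \<bullet> x = \<beta>"
          then obtain s where "x = linepath e\<^sub>1 e\<^sub>2 s" "s = 0 \<or> s = 1"
            using chord_eq[OF e, of x] x unfolding \<beta>_def c_def by (metis inner_commute order_refl)
          then show False using x \<gamma>_ends unfolding \<gamma>_def o_def by metis
        qed
        then show "w \<in> X \<union> Y" using KU KV x by (meson UnI1 UnI2 linorder_neqE)
      qed
      have cn: "c \<noteq> 0" using e by (simp add: c_def)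
      \<comment> \<open>The midpoint of the chord is strictly inside the disc, so the line of the
        chord is at distance less than 1 from the origin. Hence \<open>sgn c\<close> and
        \<open>- sgn c\<close> are points of the circle strictly on its two sides, and
        \<open>arc\<close> finds values other than p near each.\<close>
      have "\<bar>\<beta>\<bar> \<le> norm (linepath e\<^sub>1 e\<^sub>2 (1/2)) * norm c"
        using Cauchy_Schwarz_ineq2[of "linepath e\<^sub>1 e\<^sub>2 (1/2)" c] by (simp only: lin)
      also have "\<dots> < 1 * norm c"
        using linepath_inside_ball[OF e, of "1/2"] cn by (intro mult_strict_right_mono) auto
      finally have "\<bar>\<beta>\<bar> < norm c" by simp
      moreover have "c \<bullet> sgn c = norm c"
        using cn by (simp add: sgn_div_norm power2_norm_eq_inner[symmetric] power2_eq_square)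
      ultimately have m: "c \<bullet> sgn c > \<beta>" "c \<bullet> (- sgn c) < \<beta>"
        by auto
      have "norm (sgn c) = 1" using cn by (simp add: norm_sgn)
      then obtain a b where a: "norm a = 1" "c \<bullet> a > \<beta>" "G a \<noteq> p" and b: "norm b = 1" "c \<bullet> b < \<beta>" "G b \<noteq> p"
        using arc[of "sgn c" "{x. c \<bullet> x > \<beta>}" p] arc[of "- sgn c" "{x. c \<bullet> x < \<beta>}" p] m
        by (auto simp: open_halfspace_gt open_halfspace_lt)
      have "connected (frontier D - {p})"
        by (rule connected_punctured_circle_image) (use J frD e in \<open>auto simp: D_def p_def\<close>)
      moreover have "G a \<in> X \<inter> (frontier D - {p})" "G b \<in> Y \<inter> (frontier D - {p})"
        using KU[OF a] KV[OF b] a b by (auto simp: frD)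
      ultimately show False
        using connectedD[of "frontier D - {p}" X Y] XY cover by blast
    qed
    have hU: "G ` U \<subseteq> inside \<Gamma> \<or> G ` U \<subseteq> outside \<Gamma>"
      by (rule side) (fact U)+
    have hV: "G ` V \<subseteq> inside \<Gamma> \<or> G ` V \<subseteq> outside \<Gamma>"
      by (rule side) (fact V)+
    have "\<not> (G ` U \<subseteq> inside \<Gamma> \<and> G ` V \<subseteq> outside \<Gamma>)"
      by (intro notI, elim conjE, rule no_sep[of "inside \<Gamma>" "outside \<Gamma>"]) simp_all
    moreover have "\<not> (G ` U \<subseteq> outside \<Gamma> \<and> G ` V \<subseteq> inside \<Gamma>)"
      by (intro notI, elim conjE, rule no_sep[of "outside \<Gamma>" "inside \<Gamma>"]) simp_all
    moreover have "\<not> (G ` U \<subseteq> inside \<Gamma> \<and> G ` V \<subseteq> inside \<Gamma>)"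
    proof
      assume "G ` U \<subseteq> inside \<Gamma> \<and> G ` V \<subseteq> inside \<Gamma>"
      then have "D \<subseteq> inside \<Gamma> \<union> \<Gamma>" using split by (meson Un_least Un_mono order_refl order_trans)
      moreover have "outside \<Gamma> \<inter> (inside \<Gamma> \<union> \<Gamma>) = {}"
        using JCT(3) outside_no_overlap[of \<Gamma>] by (simp add: Int_Un_distrib Int_commute)
      ultimately show False using meets(2) by (metis disjoint_iff subsetD)
    qed
    moreover have "\<not> (G ` U \<subseteq> outside \<Gamma> \<and> G ` V \<subseteq> outside \<Gamma>)"
    proof
      assume "G ` U \<subseteq> outside \<Gamma> \<and> G ` V \<subseteq> outside \<Gamma>"
      then have "D \<subseteq> outside \<Gamma> \<union> \<Gamma>" using split by (meson Un_least Un_mono order_refl order_trans)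
      moreover have "inside \<Gamma> \<inter> (outside \<Gamma> \<union> \<Gamma>) = {}"
        using JCT(3) inside_no_overlap[of \<Gamma>] by (simp add: Int_Un_distrib Int_commute)
      ultimately show False using meets(1) by (metis disjoint_iff subsetD)
    qed
    ultimately show False using hU hV by argo
  qed
  then have circle: "x = y" if "norm x = 1" "norm y = 1" "G x = G y" for x y
    using that by blast
  show ?thesis
  proof (rule inj_onI)
    fix x y assume xy: "x \<in> cball 0 1" "y \<in> cball 0 1" "G x = G y"
    then consider "norm x < 1" "norm y < 1" | "norm x < 1" "norm y = 1" | "norm x = 1" "norm y < 1" | "norm x = 1" "norm y = 1"
      by (auto simp: le_less)
    then show "x = y"
    proof cases
      case 1
      then show ?thesis using inj_onD[OF inj xy(3)] by simp
    next
      case 2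
      then have "G x \<in> D" by (simp add: D_def)
      then show ?thesis using bdry[of y] 2 xy(3) by simp
    next
      case 3
      then have "G y \<in> D" by (simp add: D_def)
      then show ?thesis using bdry[of x] 3 xy(3) by simp
    qed (use circle xy in blast)
  qed
qed

section \<open>Jordan domains on the Riemann sphere\<close>

lemma openin_riemann_sphere:
  "openin riemann_sphere V \<longleftrightarrow>
     (\<exists>U. open U \<and> V = Some ` U) \<or> (\<exists>C. compact C \<and> V = insert None (Some ` (- C)))"
  by (auto simp: riemann_sphere_def openin_Alexandroff_compactification compact_imp_closed Compl_eq_Diff_UNIV)

lemma openin_riemann_sphere_Some: "open U \<Longrightarrow> openin riemann_sphere (Some ` U)"
  unfolding openin_riemann_sphere by blast

lemma topspace_riemann_sphere [simp]: "topspace riemann_sphere = UNIV"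
  by (auto simp: riemann_sphere_def topspace_Alexandroff_compactification) (metis not_None_eq rangeI)

lemma riemann_sphere_frontier_of_unbounded:
  assumes "open D" "\<not> bounded D"
  shows "riemann_sphere frontier_of (Some ` D) = insert None (Some ` frontier D)"
proof -
  have int: "riemann_sphere interior_of (Some ` D) = Some ` D"
    using assms(1) by (intro interior_of_openin openin_riemann_sphere_Some)
  have "None \<in> riemann_sphere closure_of (Some ` D)"
    unfolding in_closure_of
  proof (intro conjI allI impI)
    fix T assume "None \<in> T \<and> openin riemann_sphere T"
    then obtain C where C: "compact C" "T = insert None (Some ` (- C))"
      by (auto simp: openin_riemann_sphere)
    have "\<not> D \<subseteq> C" using assms(2) C(1) bounded_subset compact_imp_bounded by blast
    then show "\<exists>y. y \<in> Some ` D \<and> y \<in> T" using C(2) by auto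
  qed auto
  moreover have "Some w \<in> riemann_sphere closure_of (Some ` D) \<longleftrightarrow> w \<in> closure D" for w
  proof
    assume L: "Some w \<in> riemann_sphere closure_of (Some ` D)"
    show "w \<in> closure D"
    proof (rule ccontr)
      assume "w \<notin> closure D"
      then have "Some w \<in> Some ` (- closure D)" by simp
      moreover have "openin riemann_sphere (Some ` (- closure D))"
        by (intro openin_riemann_sphere_Some) auto
      ultimately have "\<exists>y. y \<in> Some ` D \<and> y \<in> Some ` (- closure D)"
        using L by (simp only: in_closure_of)
      then show False using closure_subset[of D] by auto
    qed
  next
    assume R: "w \<in> closure D"
    show "Some w \<in> riemann_sphere closure_of (Some ` D)"
      unfolding in_closure_of
    proof (intro conjI allI impI)
      fix T assume T: "Some w \<in> T \<and> openin riemann_sphere T"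
      have "\<exists>U. open U \<and> w \<in> U \<and> Some ` U \<subseteq> T"
      proof -
        consider U where "open U" "T = Some ` U" | C where "compact C" "T = insert None (Some ` (- C))"
          using T unfolding openin_riemann_sphere by blast
        then show ?thesis
        proof cases
          case (1 U)
          then show ?thesis using T by auto
        next
          case (2 C)
          then show ?thesis using T by (intro exI[of _ "- C"]) (auto simp: compact_imp_closed)
        qed
      qed
      then obtain U where "open U" "w \<in> U" "Some ` U \<subseteq> T" by blast
      moreover from this have "U \<inter> D \<noteq> {}"
        using R open_Int_closure_eq_empty[of U D] by blast
      ultimately show "\<exists>y. y \<in> Some ` D \<and> y \<in> T" by blast
    qed auto
  qed
  ultimately have "x \<in> riemann_sphere closure_of (Some ` D) \<longleftrightarrow> x \<in> insert None (Some ` closure D)" for x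
    by (cases x) auto
  then have cl: "riemann_sphere closure_of (Some ` D) = insert None (Some ` closure D)"
    by blast
  have "frontier D = closure D - D" using assms(1) by (simp add: frontier_def interior_open)
  then show ?thesis unfolding frontier_of_def cl int by auto
qed

text \<open>Sending infinity to 0 and w to 1/(w - a) is a continuous injection of the compact Jordan
  curve into the plane, hence a homeomorphism onto its image. The centre a only has to avoid the
  curve, so that it may be taken inside D as well as outside its closure; both cases occur.\<close>

lemma Moebius_image_of_Jordan_frontier:
  assumes D: "open D" "\<not> bounded D" and J: "Jordan_domain (Some ` D)" and a: "a \<notin> frontier D"
  shows "insert 0 ((\<lambda>w. 1 / (w - a)) ` frontier D) homeomorphic sphere (0::complex) 1"
proof -
  define J where "J = insert None (Some ` frontier D)"
  define m where "m = case_option 0 (\<lambda>w. 1 / (w - a))"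
  have hom: "subtopology riemann_sphere J homeomorphic_space top_of_set (sphere (0::complex) 1)"
    using J unfolding Jordan_domain_def Jordan_curve_in_def riemann_sphere_frontier_of_unbounded[OF D] J_def by blast
  have mJ: "m ` J = insert 0 ((\<lambda>w. 1 / (w - a)) ` frontier D)"
    by (auto simp: m_def J_def image_iff)
  have "continuous_map (subtopology riemann_sphere J) euclidean m"
    unfolding continuous_map_def
  proof (intro conjI allI impI)
    fix U :: "complex set" assume "openin euclidean U"
    then have "open U" by simp
    \<comment> \<open>The point a is removed explicitly: with 1/0 = 0 it would belong to the
      preimage of every neighbourhood of 0. It is not in \<open>J\<close>, so nothing is
      lost.\<close>
    define T where "T = {w. w \<noteq> a \<and> 1 / (w - a) \<in> U}"
    have "open ((-{a}) \<inter> (\<lambda>w. 1 / (w - a)) -` U)"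
      by (rule continuous_open_preimage) (auto intro!: continuous_intros \<open>open U\<close>)
    moreover have "(-{a}) \<inter> (\<lambda>w. 1 / (w - a)) -` U = T" by (auto simp: T_def)
    ultimately have "open T" by simp
    show "openin (subtopology riemann_sphere J) {x \<in> topspace (subtopology riemann_sphere J). m x \<in> U}"
    proof (cases "0 \<in> U")
      case False
      have "{x \<in> topspace (subtopology riemann_sphere J). m x \<in> U} = Some ` T \<inter> J"
        using False a by (auto simp: J_def m_def T_def)
      moreover have "openin riemann_sphere (Some ` T)"
        using \<open>open T\<close> by (rule openin_riemann_sphere_Some)
      ultimately show ?thesis by (auto simp: openin_subtopology)
    next
      case True
      obtain r where r: "0 < r" "ball 0 r \<subseteq> U" using \<open>open U\<close> True openE by blast
      have "- T \<subseteq> cball a (1 / r)"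
      proof
        fix w assume w: "w \<in> - T"
        show "w \<in> cball a (1 / r)"
        proof (rule ccontr)
          assume *: "w \<notin> cball a (1 / r)"
          then have "1 / r < norm (w - a)" by (simp add: dist_norm norm_minus_commute)
          then have "w \<noteq> a" using r(1) by auto
          moreover from this have "norm (1 / (w - a)) < r"
            using r(1) * by (simp add: norm_divide dist_norm norm_minus_commute field_simps)
          ultimately show False using w r(2) by (auto simp: T_def subset_iff)
        qed
      qed
      then have "compact (- T)"
        using \<open>open T\<close> by (meson bounded_cball bounded_subset closed_Compl compact_eq_bounded_closed)
      then have "openin riemann_sphere (insert None (Some ` T))"
        by (auto simp: openin_riemann_sphere intro!: exI[of _ "- T"])
      moreover have "{x \<in> topspace (subtopology riemann_sphere J). m x \<in> U} = insert None (Some ` T) \<inter> J"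
        using True a by (auto simp: J_def m_def T_def)
      ultimately show ?thesis by (auto simp: openin_subtopology)
    qed
  qed auto
  then have "continuous_map (subtopology riemann_sphere J) (top_of_set (m ` J)) m"
    by (simp add: continuous_map_in_subtopology)
  moreover have "compact_space (subtopology riemann_sphere J)"
    using homeomorphic_compact_space[OF hom] by (simp add: compact_space_subtopology)
  moreover have "inj_on m J"
    using a by (auto simp: inj_on_def J_def m_def)
  ultimately have "homeomorphic_map (subtopology riemann_sphere J) (top_of_set (m ` J)) m"
    by (intro continuous_imp_homeomorphic_map) (auto simp: Hausdorff_space_subtopology)
  then have "top_of_set (m ` J) homeomorphic_space top_of_set (sphere (0::complex) 1)"
    using hom homeomorphic_map_imp_homeomorphic_space homeomorphic_space_sym homeomorphic_space_trans by blast
  then obtain p q where "homeomorphic_maps (top_of_set (m ` J)) (top_of_set (sphere (0::complex) 1)) p q"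
    by (auto simp: homeomorphic_space_def)
  then have "continuous_on (m ` J) p" "continuous_on (sphere 0 1) q" "p \<in> m ` J \<rightarrow> sphere 0 1" "q \<in> sphere 0 1 \<rightarrow> m ` J"
    "\<And>x. x \<in> m ` J \<Longrightarrow> q (p x) = x" "\<And>y. y \<in> sphere 0 1 \<Longrightarrow> p (q y) = y"
    unfolding homeomorphic_maps_def continuous_map_subtopology_eu topspace_euclidean_subtopology by blast+
  then have "homeomorphism (m ` J) (sphere 0 1) p q"
    by (intro homeomorphismI) blast+
  then show ?thesis
    unfolding mJ[symmetric] homeomorphic_def by blast
qed

text \<open>If D were dense, its frontier would be its whole complement. Inversion about a point b
  of D would turn the frontier and infinity into a plane Jordan curve whose complement is the image
  of D without b. That image is connected, contrary to the Jordan separation theorem.\<close>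

lemma Jordan_domain_exterior_point:
  assumes D: "open D" "connected D" "\<not> bounded D" and J: "Jordan_domain (Some ` D)"
  obtains a where "a \<notin> closure D"
proof -
  have "closure D \<noteq> UNIV"
  proof
    assume U: "closure D = UNIV"
    have F: "frontier D = - D" using D(1) U by (auto simp: frontier_def interior_open)
    have "D \<noteq> {}" using D(3) by auto
    then obtain b where b: "b \<in> D" by blast
    then have "insert 0 ((\<lambda>w. 1 / (w - b)) ` frontier D) homeomorphic sphere (0::complex) 1"
      by (intro Moebius_image_of_Jordan_frontier D J) (simp add: F)
    then have "\<not> connected (- insert 0 ((\<lambda>w. 1 / (w - b)) ` frontier D))"
      by (rule Jordan_Brouwer_separation) simp
    moreover have "- insert 0 ((\<lambda>w. 1 / (w - b)) ` frontier D) = (\<lambda>w. 1 / (w - b)) ` (D - {b})"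
    proof (intro equalityI subsetI)
      fix y assume y: "y \<in> - insert 0 ((\<lambda>w. 1 / (w - b)) ` frontier D)"
      define w where "w = b + 1 / y"
      have "w \<noteq> b" "y = 1 / (w - b)" using y by (auto simp: w_def)
      moreover from this have "w \<in> D" using y by (auto simp: F)
      ultimately show "y \<in> (\<lambda>w. 1 / (w - b)) ` (D - {b})" by blast
    next
      fix y assume "y \<in> (\<lambda>w. 1 / (w - b)) ` (D - {b})"
      then show "y \<in> - insert 0 ((\<lambda>w. 1 / (w - b)) ` frontier D)"
        by (auto simp: F)
    qed
    moreover have "connected ((\<lambda>w. 1 / (w - b)) ` (D - {b}))"
      by (intro connected_continuous_image connected_open_delete D continuous_intros) auto
    ultimately show False by simp
  qed
  then show ?thesis using that by blast
qed

text \<open>Unboundedness of D contributes the point 0; every other frontier point corresponds to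
  one of D through the inverse map k, since a has positive distance from D.\<close>

lemma frontier_inversion_image:
  fixes D :: "complex set"
  assumes D: "open D" "\<not> bounded D" and a: "a \<notin> closure D"
  shows "frontier ((\<lambda>w. 1 / (w - a)) ` D) = insert 0 ((\<lambda>w. 1 / (w - a)) ` frontier D)"
proof -
  define g where "g = (\<lambda>w. 1 / (w - a))"
  define k where "k = (\<lambda>y. a + 1 / y)"
  have aD: "x \<noteq> a" if "x \<in> closure D" for x using that a by auto
  \<comment> \<open>Both identities hold without exception, because 1/0 = 0 makes g and k exchange a
    and 0.\<close>
  have kg: "k (g x) = x" for x by (simp add: k_def g_def)
  have gk: "g (k y) = y" for y by (simp add: k_def g_def)
  have Dcl: "D \<subseteq> closure D" by (rule closure_subset)
  have gD: "g ` D = {y. y \<noteq> 0 \<and> k y \<in> D}"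
  proof (intro equalityI subsetI)
    fix y assume "y \<in> g ` D"
    then obtain x where "x \<in> D" "y = g x" by blast
    then show "y \<in> {y. y \<noteq> 0 \<and> k y \<in> D}" using aD Dcl kg by (auto simp: g_def)
  next
    fix y assume "y \<in> {y. y \<noteq> 0 \<and> k y \<in> D}"
    then show "y \<in> g ` D" using gk by (metis (mono_tags, lifting) image_eqI mem_Collect_eq)
  qed
  have op: "open (g ` D)"
  proof -
    have "open ((-{0}) \<inter> k -` D)"
      unfolding k_def by (rule continuous_open_preimage) (auto intro!: continuous_intros D)
    moreover have "(-{0}) \<inter> k -` D = g ` D" unfolding gD by auto
    ultimately show ?thesis by simp
  qed
  have 1: "k y \<in> closure D" if "y \<in> closure (g ` D)" "y \<noteq> 0" for y
  proof -
    obtain f where f: "\<And>n. f n \<in> g ` D" "f \<longlonglongrightarrow> y" using \<open>y \<in> closure (g ` D)\<close> closure_sequential by metis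
    have "(\<lambda>n. k (f n)) \<longlonglongrightarrow> k y" unfolding k_def using f \<open>y \<noteq> 0\<close> by (intro tendsto_intros)
    moreover have "k (f n) \<in> D" for n using f(1)[of n] by (simp add: gD)
    ultimately show ?thesis using closure_sequential by metis
  qed
  have 2: "g x \<in> closure (g ` D)" if "x \<in> closure D" for x
  proof -
    obtain f where f: "\<And>n. f n \<in> D" "f \<longlonglongrightarrow> x" using \<open>x \<in> closure D\<close> closure_sequential by metis
    have "(\<lambda>n. g (f n)) \<longlonglongrightarrow> g x" unfolding g_def using f aD[OF that] by (intro tendsto_intros) auto
    then show ?thesis using f closure_sequential by (metis imageI)
  qed
  have 3: "0 \<in> closure (g ` D)"
    unfolding closure_approachable
  proof (intro allI impI)
    fix e :: real assume "0 < e"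
    obtain x where x: "x \<in> D" "1 / e + norm a < norm x"
      using D(2) unfolding bounded_iff by (meson not_le)
    then have "1 / e < norm (x - a)" using norm_triangle_ineq2[of x a] by linarith
    moreover have "x \<noteq> a" using x(1) aD Dcl by blast
    ultimately have "dist (g x) 0 < e" using \<open>0 < e\<close> by (simp add: g_def norm_divide field_simps)
    then show "\<exists>y\<in>g ` D. dist y 0 < e" using x by blast
  qed
  have fr: "frontier D = closure D - D" "frontier (g ` D) = closure (g ` D) - g ` D"
    using D(1) op by (simp_all add: frontier_def interior_open)
  have "frontier (g ` D) = insert 0 (g ` frontier D)"
  proof (intro equalityI subsetI)
    fix y assume y: "y \<in> frontier (g ` D)"
    show "y \<in> insert 0 (g ` frontier D)"
    proof (cases "y = 0")
      case False
      have "y \<in> closure (g ` D)" "y \<notin> g ` D" using y fr(2) by auto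
      then have "k y \<in> closure D" "k y \<notin> D" using 1 False gD by auto
      then have "k y \<in> frontier D" using fr(1) by simp
      then show ?thesis using gk by (metis imageI insertCI)
    qed simp
  next
    fix y assume "y \<in> insert 0 (g ` frontier D)"
    then consider "y = 0" | x where "x \<in> frontier D" "y = g x" by blast
    then show "y \<in> frontier (g ` D)"
    proof cases
      case 1
      have "0 \<notin> g ` D" using gD by auto
      then show ?thesis using 1 3 fr(2) by simp
    next
      case (2 x)
      then have x: "x \<in> closure D" "x \<notin> D" using fr(1) by auto
      then have "g x \<notin> g ` D" using kg by (metis imageE)
      then show ?thesis using x(1) \<open>y = g x\<close> fr(2) \<open>\<And>x. x \<in> closure D \<Longrightarrow> g x \<in> closure (g ` D)\<close> by simp
    qed
  qed
  then show ?thesis by (simp add: g_def)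
qed

section \<open>Boundary extension of bounded maps with small Schwarzian\<close>

text \<open>Inversion changes the pre-Schwarzian P to P - 2h'/(h - a), and the extra terms coming
  from the derivative and from half the square cancel. This makes the Schwarzian hypothesis on h
  available for a bounded function.\<close>

lemma Schwarzian_inversion:
  assumes h: "h holomorphic_on S" "open S" "\<And>z. z \<in> S \<Longrightarrow> deriv h z \<noteq> 0" "\<And>z. z \<in> S \<Longrightarrow> h z \<noteq> a"
    and z: "z \<in> S"
  shows "Schwarzian (\<lambda>z. 1 / (h z - a)) z = Schwarzian h z"
proof -
  define g where "g = (\<lambda>z. 1 / (h z - a))"
  have Dh: "(h has_field_derivative deriv h w) (at w)" "(deriv h has_field_derivative deriv (deriv h) w) (at w)"
    if "w \<in> S" for w
    using that h holomorphic_derivI holomorphic_deriv by blast+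
  have g1: "deriv g w = - deriv h w / (h w - a)\<^sup>2" if "w \<in> S" for w
    unfolding g_def using Dh(1)[OF that] h(4)[OF that]
    by (intro DERIV_imp_deriv) (auto intro!: derivative_eq_intros simp: power2_eq_square)
  have g2: "deriv (deriv g) w = - deriv (deriv h) w / (h w - a)\<^sup>2 + 2 * (deriv h w)\<^sup>2 / (h w - a)^3"
    if w: "w \<in> S" for w
  proof -
    define k where "k = (\<lambda>w. h w - a)"
    have "(k has_field_derivative deriv h w) (at w)"
      unfolding k_def using Dh[OF w] by (auto intro!: derivative_eq_intros)
    moreover have "k w \<noteq> 0" using h(4)[OF w] by (simp add: k_def)
    ultimately have "((\<lambda>w. - deriv h w / (k w)\<^sup>2) has_field_derivative
         - deriv (deriv h) w / (k w)\<^sup>2 + 2 * (deriv h w)\<^sup>2 / (k w)^3) (at w)"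
      using Dh[OF w] by (auto intro!: derivative_eq_intros simp: field_simps power2_eq_square power3_eq_cube)
    then have "((\<lambda>w. - deriv h w / (h w - a)\<^sup>2) has_field_derivative
         - deriv (deriv h) w / (h w - a)\<^sup>2 + 2 * (deriv h w)\<^sup>2 / (h w - a)^3) (at w)"
      by (simp add: k_def)
    then have "(deriv g has_field_derivative
         - deriv (deriv h) w / (h w - a)\<^sup>2 + 2 * (deriv h w)\<^sup>2 / (h w - a)^3) (at w)"
      by (rule has_field_derivative_transform_within_open[OF _ h(2) w]) (simp add: g1)
    then show ?thesis by (rule DERIV_imp_deriv)
  qed
  have P: "pre_Schwarzian g w = pre_Schwarzian h w - 2 * deriv h w / (h w - a)" if w: "w \<in> S" for w
  proof -
    have alg: "(- p / u\<^sup>2 + 2 * q\<^sup>2 / u^3) / (- q / u\<^sup>2) = p / q - 2 * q / u" if "u \<noteq> 0" "q \<noteq> 0" for p q u :: complex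
      using that by (simp add: field_simps power2_eq_square power3_eq_cube)
    show ?thesis
      unfolding pre_Schwarzian_def g1[OF w] g2[OF w] by (rule alg) (use h(3,4)[OF w] in auto)
  qed
  have "(pre_Schwarzian h has_field_derivative deriv (pre_Schwarzian h) z) (at z)"
    using holomorphic_pre_Schwarzian[OF h(1,2,3)] h(2) z holomorphic_derivI by blast
  then have "((\<lambda>w. pre_Schwarzian h w - 2 * deriv h w / (h w - a)) has_field_derivative
      deriv (pre_Schwarzian h) z - (2 * deriv (deriv h) z * (h z - a) - 2 * deriv h z * deriv h z) / ((h z - a) * (h z - a))) (at z)"
    using Dh[OF z] h(4)[OF z] by (auto intro!: derivative_eq_intros)
  then have "(pre_Schwarzian g has_field_derivative
      deriv (pre_Schwarzian h) z - (2 * deriv (deriv h) z * (h z - a) - 2 * deriv h z * deriv h z) / ((h z - a) * (h z - a))) (at z)"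
    by (rule has_field_derivative_transform_within_open[OF _ h(2) z]) (simp add: P)
  then have "deriv (pre_Schwarzian g) z = deriv (pre_Schwarzian h) z -
      (2 * deriv (deriv h) z * (h z - a) - 2 * deriv h z * deriv h z) / ((h z - a) * (h z - a))"
    by (rule DERIV_imp_deriv)
  moreover have alg: "x - (2 * (p * q) * u - 2 * q * q) / (u * u) - (p - 2 * q / u)\<^sup>2 / 2 = x - p\<^sup>2 / 2"
    if "u \<noteq> 0" for x p q u :: complex
    using that by (simp add: field_simps power2_eq_square)
  moreover have "deriv (deriv h) z = pre_Schwarzian h z * deriv h z"
    using h(3)[OF z] by (simp add: pre_Schwarzian_def)
  ultimately have "Schwarzian g z = Schwarzian h z"
    unfolding Schwarzian_def P[OF z]
    by (simp only:) (rule alg, use h(4)[OF z] in simp)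
  then show ?thesis by (simp add: g_def)
qed

section \<open>Local estimates near the boundary\<close>

lemma Schwarzian_vanishes_at_boundaryD:
  assumes "Schwarzian_vanishes_at_boundary h" "0 < \<sigma>"
  obtains \<delta> where "0 < \<delta>" "\<And>z. 0 < Re z \<Longrightarrow> Re z \<le> \<delta> \<Longrightarrow> (Re z)\<^sup>2 * norm (Schwarzian h z) \<le> \<sigma>"
proof -
  define F where "F = (\<lambda>t::real. SUP z\<in>{z. 0 < Re z \<and> Re z \<le> t}. ereal (1/2 * (2 * Re z)\<^sup>2 * norm (Schwarzian h z)))"
  have "(F \<longlongrightarrow> 0) (at_right 0)"
    using assms(1) by (simp add: Schwarzian_vanishes_at_boundary_def F_def)
  then have "\<forall>\<^sub>F t in at_right 0. F t < ereal \<sigma>"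
    using assms(2) by (intro order_tendstoD) auto
  then obtain b where b: "0 < b" "\<And>t. 0 < t \<Longrightarrow> t < b \<Longrightarrow> F t < ereal \<sigma>"
    unfolding eventually_at_right_field by auto
  have "(Re z)\<^sup>2 * norm (Schwarzian h z) \<le> \<sigma>" if z: "0 < Re z" "Re z \<le> b / 2" for z
  proof -
    have "ereal (1/2 * (2 * Re z)\<^sup>2 * norm (Schwarzian h z)) \<le> F (b / 2)"
      unfolding F_def by (rule SUP_upper) (use z in auto)
    also have "\<dots> < ereal \<sigma>" using b by auto
    finally have "2 * ((Re z)\<^sup>2 * norm (Schwarzian h z)) < \<sigma>"
      by (simp add: power_mult_distrib)
    moreover have "0 \<le> (Re z)\<^sup>2 * norm (Schwarzian h z)" by simp
    ultimately show ?thesis by linarith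
  qed
  with b(1) that[of "b / 2"] show ?thesis by auto
qed

text \<open>The weight min (Re w) d covers the whole path: at distance s along a horizontal piece
  both entries are at least s, and on the crossing segment both are at least d. That segment lies in
  K by convexity. The cap d is needed because far from the boundary Re w |P| need not be
  small.\<close>

lemma near_isometry_on_convex:
  fixes f A B :: "complex \<Rightarrow> complex" and d :: real
  assumes d: "d = norm (z\<^sub>1 - z\<^sub>2)" and z: "z\<^sub>1 \<in> \<H>" "z\<^sub>2 \<in> \<H>"
    and f': "\<And>w. w \<in> \<H> \<Longrightarrow> (f has_field_derivative A w * B w) (at w)"
    and A: "A holomorphic_on \<H>" "\<And>w. w \<in> \<H> \<Longrightarrow> A w \<noteq> 0"
    and B: "\<And>w. w \<in> \<H> \<Longrightarrow> norm (B w - 1) \<le> 1/32"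
    and K: "convex K" "\<And>s. 0 \<le> s \<Longrightarrow> s \<le> d \<Longrightarrow> z\<^sub>1 + of_real s \<in> K" "\<And>s. 0 \<le> s \<Longrightarrow> s \<le> d \<Longrightarrow> z\<^sub>2 + of_real s \<in> K"
    and bd: "\<And>w. w \<in> K \<Longrightarrow> w \<in> \<H> \<Longrightarrow> min (Re w) d * norm (deriv A w / A w) \<le> 1/32"
  shows "norm (f z\<^sub>1 - f z\<^sub>2 - A (z\<^sub>1 + of_real d) * (z\<^sub>1 - z\<^sub>2)) \<le> norm (A (z\<^sub>1 + of_real d)) * d / 2"
proof (cases "d = 0")
  case False
  then have d0: "0 < d" using d by simp
  obtain \<Lambda> where L: "\<And>z. z \<in> \<H> \<Longrightarrow> A z = exp (\<Lambda> z)"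
    "\<And>z. z \<in> \<H> \<Longrightarrow> (\<Lambda> has_field_derivative deriv A z / A z) (at z)"
    using holomorphic_log_right_half_plane[OF A] by blast
  have le: "norm (deriv A w / A w) \<le> (1/32) / s" if "w \<in> K" "w \<in> \<H>" "0 < s" "s \<le> d" "s \<le> Re w" for w s
  proof -
    have "s * norm (deriv A w / A w) \<le> min (Re w) d * norm (deriv A w / A w)"
      using that by (intro mult_right_mono) auto
    also have "\<dots> \<le> 1/32" using bd that by blast
    finally show ?thesis using \<open>0 < s\<close> by (simp add: field_simps)
  qed
  show ?thesis
  proof (rule near_isometry_estimate[OF d z f' L B])
    fix s :: real assume s: "0 < s" "s \<le> d"
    show "norm (deriv A (z\<^sub>1 + of_real s) / A (z\<^sub>1 + of_real s)) \<le> (1/32) / s"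
      by (rule le) (use s z K in \<open>auto simp: right_half_plane_def\<close>)
    show "norm (deriv A (z\<^sub>2 + of_real s) / A (z\<^sub>2 + of_real s)) \<le> (1/32) / s"
      by (rule le) (use s z K in \<open>auto simp: right_half_plane_def\<close>)
  next
    fix w assume w: "w \<in> closed_segment (z\<^sub>1 + of_real d) (z\<^sub>2 + of_real d)"
    have "closed_segment (z\<^sub>1 + of_real d) (z\<^sub>2 + of_real d) \<subseteq> K \<inter> {w. d \<le> Re w}"
      by (rule closed_segment_subset)
        (use K d0 z in \<open>auto simp: right_half_plane_def intro!: convex_Int convex_halfspace_Re_ge\<close>)
    with w have "w \<in> K" "d \<le> Re w" by auto
    then show "norm (deriv A w / A w) \<le> (1/32) / d"
      using d0 by (intro le) (auto simp: right_half_plane_def)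
  qed
qed (use d in auto)

lemma cball_subset_right_half_plane:
  assumes "r < Re z"
  shows "cball z r \<subseteq> \<H>"
proof
  fix w assume "w \<in> cball z r"
  then have "\<bar>Re (z - w)\<bar> \<le> r"
    using abs_Re_le_cmod[of "z - w"] by (simp add: dist_norm)
  then have "0 < Re w" using assms unfolding minus_complex.sel by linarith
  then show "w \<in> \<H>" by (simp add: right_half_plane_def)
qed

lemma Cauchy_estimate_ball:
  assumes f: "f holomorphic_on \<H>" and r: "0 < r" "r < Re z"
    and B: "\<And>w. norm (z - w) = r \<Longrightarrow> norm (f w - a) \<le> B"
  shows "r * norm (deriv f z) \<le> B"
proof -
  have zH: "z \<in> \<H>" using r by (simp add: right_half_plane_def)
  have sub: "cball z r \<subseteq> \<H>" using r(2) by (rule cball_subset_right_half_plane)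
  have hol: "(\<lambda>w. f w - a) holomorphic_on \<H>" using f by (intro holomorphic_intros)
  have "norm ((deriv ^^ 1) (\<lambda>w. f w - a) z) \<le> fact 1 * B / r ^ 1"
  proof (rule Cauchy_inequality)
    show "(\<lambda>w. f w - a) holomorphic_on ball z r"
      using sub ball_subset_cball holomorphic_on_subset[OF hol] by blast
    show "continuous_on (cball z r) (\<lambda>w. f w - a)"
      using sub holomorphic_on_imp_continuous_on[OF hol] continuous_on_subset by blast
  qed (use r B in auto)
  moreover have "deriv (\<lambda>w. f w - a) z = deriv f z"
    using holomorphic_derivI[OF f _ zH] by (intro DERIV_imp_deriv) (auto intro!: derivative_eq_intros)
  ultimately show ?thesis using r by (simp add: field_simps)
qed

lemma Cauchy_estimate_right_half_plane:
  assumes "f holomorphic_on \<H>" "z \<in> \<H>" "\<And>w. w \<in> \<H> \<Longrightarrow> norm (f w) \<le> B"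
  shows "Re z * norm (deriv f z) \<le> 2 * B"
proof -
  have "0 < Re z" using assms(2) by (simp add: right_half_plane_def)
  then have sub: "cball z (Re z / 2) \<subseteq> \<H>" by (intro cball_subset_right_half_plane) simp
  have "Re z / 2 * norm (deriv f z) \<le> B"
  proof (rule Cauchy_estimate_ball[OF assms(1), where a = 0])
    fix w assume "norm (z - w) = Re z / 2"
    then have "w \<in> cball z (Re z / 2)" by (simp add: dist_norm)
    then show "norm (f w - 0) \<le> B" using sub assms(3) by auto
  qed (use \<open>0 < Re z\<close> in auto)
  then show ?thesis by simp
qed

text \<open>Heights are bounded because the lower bound for |g'| on Re z = \<delta> comes from
  compactness of a vertical segment. The upper bound 2B is Cauchy's estimate for the bounded g; the
  summand 1 in \<open>2 * B + 1\<close> ensures positivity.\<close>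

lemma pre_Schwarzian_small_strip:
  assumes g: "g holomorphic_on \<H>" "\<And>z. z \<in> \<H> \<Longrightarrow> deriv g z \<noteq> 0"
    and B: "\<And>z. z \<in> \<H> \<Longrightarrow> norm (g z) \<le> B"
    and S: "\<And>\<sigma>. 0 < \<sigma> \<Longrightarrow> \<exists>\<delta>>0. \<forall>z. 0 < Re z \<longrightarrow> Re z \<le> \<delta> \<longrightarrow> (Re z)\<^sup>2 * norm (Schwarzian g z) \<le> \<sigma>"
    and "0 \<le> Y"
  obtains \<eta> where "0 < \<eta>" "\<And>z. 0 < Re z \<Longrightarrow> Re z \<le> \<eta> \<Longrightarrow> \<bar>Im z\<bar> \<le> Y \<Longrightarrow> Re z * norm (pre_Schwarzian g z) \<le> 1/32"
proof -
  obtain \<delta> where \<delta>: "0 < \<delta>" "\<And>z. 0 < Re z \<Longrightarrow> Re z \<le> \<delta> \<Longrightarrow> (Re z)\<^sup>2 * norm (Schwarzian g z) \<le> (1/32)\<^sup>2 / 64"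
    using S[of "(1/32)\<^sup>2 / 64"] by auto
  define K where "K = Complex \<delta> ` {-Y..Y}"
  have "K \<subseteq> \<H>" using \<delta>(1) by (auto simp: K_def right_half_plane_def)
  have "continuous_on \<H> (deriv g)"
    using g(1) by (intro holomorphic_on_imp_continuous_on holomorphic_deriv) auto
  have "continuous_on {-Y..Y} (\<lambda>y. Complex \<delta> y)"
    unfolding Complex_eq by (intro continuous_intros)
  then have "compact K" unfolding K_def by (intro compact_continuous_image) auto
  moreover have "continuous_on K (\<lambda>z. norm (deriv g z))"
    using \<open>K \<subseteq> \<H>\<close> \<open>continuous_on \<H> (deriv g)\<close> continuous_on_subset by (intro continuous_on_norm) blast
  moreover have "K \<noteq> {}" using \<open>0 \<le> Y\<close> by (auto simp: K_def)
  ultimately obtain z\<^sub>0 where z0: "z\<^sub>0 \<in> K" "\<And>z. z \<in> K \<Longrightarrow> norm (deriv g z\<^sub>0) \<le> norm (deriv g z)"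
    using continuous_attains_inf by metis
  have c: "0 < norm (deriv g z\<^sub>0)" using g(2) z0 \<open>K \<subseteq> \<H>\<close> by auto
  have "norm (g 1) \<le> B" using B by (simp add: right_half_plane_def)
  then have "0 \<le> B" by (rule order_trans[OF norm_ge_zero])
  obtain \<eta> where "0 < \<eta>" "\<And>z. 0 < Re z \<Longrightarrow> Re z \<le> \<eta> \<Longrightarrow> Im z \<in> {-Y..Y} \<Longrightarrow> Re z * norm (pre_Schwarzian g z) \<le> 1/32"
  proof (rule riccati_smallness_half_plane[OF g \<delta>(1), where C = "2 * B + 1" and \<epsilon> = "1/32" and Y = "{-Y..Y}" and c = "norm (deriv g z\<^sub>0)"])
    fix z assume "0 < Re z" "Re z \<le> \<delta>" "Im z \<in> {-Y..Y}"
    then show "Re z * norm (deriv g z) \<le> 2 * B + 1"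
      using Cauchy_estimate_right_half_plane[OF g(1) _ B, of z] by (force simp: right_half_plane_def)
  next
    fix y assume "y \<in> {-Y..Y}"
    then show "norm (deriv g z\<^sub>0) \<le> norm (deriv g (Complex \<delta> y))"
      using z0 by (auto simp: K_def)
  qed (use \<delta> c \<open>0 \<le> B\<close> in auto)
  then show ?thesis using that by (auto simp: abs_le_iff)
qed

lemma near_isometry_strip:
  assumes g: "g holomorphic_on \<H>" "\<And>z. z \<in> \<H> \<Longrightarrow> deriv g z \<noteq> 0"
    and \<eta>: "\<And>z. 0 < Re z \<Longrightarrow> Re z \<le> \<eta> \<Longrightarrow> \<bar>Im z\<bar> \<le> Y \<Longrightarrow> Re z * norm (pre_Schwarzian g z) \<le> 1/32"
    and z: "z\<^sub>1 \<in> \<H>" "z\<^sub>2 \<in> \<H>" "\<bar>Im z\<^sub>1\<bar> \<le> Y" "\<bar>Im z\<^sub>2\<bar> \<le> Y"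
      "Re z\<^sub>1 + norm (z\<^sub>1 - z\<^sub>2) \<le> \<eta>" "Re z\<^sub>2 + norm (z\<^sub>1 - z\<^sub>2) \<le> \<eta>"
  shows "norm (g z\<^sub>1 - g z\<^sub>2 - deriv g (z\<^sub>1 + of_real (norm (z\<^sub>1 - z\<^sub>2))) * (z\<^sub>1 - z\<^sub>2))
     \<le> norm (deriv g (z\<^sub>1 + of_real (norm (z\<^sub>1 - z\<^sub>2)))) * norm (z\<^sub>1 - z\<^sub>2) / 2"
proof (rule near_isometry_on_convex[where B = "\<lambda>_. 1" and K = "{w. Re w \<le> \<eta>} \<inter> ({w. Im w \<le> Y} \<inter> {w. Im w \<ge> - Y})"])
  show "convex ({w. Re w \<le> \<eta>} \<inter> ({w. Im w \<le> Y} \<inter> {w. Im w \<ge> - Y}))"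
    by (intro convex_Int convex_halfspace_Re_le convex_halfspace_Im_le convex_halfspace_Im_ge)
  show "(g has_field_derivative deriv g w * 1) (at w)" if "w \<in> \<H>" for w
    using that g(1) holomorphic_derivI by auto
  show "deriv g holomorphic_on \<H>" using g(1) by (intro holomorphic_deriv) auto
  fix w assume w: "w \<in> {w. Re w \<le> \<eta>} \<inter> ({w. Im w \<le> Y} \<inter> {w. Im w \<ge> - Y})" "w \<in> \<H>"
  have "min (Re w) (norm (z\<^sub>1 - z\<^sub>2)) * norm (deriv (deriv g) w / deriv g w) \<le> Re w * norm (deriv (deriv g) w / deriv g w)"
    by (intro mult_right_mono) auto
  also have "\<dots> \<le> 1/32"
    using \<eta>[of w] w by (simp add: right_half_plane_def pre_Schwarzian_def abs_le_iff)
  finally show "min (Re w) (norm (z\<^sub>1 - z\<^sub>2)) * norm (deriv (deriv g) w / deriv g w) \<le> 1/32" .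
qed (use g(2) z in auto)

text \<open>The estimate for the logarithm of g' gives the exponent 1/32. It is weakened to 1/2,
  which turns into a square root; any exponent below 1 would make s |g'(z + s)| tend to 0 with
  s.\<close>

lemma derivative_growth_strip:
  assumes g: "g holomorphic_on \<H>" "\<And>z. z \<in> \<H> \<Longrightarrow> deriv g z \<noteq> 0"
    and \<eta>: "\<And>z. 0 < Re z \<Longrightarrow> Re z \<le> \<eta> \<Longrightarrow> \<bar>Im z\<bar> \<le> Y \<Longrightarrow> Re z * norm (pre_Schwarzian g z) \<le> 1/32"
    and z: "z \<in> \<H>" "\<bar>Im z\<bar> \<le> Y" and s: "0 < s" "s \<le> \<rho>" "Re z + \<rho> \<le> \<eta>"
  shows "norm (deriv g (z + of_real s)) \<le> norm (deriv g (z + of_real \<rho>)) * sqrt (\<rho> / s)"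
proof -
  have "deriv g holomorphic_on \<H>" using g(1) by (intro holomorphic_deriv) auto
  then obtain \<Lambda> where L: "\<And>z. z \<in> \<H> \<Longrightarrow> deriv g z = exp (\<Lambda> z)"
    "\<And>z. z \<in> \<H> \<Longrightarrow> (\<Lambda> has_field_derivative deriv (deriv g) z / deriv g z) (at z)"
    using holomorphic_log_right_half_plane[of "deriv g"] g(2) by blast
  define D where "D = \<Lambda> (z + of_real s) - \<Lambda> (z + of_real \<rho>)"
  have "norm D \<le> 1/32 * ln \<rho> - 1/32 * ln s"
    unfolding D_def
  proof (rule log_growth_estimate[OF z(1) s(1,2) L(2)])
    fix u :: real assume u: "0 < u" "u \<le> \<rho>"
    have zu: "0 < Re (z + of_real u)" "Re (z + of_real u) \<le> \<eta>" "\<bar>Im (z + of_real u)\<bar> \<le> Y" "u \<le> Re (z + of_real u)"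
      using z s u by (auto simp: right_half_plane_def)
    have "u * norm (pre_Schwarzian g (z + of_real u)) \<le> Re (z + of_real u) * norm (pre_Schwarzian g (z + of_real u))"
      by (rule mult_right_mono[OF zu(4) norm_ge_zero])
    also have "\<dots> \<le> 1/32" by (rule \<eta>[OF zu(1-3)])
    finally show "norm (deriv (deriv g) (z + of_real u) / deriv g (z + of_real u)) \<le> 1/32 / u"
      using u by (simp add: pre_Schwarzian_def field_simps)
  qed auto
  also have "\<dots> = 1/32 * ln (\<rho> / s)" using s by (simp add: ln_div)
  also have "\<dots> \<le> 1/2 * ln (\<rho> / s)" using s by (intro mult_right_mono) auto
  finally have "norm (exp D) \<le> exp (1/2 * ln (\<rho> / s))"
    using norm_exp[of D] by (meson exp_le_cancel_iff order_trans)
  also have "\<dots> = sqrt (\<rho> / s)"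
    using s by (simp add: powr_half_sqrt[symmetric] powr_def)
  finally have "norm (deriv g (z + of_real \<rho>)) * norm (exp D) \<le> norm (deriv g (z + of_real \<rho>)) * sqrt (\<rho> / s)"
    by (intro mult_left_mono) auto
  moreover have "deriv g (z + of_real s) = deriv g (z + of_real \<rho>) * exp D"
    using L(1) z s by (simp add: D_def exp_diff right_half_plane_def)
  ultimately show ?thesis by (simp add: norm_mult)
qed

text \<open>There are three regimes. For large |z| all values are small; away from the boundary
  compactness applies; near the boundary the difference of two values at distance d is at most (3/2)
  d |g'(z + d)|, which the growth estimate bounds by a multiple of sqrt d.\<close>

lemma uniformly_continuous_small_Schwarzian:
  assumes g: "g holomorphic_on \<H>" "\<And>z. z \<in> \<H> \<Longrightarrow> deriv g z \<noteq> 0"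
    and B: "\<And>z. z \<in> \<H> \<Longrightarrow> norm (g z) \<le> B"
    and S: "\<And>\<sigma>. 0 < \<sigma> \<Longrightarrow> \<exists>\<delta>>0. \<forall>z. 0 < Re z \<longrightarrow> Re z \<le> \<delta> \<longrightarrow> (Re z)\<^sup>2 * norm (Schwarzian g z) \<le> \<sigma>"
    and lim: "\<And>e. 0 < e \<Longrightarrow> \<exists>R. \<forall>z\<in>\<H>. R < norm z \<longrightarrow> norm (g z) < e"
  shows "uniformly_continuous_on \<H> g"
  unfolding uniformly_continuous_on_def
proof (intro allI impI)
  fix e :: real assume e: "0 < e"
  obtain R0 where R0: "\<And>z. z \<in> \<H> \<Longrightarrow> R0 < norm z \<Longrightarrow> norm (g z) < e / 2"
    using lim[of "e/2"] e by auto
  define R where "R = max R0 0"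
  have R: "0 \<le> R" "\<And>z. z \<in> \<H> \<Longrightarrow> R < norm z \<Longrightarrow> norm (g z) < e / 2"
    using R0 by (auto simp: R_def)
  obtain \<eta> where \<eta>: "0 < \<eta>" "\<And>z. 0 < Re z \<Longrightarrow> Re z \<le> \<eta> \<Longrightarrow> \<bar>Im z\<bar> \<le> R + 1 \<Longrightarrow> Re z * norm (pre_Schwarzian g z) \<le> 1/32"
    using pre_Schwarzian_small_strip[OF g B S, of "R + 1"] R(1) by auto
  have "norm (g 1) \<le> B" using B by (simp add: right_half_plane_def)
  then have B0: "0 \<le> B" by (rule order_trans[OF norm_ge_zero])
  define K where "K = cball 0 (R + 1) \<inter> {z. \<eta> / 4 \<le> Re z}"
  have "K \<subseteq> \<H>" using \<eta>(1) by (auto simp: K_def right_half_plane_def)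
  then have "continuous_on K g"
    using holomorphic_on_imp_continuous_on[OF g(1)] continuous_on_subset by blast
  moreover have "compact K"
    unfolding K_def by (intro compact_Int_closed closed_halfspace_Re_ge) auto
  ultimately have "uniformly_continuous_on K g" by (rule compact_uniformly_continuous)
  then obtain d1 where d1: "0 < d1" "\<And>x y. x \<in> K \<Longrightarrow> y \<in> K \<Longrightarrow> dist x y < d1 \<Longrightarrow> dist (g x) (g y) < e"
    unfolding uniformly_continuous_on_def using e by metis
  define \<rho> where "\<rho> = \<eta> / 2"
  \<comment> \<open>Chosen so that (3B/\<rho>) X < e. The final bound is (3B/\<rho>) sqrt (d
    \<rho>), and the condition d < X^2/\<rho> imposed by \<open>d0\<close> gives sqrt (d \<rho>)
    \<le> X.\<close>
  define X where "X = e * \<rho> / (3 * B + 1)"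
  have pos: "0 < \<rho>" "0 < X" using \<eta>(1) e B0 by (auto simp: \<rho>_def X_def)
  define d0 where "d0 = min (min 1 (\<eta> / 4)) (min d1 (X\<^sup>2 / \<rho>))"
  have "0 < d0" using \<eta>(1) d1(1) pos by (auto simp: d0_def)
  moreover have "dist (g z\<^sub>2) (g z\<^sub>1) < e" if z: "z\<^sub>1 \<in> \<H>" "z\<^sub>2 \<in> \<H>" "dist z\<^sub>2 z\<^sub>1 < d0" for z\<^sub>1 z\<^sub>2
  proof (cases "R < norm z\<^sub>1 \<and> R < norm z\<^sub>2 \<or> z\<^sub>1 = z\<^sub>2")
    case True
    have "dist (g z\<^sub>2) (g z\<^sub>1) \<le> norm (g z\<^sub>2) + norm (g z\<^sub>1)"
      unfolding dist_norm by (rule norm_triangle_ineq4)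
    moreover have "norm (g z\<^sub>2) < e/2 \<and> norm (g z\<^sub>1) < e/2" if "z\<^sub>1 \<noteq> z\<^sub>2"
      using R(2) z True that by blast
    ultimately show ?thesis using e by (cases "z\<^sub>1 = z\<^sub>2") auto
  next
    case False
    define d where "d = norm (z\<^sub>1 - z\<^sub>2)"
    have d: "0 < d" "d < 1" "d < \<eta> / 4" "d < d1" "d < X\<^sup>2 / \<rho>"
      using z(3) False by (auto simp: d_def d0_def dist_norm norm_minus_commute)
    have n: "norm z\<^sub>1 \<le> R + 1" "norm z\<^sub>2 \<le> R + 1"
      using False d(2) norm_triangle_sub[of z\<^sub>1 z\<^sub>2] norm_triangle_sub[of z\<^sub>2 z\<^sub>1]
      by (auto simp: d_def norm_minus_commute)
    have im: "\<bar>Im z\<^sub>1\<bar> \<le> R + 1" "\<bar>Im z\<^sub>2\<bar> \<le> R + 1"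
      using n abs_Im_le_cmod order_trans by blast+
    have "\<bar>Re (z\<^sub>1 - z\<^sub>2)\<bar> \<le> d" unfolding d_def by (rule abs_Re_le_cmod)
    then have re: "Re z\<^sub>2 \<le> Re z\<^sub>1 + d" "Re z\<^sub>1 \<le> Re z\<^sub>2 + d" by auto
    show ?thesis
    proof (cases "\<eta> / 2 \<le> Re z\<^sub>1")
      case True
      then have "z\<^sub>1 \<in> K" "z\<^sub>2 \<in> K" using n re d by (auto simp: K_def)
      then show ?thesis using d1(2) d by (simp add: d_def dist_norm norm_minus_commute)
    next
      case False
      define G where "G = norm (deriv g (z\<^sub>1 + of_real d))"
      have "norm (g z\<^sub>1 - g z\<^sub>2 - deriv g (z\<^sub>1 + of_real d) * (z\<^sub>1 - z\<^sub>2)) \<le> G * d / 2"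
        unfolding d_def G_def
        by (rule near_isometry_strip[OF g \<eta>(2) z(1,2) im]) (use False re d in \<open>auto simp: d_def\<close>)
      then have "norm (g z\<^sub>1 - g z\<^sub>2) \<le> G * d / 2 + G * d"
        using norm_triangle_sub[of "g z\<^sub>1 - g z\<^sub>2" "deriv g (z\<^sub>1 + of_real d) * (z\<^sub>1 - z\<^sub>2)"]
        by (simp add: norm_mult G_def d_def mult_ac)
      moreover have "G \<le> norm (deriv g (z\<^sub>1 + of_real \<rho>)) * sqrt (\<rho> / d)"
        unfolding G_def
        by (rule derivative_growth_strip[OF g \<eta>(2) z(1) im(1)]) (use False d in \<open>auto simp: \<rho>_def\<close>)
      moreover have "norm (deriv g (z\<^sub>1 + of_real \<rho>)) \<le> 2 * B / \<rho>"
      proof -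
        have inH: "z\<^sub>1 + of_real \<rho> \<in> \<H>" using z(1) pos by (simp add: right_half_plane_def)
        have "\<rho> * norm (deriv g (z\<^sub>1 + of_real \<rho>)) \<le> Re (z\<^sub>1 + of_real \<rho>) * norm (deriv g (z\<^sub>1 + of_real \<rho>))"
          using z(1) by (intro mult_right_mono) (auto simp: right_half_plane_def)
        also have "\<dots> \<le> 2 * B" by (rule Cauchy_estimate_right_half_plane[OF g(1) inH B])
        finally show ?thesis using pos by (simp add: field_simps)
      qed
      then have "norm (deriv g (z\<^sub>1 + of_real \<rho>)) * sqrt (\<rho> / d) \<le> 2 * B / \<rho> * sqrt (\<rho> / d)"
        using d pos by (intro mult_right_mono) auto
      ultimately have "G * d \<le> 2 * B / \<rho> * sqrt (\<rho> / d) * d"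
        using d by (intro mult_right_mono) auto
      also have "\<dots> = 2 * B / \<rho> * sqrt (d * \<rho>)"
      proof -
        have "sqrt (\<rho> / d) * d = sqrt (\<rho> / d) * sqrt (d * d)" using d by simp
        also have "\<dots> = sqrt (d * \<rho>)" using d by (simp only: real_sqrt_mult[symmetric]) (simp add: mult.commute)
        finally show ?thesis by simp
      qed
      also have "\<dots> \<le> 2 * B / \<rho> * X"
      proof -
        have "d * \<rho> \<le> X\<^sup>2" using d pos by (simp add: field_simps)
        then have "sqrt (d * \<rho>) \<le> X" using pos by (intro real_le_lsqrt) auto
        then show ?thesis using B0 pos by (intro mult_left_mono) auto
      qed
      finally have "3 / 2 * (G * d) \<le> 3 * B / \<rho> * X" by simp
      also have "\<dots> = 3 * B * e / (3 * B + 1)" using pos by (simp add: X_def)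
      also have "\<dots> < e" using B0 e by (simp add: field_simps)
      finally have "3 / 2 * (G * d) < e" .
      moreover have "norm (g z\<^sub>1 - g z\<^sub>2) \<le> 3 / 2 * (G * d)"
        using \<open>norm (g z\<^sub>1 - g z\<^sub>2) \<le> G * d / 2 + G * d\<close> by simp
      ultimately show ?thesis by (simp add: dist_norm norm_minus_commute)
    qed
  qed
  ultimately show "\<exists>d>0. \<forall>x\<in>\<H>. \<forall>x'\<in>\<H>. dist x' x < d \<longrightarrow> dist (g x') (g x) < e" by blast
qed

text \<open>Uniform continuity provides the extension. Local injectivity on the imaginary axis
  survives the passage to the limit because the near-isometry estimate evaluates g' at distance d to
  the right, which stays inside the half-plane where g' is continuous and nonzero.\<close>

lemma boundary_extension_small_Schwarzian:
  assumes g: "g holomorphic_on \<H>" "\<And>z. z \<in> \<H> \<Longrightarrow> deriv g z \<noteq> 0"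
    and B: "\<And>z. z \<in> \<H> \<Longrightarrow> norm (g z) \<le> B"
    and S: "\<And>\<sigma>. 0 < \<sigma> \<Longrightarrow> \<exists>\<delta>>0. \<forall>z. 0 < Re z \<longrightarrow> Re z \<le> \<delta> \<longrightarrow> (Re z)\<^sup>2 * norm (Schwarzian g z) \<le> \<sigma>"
    and lim: "\<And>e. 0 < e \<Longrightarrow> \<exists>R. \<forall>z\<in>\<H>. R < norm z \<longrightarrow> norm (g z) < e"
  obtains G where "continuous_on {z. 0 \<le> Re z} G" "\<And>z. z \<in> \<H> \<Longrightarrow> G z = g z"
    "\<And>e. 0 < e \<Longrightarrow> \<exists>R. \<forall>z. 0 \<le> Re z \<longrightarrow> R < norm z \<longrightarrow> norm (G z) < e"
    "\<And>y. \<exists>\<rho>>0. \<forall>y'. y' \<noteq> y \<longrightarrow> \<bar>y' - y\<bar> < \<rho> \<longrightarrow> G (Complex 0 y') \<noteq> G (Complex 0 y)"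
proof -
  obtain G where G: "uniformly_continuous_on (closure \<H>) G" "\<And>z. z \<in> \<H> \<Longrightarrow> g z = G z"
    using uniformly_continuous_on_extension_on_closure[OF uniformly_continuous_small_Schwarzian[OF assms]] by metis
  have cl: "closure \<H> = {z. 0 \<le> Re z}"
    unfolding right_half_plane_def using closure_halfspace_gt[of "1::complex" 0] by (simp add: inner_complex_def)
  have cont: "continuous_on {z. 0 \<le> Re z} G"
    using uniformly_continuous_imp_continuous[OF G(1)] cl by simp
  define zn where "zn = (\<lambda>z n. z + complex_of_real (inverse (real (Suc n))))"
  have zn: "(zn z) \<longlonglongrightarrow> z" for z
  proof -
    have "(zn z) \<longlonglongrightarrow> z + of_real 0"
      unfolding zn_def by (intro tendsto_intros LIMSEQ_inverse_real_of_nat)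
    then show ?thesis by simp
  qed
  have Re_zn: "Re (zn z n) = Re z + inverse (real (Suc n))" for z n
    by (simp only: zn_def plus_complex.sel Re_complex_of_real)
  have znH: "zn z n \<in> \<H>" if "0 \<le> Re z" for z n
    using that by (simp add: zn_def right_half_plane_def add_nonneg_pos)
  have limG: "(\<lambda>n. g (zn z n)) \<longlonglongrightarrow> G z" if "0 \<le> Re z" for z
  proof -
    have "(\<lambda>n. G (zn z n)) \<longlonglongrightarrow> G z"
      using cont unfolding continuous_on_sequentially
      using that zn znH by (auto simp: right_half_plane_def o_def less_imp_le)
    then show ?thesis using G(2)[OF znH[OF that]] by simp
  qed
  have far: "\<exists>R. \<forall>z. 0 \<le> Re z \<longrightarrow> R < norm z \<longrightarrow> norm (G z) < e" if "0 < e" for e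
  proof -
    obtain R where R: "\<And>z. z \<in> \<H> \<Longrightarrow> R < norm z \<Longrightarrow> norm (g z) < e / 2"
      using lim[of "e/2"] \<open>0 < e\<close> by auto
    have "norm (G z) < e" if z: "0 \<le> Re z" "R < norm z" for z
    proof -
      have "\<forall>\<^sub>F n in sequentially. R < norm (zn z n)"
        using order_tendstoD(1)[OF tendsto_norm[OF zn] z(2)] .
      then have "\<forall>\<^sub>F n in sequentially. norm (g (zn z n)) \<le> e / 2"
        by eventually_elim (use R znH[OF z(1)] in \<open>auto intro: less_imp_le\<close>)
      then have "norm (G z) \<le> e / 2"
        by (rule tendsto_upperbound[OF tendsto_norm[OF limG[OF z(1)]]]) simp
      then show ?thesis using \<open>0 < e\<close> by simp
    qed
    then show ?thesis by blast
  qed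
  have inj: "\<exists>\<rho>>0. \<forall>y'. y' \<noteq> y \<longrightarrow> \<bar>y' - y\<bar> < \<rho> \<longrightarrow> G (Complex 0 y') \<noteq> G (Complex 0 y)" for y
  proof -
    define Y where "Y = \<bar>y\<bar> + 1"
    obtain \<eta> where \<eta>: "0 < \<eta>" "\<And>z. 0 < Re z \<Longrightarrow> Re z \<le> \<eta> \<Longrightarrow> \<bar>Im z\<bar> \<le> Y \<Longrightarrow> Re z * norm (pre_Schwarzian g z) \<le> 1/32"
      using pre_Schwarzian_small_strip[OF g B S, of Y] by (auto simp: Y_def)
    \<comment> \<open>The bound 1 keeps both heights within Y; \<eta>/2 leaves room in the strip for
      the approximating points moved right by d.\<close>
    have "G (Complex 0 y') \<noteq> G (Complex 0 y)" if y': "y' \<noteq> y" "\<bar>y' - y\<bar> < min 1 (\<eta> / 2)" for y'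
    proof
      assume eq: "G (Complex 0 y') = G (Complex 0 y)"
      define z\<^sub>1 z\<^sub>2 where "z\<^sub>1 = Complex 0 y" and "z\<^sub>2 = Complex 0 y'"
      define d where "d = norm (z\<^sub>1 - z\<^sub>2)"
      have "z\<^sub>1 - z\<^sub>2 = \<i> * of_real (y - y')" by (simp add: z\<^sub>1_def z\<^sub>2_def complex_eq_iff)
      then have d: "d = \<bar>y - y'\<bar>" unfolding d_def by (simp only: norm_mult norm_of_real) simp
      then have d': "0 < d" "d < 1" "d < \<eta> / 2" using y' abs_minus_commute[of y y'] by auto
      have inH: "z\<^sub>1 + of_real d \<in> \<H>" using d' by (simp add: z\<^sub>1_def right_half_plane_def)
      have cg': "continuous_on \<H> (deriv g)"
        using g(1) by (intro holomorphic_on_imp_continuous_on holomorphic_deriv) auto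
      have "isCont (deriv g) (z\<^sub>1 + of_real d)"
        using cg' inH by (simp add: continuous_on_eq_continuous_at)
      moreover have "(\<lambda>n. zn z\<^sub>1 n + of_real d) \<longlonglongrightarrow> z\<^sub>1 + of_real d"
        by (intro tendsto_intros zn)
      ultimately have g': "(\<lambda>n. deriv g (zn z\<^sub>1 n + of_real d)) \<longlonglongrightarrow> deriv g (z\<^sub>1 + of_real d)"
        by (rule isCont_tendsto_compose)
      have diff: "zn z\<^sub>1 n - zn z\<^sub>2 n = z\<^sub>1 - z\<^sub>2" for n by (simp add: zn_def)
      have "\<forall>\<^sub>F n in sequentially. inverse (real (Suc n)) < \<eta> / 2"
        using order_tendstoD(2)[OF LIMSEQ_inverse_real_of_nat, of "\<eta> / 2"] \<eta>(1) by simp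
      then have ev: "\<forall>\<^sub>F n in sequentially. norm (g (zn z\<^sub>1 n) - g (zn z\<^sub>2 n) - deriv g (zn z\<^sub>1 n + of_real d) * (z\<^sub>1 - z\<^sub>2))
          \<le> norm (deriv g (zn z\<^sub>1 n + of_real d)) * d / 2"
      proof eventually_elim
        case (elim n)
        have "norm (g (zn z\<^sub>1 n) - g (zn z\<^sub>2 n) - deriv g (zn z\<^sub>1 n + of_real (norm (zn z\<^sub>1 n - zn z\<^sub>2 n))) * (zn z\<^sub>1 n - zn z\<^sub>2 n))
          \<le> norm (deriv g (zn z\<^sub>1 n + of_real (norm (zn z\<^sub>1 n - zn z\<^sub>2 n)))) * norm (zn z\<^sub>1 n - zn z\<^sub>2 n) / 2"
        proof (rule near_isometry_strip[OF g \<eta>(2)])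
          show "zn z\<^sub>1 n \<in> \<H>" "zn z\<^sub>2 n \<in> \<H>" by (auto intro!: znH simp: z\<^sub>1_def z\<^sub>2_def)
          show "\<bar>Im (zn z\<^sub>1 n)\<bar> \<le> Y" "\<bar>Im (zn z\<^sub>2 n)\<bar> \<le> Y"
            using y' by (auto simp: zn_def z\<^sub>1_def z\<^sub>2_def Y_def)
          show "Re (zn z\<^sub>1 n) + norm (zn z\<^sub>1 n - zn z\<^sub>2 n) \<le> \<eta>" "Re (zn z\<^sub>2 n) + norm (zn z\<^sub>1 n - zn z\<^sub>2 n) \<le> \<eta>"
            unfolding diff d_def[symmetric] using elim d' by (auto simp: Re_zn z\<^sub>1_def z\<^sub>2_def)
        qed auto
        then show ?case unfolding diff d_def[symmetric] .
      qed
      have "norm (G z\<^sub>1 - G z\<^sub>2 - deriv g (z\<^sub>1 + of_real d) * (z\<^sub>1 - z\<^sub>2)) \<le> norm (deriv g (z\<^sub>1 + of_real d)) * d / 2"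
      proof (rule tendsto_le[OF _ _ _ ev])
        show "(\<lambda>n. norm (deriv g (zn z\<^sub>1 n + of_real d)) * d / 2) \<longlonglongrightarrow> norm (deriv g (z\<^sub>1 + of_real d)) * d / 2"
          by (intro tendsto_intros g') simp
        show "(\<lambda>n. norm (g (zn z\<^sub>1 n) - g (zn z\<^sub>2 n) - deriv g (zn z\<^sub>1 n + of_real d) * (z\<^sub>1 - z\<^sub>2)))
          \<longlonglongrightarrow> norm (G z\<^sub>1 - G z\<^sub>2 - deriv g (z\<^sub>1 + of_real d) * (z\<^sub>1 - z\<^sub>2))"
          by (intro tendsto_intros g' limG) (auto simp: z\<^sub>1_def z\<^sub>2_def)
      qed simp
      moreover have "G z\<^sub>1 = G z\<^sub>2" using eq by (simp add: z\<^sub>1_def z\<^sub>2_def)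
      ultimately have "norm (deriv g (z\<^sub>1 + of_real d)) * d \<le> norm (deriv g (z\<^sub>1 + of_real d)) * d / 2"
        by (simp add: norm_mult flip: d_def)
      moreover have "0 < norm (deriv g (z\<^sub>1 + of_real d)) * d"
        using g(2)[OF inH] d' by simp
      ultimately show False by linarith
    qed
    moreover have "0 < min 1 (\<eta> / 2)" using \<eta>(1) by simp
    ultimately show ?thesis by blast
  qed
  show ?thesis
    by (rule that[OF cont _ far inj]) (use G(2) in auto)
qed

section \<open>Transfer to the disc by the Cayley map\<close>

lemma cayley_disc_to_half_plane:
  fixes w :: complex
  assumes "norm w \<le> 1" "w \<noteq> 1"
  shows "0 \<le> Re ((1 + w) / (1 - w))" "norm w < 1 \<Longrightarrow> (1 + w) / (1 - w) \<in> \<H>"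
    "norm w = 1 \<Longrightarrow> Re ((1 + w) / (1 - w)) = 0"
proof -
  have "Re ((1 + w) / (1 - w)) = (1 - (norm w)\<^sup>2) / (norm (1 - w))\<^sup>2"
    unfolding Re_divide cmod_power2 by (simp add: power2_eq_square algebra_simps)
  moreover have "0 < (norm (1 - w))\<^sup>2" using assms(2) by simp
  ultimately show "0 \<le> Re ((1 + w) / (1 - w))" "norm w < 1 \<Longrightarrow> (1 + w) / (1 - w) \<in> \<H>"
    "norm w = 1 \<Longrightarrow> Re ((1 + w) / (1 - w)) = 0"
    using assms(1) by (auto simp: right_half_plane_def power_le_one abs_square_less_1)
qed

lemma cayley_half_plane_to_disc:
  fixes z :: complex
  assumes "0 \<le> Re z"
  shows "norm ((z - 1) / (z + 1)) \<le> 1" "(z - 1) / (z + 1) \<noteq> 1"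
    "(1 + (z - 1) / (z + 1)) / (1 - (z - 1) / (z + 1)) = z"
    "0 < Re z \<Longrightarrow> norm ((z - 1) / (z + 1)) < 1"
proof -
  have nz: "z + 1 \<noteq> 0" using assms by (auto simp: complex_eq_iff)
  show "(z - 1) / (z + 1) \<noteq> 1" using nz by (simp add: divide_eq_eq)
  have "(1 + p / q) / (1 - p / q) = (q + p) / (q - p)" if "q \<noteq> 0" for p q :: complex
  proof -
    have "1 + p / q = (q + p) / q" "1 - p / q = (q - p) / q"
      using that by (simp_all add: add_divide_distrib diff_divide_distrib)
    then show ?thesis using that by (simp only: divide_divide_eq_right) simp
  qed
  from this[OF nz, of "z - 1"] show "(1 + (z - 1) / (z + 1)) / (1 - (z - 1) / (z + 1)) = z"
    by simp
  have eq: "(norm (z + 1))\<^sup>2 - (norm (z - 1))\<^sup>2 = 4 * Re z"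
    unfolding cmod_power2 by (simp add: power2_eq_square algebra_simps)
  then have "(norm (z - 1))\<^sup>2 \<le> (norm (z + 1))\<^sup>2" using assms by linarith
  then have "norm (z - 1) \<le> norm (z + 1)" by (rule power2_le_imp_le) simp
  then show "norm ((z - 1) / (z + 1)) \<le> 1" using nz by (simp add: norm_divide)
  show "norm ((z - 1) / (z + 1)) < 1" if "0 < Re z"
  proof -
    have "(norm (z - 1))\<^sup>2 < (norm (z + 1))\<^sup>2" using eq that by linarith
    then have "norm (z - 1) < norm (z + 1)" by (rule power2_less_imp_less) simp
    then show ?thesis using nz by (simp add: norm_divide)
  qed
qed

text \<open>On the disc, infinity becomes the boundary point 1, where decay of G at infinity forces
  the value 0. Injectivity on the closed disc therefore also shows that G vanishes at no finite
  point, which later makes a + 1/G finite on the imaginary axis.\<close>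

lemma injective_boundary_extension:
  fixes G :: "complex \<Rightarrow> complex"
  assumes cont: "continuous_on {z. 0 \<le> Re z} G" and hol: "G holomorphic_on \<H>" and inj: "inj_on G \<H>"
    and far: "\<And>e. 0 < e \<Longrightarrow> \<exists>R. \<forall>z. 0 \<le> Re z \<longrightarrow> R < norm z \<longrightarrow> norm (G z) < e"
    and loc: "\<And>y. \<exists>\<rho>>0. \<forall>y'. y' \<noteq> y \<longrightarrow> \<bar>y' - y\<bar> < \<rho> \<longrightarrow> G (Complex 0 y') \<noteq> G (Complex 0 y)"
    and J: "frontier (G ` \<H>) homeomorphic sphere (0::complex) 1"
  shows "inj_on G {z. 0 \<le> Re z}" "\<And>z. 0 \<le> Re z \<Longrightarrow> G z \<noteq> 0"
proof -
  define c where "c = (\<lambda>w::complex. (1 + w) / (1 - w))"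
  define k where "k = (\<lambda>z::complex. (z - 1) / (z + 1))"
  have c: "0 \<le> Re (c w)" "norm w < 1 \<Longrightarrow> c w \<in> \<H>" "norm w = 1 \<Longrightarrow> Re (c w) = 0"
    if "norm w \<le> 1" "w \<noteq> 1" for w
    unfolding c_def using cayley_disc_to_half_plane[OF that] by auto
  have k: "norm (k z) \<le> 1" "k z \<noteq> 1" "c (k z) = z" "0 < Re z \<Longrightarrow> norm (k z) < 1" if "0 \<le> Re z" for z
    unfolding c_def k_def using cayley_half_plane_to_disc[OF that] by auto
  have c_inj: "w = w'" if "c w = c w'" "w \<noteq> 1" "w' \<noteq> 1" for w w'
  proof -
    have "(1 + w) * (1 - w') = (1 + w') * (1 - w)"
      using that by (simp add: c_def frac_eq_eq)
    then show ?thesis by (simp add: algebra_simps)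
  qed
  define F where "F = (\<lambda>w. if w = 1 then 0 else G (c w))"
  have Fc: "F w = G (c w)" if "w \<noteq> 1" for w using that by (simp add: F_def)
  have contF: "continuous_on (cball 0 1) F"
    unfolding continuous_on_eq_continuous_within
  proof
    fix w :: complex assume w: "w \<in> cball 0 1"
    show "continuous (at w within cball 0 1) F"
    proof (cases "w = 1")
      case False
      have "continuous_on (cball 0 1 - {1}) (\<lambda>w. G (c w))"
      proof (rule continuous_on_compose2[OF cont])
        show "continuous_on (cball 0 1 - {1}) c" unfolding c_def by (intro continuous_intros) auto
        show "c ` (cball 0 1 - {1}) \<subseteq> {z. 0 \<le> Re z}" using c(1) by auto
      qed
      then have "continuous_on (cball 0 1 - {1}) F"
        by (rule continuous_on_eq) (simp add: F_def)
      then have "continuous (at w within cball 0 1 - {1}) F"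
        using w False by (simp add: continuous_on_eq_continuous_within)
      moreover have "at w within cball 0 1 - {1} = at w within cball 0 1"
        by (rule at_within_nhd[of w "- {1}"]) (use False in auto)
      ultimately show ?thesis by simp
    next
      case True
      show ?thesis
        unfolding continuous_within_eps_delta
      proof (intro allI impI)
        fix e :: real assume e: "0 < e"
        then obtain R where R: "\<And>z. 0 \<le> Re z \<Longrightarrow> R < norm z \<Longrightarrow> norm (G z) < e" using far by blast
        \<comment> \<open>From r \<le> 1 it follows that |1 + w'| > 1, and then |1 - w'| < r makes
          |c w'| larger than |R| + 1.\<close>
        define r where "r = 1 / (\<bar>R\<bar> + 1)"
        have "dist (F w') (F w) < e" if w': "w' \<in> cball 0 1" "dist w' w < r" for w'
        proof (cases "w' = 1")
          case False
          have n: "0 < norm (1 - w')" "norm (1 - w') < r"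
            using w' True False by (auto simp: dist_norm norm_minus_commute)
          then have "norm (1 - w') * (\<bar>R\<bar> + 1) < 1" by (simp add: r_def field_simps)
          moreover have "r \<le> 1" by (simp add: r_def)
          moreover have "norm (2::complex) \<le> norm (1 + w') + norm (1 - w')"
            using norm_triangle_ineq[of "1 + w'" "1 - w'"] by simp
          ultimately have "norm (1 - w') * (\<bar>R\<bar> + 1) < norm (1 + w')" using n by simp
          then have "\<bar>R\<bar> + 1 < norm (c w')"
            using n by (simp add: c_def norm_divide field_simps)
          then have "R < norm (c w')" by linarith
          then have "norm (G (c w')) < e" using R c(1)[of w'] w' False by simp
          then show ?thesis using True False by (simp add: F_def)
        qed (use True e in simp)
        moreover have "0 < r" by (simp add: r_def)
        ultimately show "\<exists>d>0. \<forall>x'\<in>cball 0 1. dist x' w < d \<longrightarrow> dist (F x') (F w) < e" by blast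
      qed
    qed
  qed
  have holF: "F holomorphic_on ball 0 1"
  proof -
    have "(\<lambda>w. G (c w)) holomorphic_on ball 0 1"
    proof (rule holomorphic_on_compose_gen[OF _ hol, unfolded o_def])
      show "c holomorphic_on ball 0 1" unfolding c_def by (intro holomorphic_intros) auto
      show "c ` ball 0 1 \<subseteq> \<H>"
      proof (rule image_subsetI)
        fix w :: complex assume "w \<in> ball 0 1"
        then have "norm w < 1" "w \<noteq> 1" by auto
        then show "c w \<in> \<H>" using c(2)[of w] by simp
      qed
    qed
    then show ?thesis by (rule holomorphic_transform) (auto simp: F_def)
  qed
  have injF: "inj_on F (ball 0 1)"
  proof (rule inj_onI)
    fix w w' :: complex assume w: "w \<in> ball 0 1" "w' \<in> ball 0 1" "F w = F w'"
    then have ne: "w \<noteq> 1" "w' \<noteq> 1" by auto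
    have "G (c w) = G (c w')" using w(3) Fc[OF ne(1)] Fc[OF ne(2)] by argo
    moreover have "c w \<in> \<H>" "c w' \<in> \<H>" using w(1,2) ne c(2) by simp_all
    ultimately have "c w = c w'" by (rule inj_onD[OF inj])
    then show "w = w'" using c_inj ne by blast
  qed
  have imF: "F ` ball 0 1 = G ` \<H>"
  proof (intro equalityI subsetI)
    fix y assume "y \<in> F ` ball 0 1"
    then obtain w where "norm w < 1" "y = F w" by auto
    moreover from this have "w \<noteq> 1" by auto
    ultimately show "y \<in> G ` \<H>" using c(2)[of w] by (auto simp: Fc)
  next
    fix y assume "y \<in> G ` \<H>"
    then obtain z where z: "0 < Re z" "y = G z" by (auto simp: right_half_plane_def)
    then have "F (k z) = y" "k z \<in> ball 0 1" using k[of z] by (auto simp: Fc)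
    then show "y \<in> F ` ball 0 1" by blast
  qed
  have injF': "inj_on F (cball 0 1)"
  proof (rule injective_on_closed_disc[OF contF holF injF])
    show "frontier (F ` ball 0 1) homeomorphic sphere (0::complex) 1" using J imF by simp
    fix e :: complex assume e: "norm e = 1" "e \<noteq> 1"
    define y where "y = Im (c e)"
    have ce: "Complex 0 (Im (c w)) = c w" if "norm w = 1" "w \<noteq> 1" for w
      using c(3)[of w] that by (simp add: complex_eq_iff)
    obtain \<rho> where \<rho>: "0 < \<rho>" "\<And>y'. y' \<noteq> y \<Longrightarrow> \<bar>y' - y\<bar> < \<rho> \<Longrightarrow> G (Complex 0 y') \<noteq> G (Complex 0 y)"
      using loc by blast
    have "isCont c e" unfolding c_def using e(2) by (intro continuous_intros) auto
    then obtain s where s: "0 < s" "\<And>w. dist w e < s \<Longrightarrow> dist (c w) (c e) < \<rho>"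
      unfolding continuous_at_eps_delta using \<rho>(1) by blast
    \<comment> \<open>The second entry keeps e' away from 1, where c has a division by zero and F is
      not given by G.\<close>
    define r where "r = min s (dist 1 e)"
    have "F e' \<noteq> F e" if e': "norm e' = 1" "e' \<noteq> e" "dist e' e < r" for e'
    proof -
      have e1: "e' \<noteq> 1" using e'(3) by (auto simp: r_def)
      have "\<bar>Im (c e' - c e)\<bar> < \<rho>"
        using s(2)[of e'] e'(3) abs_Im_le_cmod[of "c e' - c e"] by (simp add: r_def dist_norm)
      moreover have "Im (c e') \<noteq> y"
      proof
        assume "Im (c e') = y"
        then have "c e' = c e" using ce[OF e] ce[OF e'(1) e1] by (simp add: y_def)
        from c_inj[OF this e1 e(2)] e'(2) show False by simp
      qed
      ultimately have "G (Complex 0 (Im (c e'))) \<noteq> G (Complex 0 y)"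
        using \<rho>(2)[of "Im (c e')"] by (simp add: y_def)
      then show ?thesis unfolding y_def ce[OF e] ce[OF e'(1) e1] using Fc[OF e(2)] Fc[OF e1] by argo
    qed
    moreover have "0 < r" using s(1) e(2) by (simp add: r_def)
    ultimately show "\<exists>r>0. \<forall>e'. norm e' = 1 \<longrightarrow> e' \<noteq> e \<longrightarrow> dist e' e < r \<longrightarrow> F e' \<noteq> F e" by blast
  qed
  show "inj_on G {z. 0 \<le> Re z}"
  proof (rule inj_onI)
    fix z z' assume z: "z \<in> {z. 0 \<le> Re z}" "z' \<in> {z. 0 \<le> Re z}" "G z = G z'"
    then have re: "0 \<le> Re z" "0 \<le> Re z'" by auto
    have "F (k z) = F (k z')"
      using Fc[OF k(2)[OF re(1)]] Fc[OF k(2)[OF re(2)]] k(3)[OF re(1)] k(3)[OF re(2)] z(3) by metis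
    moreover have "k z \<in> cball 0 1" "k z' \<in> cball 0 1" using k(1) re by auto
    ultimately have "k z = k z'" by (rule inj_onD[OF injF'])
    then show "z = z'" using k(3)[OF re(1)] k(3)[OF re(2)] by metis
  qed
  show "G z \<noteq> 0" if "0 \<le> Re z" for z
  proof
    assume "G z = 0"
    then have "F (k z) = F 1" using k(2,3)[OF that] by (simp add: F_def)
    moreover have "k z \<in> cball 0 1" "1 \<in> cball (0::complex) 1" using k(1)[OF that] by auto
    ultimately have "k z = 1" by (rule inj_onD[OF injF'])
    then show False using k(2)[OF that] by blast
  qed
qed

section \<open>Uniform continuity of the map and its inverse on the full domains\<close>

lemma uniformly_continuous_on_glue_norm:
  fixes f :: "'a::real_normed_vector \<Rightarrow> 'b::metric_space"
  assumes "uniformly_continuous_on {x \<in> S. norm x > M} f" "uniformly_continuous_on {x \<in> S. norm x \<le> M + 1} f"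
  shows "uniformly_continuous_on S f"
  unfolding uniformly_continuous_on_def
proof (intro allI impI)
  fix e :: real assume e: "0 < e"
  obtain d1 where d1: "0 < d1" "\<And>x y. x \<in> S \<Longrightarrow> norm x > M \<Longrightarrow> y \<in> S \<Longrightarrow> norm y > M \<Longrightarrow> dist y x < d1 \<Longrightarrow> dist (f y) (f x) < e"
    using assms(1) e unfolding uniformly_continuous_on_def by (auto; metis)
  obtain d2 where d2: "0 < d2" "\<And>x y. x \<in> S \<Longrightarrow> norm x \<le> M + 1 \<Longrightarrow> y \<in> S \<Longrightarrow> norm y \<le> M + 1 \<Longrightarrow> dist y x < d2 \<Longrightarrow> dist (f y) (f x) < e"
    using assms(2) e unfolding uniformly_continuous_on_def by (auto; metis)
  \<comment> \<open>The two regions overlap in a shell of width 1, so two points less than 1 apart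
    lie together in one of them.\<close>
  have "dist (f y) (f x) < e" if "x \<in> S" "y \<in> S" "dist y x < min 1 (min d1 d2)" for x y
  proof (cases "norm x > M \<and> norm y > M")
    case False
    have "norm (y - x) < 1" using that by (simp add: dist_norm)
    then have "norm x \<le> M + 1" "norm y \<le> M + 1"
      using False norm_triangle_sub[of x y] norm_triangle_sub[of y x] by (auto simp: norm_minus_commute)
    then show ?thesis using d2(2) that by auto
  qed (use d1(2) that in auto)
  then show "\<exists>d>0. \<forall>x\<in>S. \<forall>x'\<in>S. dist x' x < d \<longrightarrow> dist (f x') (f x) < e"
    using d1(1) d2(1) by (intro exI[of _ "min 1 (min d1 d2)"]) auto
qed

text \<open>Condition (A) takes care of large |z| and |w|. On bounded parts, the extension H = a +
  1/G of h is continuous and injective on compact half-discs, so it and its inverse are uniformly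
  continuous there.\<close>

lemma uniformly_continuous_univalent:
  assumes h: "univalent_on h \<H>"
    and lim: "filterlim h at_infinity (inf at_infinity (principal \<H>))"
    and J: "Jordan_domain (Some ` (h ` \<H>))"
    and S: "Schwarzian_vanishes_at_boundary h"
    and A: "condition_A h"
  shows "uniformly_continuous_on \<H> h" "uniformly_continuous_on (h ` \<H>) (inv_into \<H> h)"
proof -
  have hol: "h holomorphic_on \<H>" and inj: "inj_on h \<H>" using h by (auto simp: univalent_on_def)
  have h': "deriv h z \<noteq> 0" if "z \<in> \<H>" for z using deriv_univalent_nonzero[OF h _ that] by simp
  have inf: "\<exists>R. \<forall>z\<in>\<H>. R < norm z \<longrightarrow> B < norm (h z)" for B
  proof -
    have "eventually (\<lambda>z. B < norm (h z)) (inf at_infinity (principal \<H>))"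
      using filterlim_at_infinity_imp_norm_at_top[OF lim] by (simp add: filterlim_at_top_dense)
    then show ?thesis
      unfolding eventually_inf_principal eventually_at_infinity by (meson less_imp_le)
  qed
  define D where "D = h ` \<H>"
  have "open D" unfolding D_def by (rule open_mapping_thm3[OF hol _ inj]) simp
  have "connected D"
    unfolding D_def using hol by (intro connected_continuous_image convex_connected holomorphic_on_imp_continuous_on) auto
  have "\<not> bounded D"
  proof
    assume "bounded D"
    then obtain B where B: "\<And>w. w \<in> D \<Longrightarrow> norm w \<le> B" by (auto simp: bounded_iff)
    obtain R where R: "\<And>z. z \<in> \<H> \<Longrightarrow> R < norm z \<Longrightarrow> B < norm (h z)" using inf by blast
    have "complex_of_real (\<bar>R\<bar> + 1) \<in> \<H>" by (simp add: right_half_plane_def)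
    moreover from this have "R < norm (complex_of_real (\<bar>R\<bar> + 1))" by (simp only: norm_of_real)
    ultimately show False using R B by (force simp: D_def)
  qed
  obtain a where a: "a \<notin> closure D"
    using Jordan_domain_exterior_point[OF \<open>open D\<close> \<open>connected D\<close> \<open>\<not> bounded D\<close>] J by (auto simp: D_def)
  then obtain r where r: "0 < r" "\<And>w. w \<in> D \<Longrightarrow> r \<le> dist w a"
    by (meson closure_approachable not_le)
  have ha: "h z \<noteq> a" if "z \<in> \<H>" for z using r(1) r(2)[of "h z"] that by (auto simp: D_def)
  define g where "g = (\<lambda>z. 1 / (h z - a))"
  have hg: "h z = a + 1 / g z" for z by (simp add: g_def)
  have holg: "g holomorphic_on \<H>" unfolding g_def using hol ha by (intro holomorphic_intros) auto
  have injg: "inj_on g \<H>" using inj hg unfolding inj_on_def by metis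
  have g': "deriv g z \<noteq> 0" if "z \<in> \<H>" for z
    using holomorphic_injective_imp_regular[OF holg _ injg that] by simp
  have B: "norm (g z) \<le> 1 / r" if "z \<in> \<H>" for z
    using r(1) r(2)[of "h z"] that by (simp add: g_def norm_divide D_def dist_norm frac_le)
  have Sg: "\<exists>\<delta>>0. \<forall>z. 0 < Re z \<longrightarrow> Re z \<le> \<delta> \<longrightarrow> (Re z)\<^sup>2 * norm (Schwarzian g z) \<le> \<sigma>" if \<sigma>: "0 < \<sigma>" for \<sigma>
  proof -
    obtain \<delta> where "0 < \<delta>" "\<And>z. 0 < Re z \<Longrightarrow> Re z \<le> \<delta> \<Longrightarrow> (Re z)\<^sup>2 * norm (Schwarzian h z) \<le> \<sigma>"
      using Schwarzian_vanishes_at_boundaryD[OF S \<sigma>] by blast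
    moreover have "Schwarzian g z = Schwarzian h z" if "0 < Re z" for z
      unfolding g_def by (rule Schwarzian_inversion[OF hol _ h' ha]) (use that in \<open>auto simp: right_half_plane_def open_halfspace_Re_gt\<close>)
    ultimately show ?thesis by metis
  qed
  have limg: "\<exists>R. \<forall>z\<in>\<H>. R < norm z \<longrightarrow> norm (g z) < e" if "0 < e" for e
  proof -
    obtain R where R: "\<And>z. z \<in> \<H> \<Longrightarrow> R < norm z \<Longrightarrow> norm a + 1 / e < norm (h z)" using inf by blast
    have "norm (g z) < e" if "z \<in> \<H>" "R < norm z" for z
    proof -
      have "1 / e < norm (h z - a)" using R[OF that] norm_triangle_ineq2[of "h z" a] by linarith
      moreover have "0 < norm (h z - a)" using ha[OF that(1)] by simp
      ultimately show ?thesis using \<open>0 < e\<close> by (simp add: g_def norm_divide field_simps)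
    qed
    then show ?thesis by blast
  qed
  obtain G where G: "continuous_on {z. 0 \<le> Re z} G" "\<And>z. z \<in> \<H> \<Longrightarrow> G z = g z"
    "\<And>e. 0 < e \<Longrightarrow> \<exists>R. \<forall>z. 0 \<le> Re z \<longrightarrow> R < norm z \<longrightarrow> norm (G z) < e"
    "\<And>y. \<exists>\<rho>>0. \<forall>y'. y' \<noteq> y \<longrightarrow> \<bar>y' - y\<bar> < \<rho> \<longrightarrow> G (Complex 0 y') \<noteq> G (Complex 0 y)"
    using boundary_extension_small_Schwarzian[OF holg g' B Sg limg] by blast
  have gD: "G ` \<H> = (\<lambda>w. 1 / (w - a)) ` D"
    using G(2) by (auto simp: g_def D_def image_iff)
  have Ginj: "inj_on G {z. 0 \<le> Re z}" "\<And>z. 0 \<le> Re z \<Longrightarrow> G z \<noteq> 0"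
  proof (rule_tac [!] injective_boundary_extension[OF G(1)])
    show "G holomorphic_on \<H>" using holg by (rule holomorphic_transform) (simp add: G(2))
    then show "G holomorphic_on \<H>" .
    show "inj_on G \<H>" using injg G(2) by (simp add: inj_on_def)
    then show "inj_on G \<H>" .
    have "frontier (G ` \<H>) = insert 0 ((\<lambda>w. 1 / (w - a)) ` frontier D)"
      unfolding gD by (rule frontier_inversion_image[OF \<open>open D\<close> \<open>\<not> bounded D\<close> a])
    moreover have "a \<notin> frontier D" using a by (simp add: frontier_def)
    ultimately show "frontier (G ` \<H>) homeomorphic sphere (0::complex) 1"
      using Moebius_image_of_Jordan_frontier[OF \<open>open D\<close> \<open>\<not> bounded D\<close>, of a] J by (simp add: D_def)
    then show "frontier (G ` \<H>) homeomorphic sphere (0::complex) 1" .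
  qed (use G(3,4) in auto)
  define H where "H = (\<lambda>z. a + 1 / G z)"
  have Hcont: "continuous_on {z. 0 \<le> Re z} H"
    unfolding H_def using Ginj(2) by (intro continuous_intros G(1)) auto
  have Hinj: "inj_on H {z. 0 \<le> Re z}"
    using Ginj by (auto simp: H_def inj_on_def)
  have Hh: "H z = h z" if "z \<in> \<H>" for z using G(2)[OF that] hg[of z] by (simp add: H_def)
  have HH: "\<H> \<subseteq> {z. 0 \<le> Re z}" by (auto simp: right_half_plane_def)
  define K where "K = (\<lambda>R. cball 0 R \<inter> {z::complex. 0 \<le> Re z})"
  have K: "compact (K R)" "continuous_on (K R) H" "inj_on H (K R)" for R
    unfolding K_def using continuous_on_subset[OF Hcont] inj_on_subset[OF Hinj]
    by (auto intro!: compact_Int_closed closed_halfspace_Re_ge)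
  obtain M where M: "uniformly_continuous_on {z \<in> \<H>. norm z > M} h"
      "uniformly_continuous_on {w \<in> h ` \<H>. norm w > M} (inv_into \<H> h)"
    using A by (auto simp: condition_A_def)
  have uc_cong: "uniformly_continuous_on X f" if "uniformly_continuous_on Y f'" "X \<subseteq> Y" "\<And>x. x \<in> X \<Longrightarrow> f x = f' x"
    for X Y and f f' :: "complex \<Rightarrow> complex"
    using that unfolding uniformly_continuous_on_def by (metis subsetD)
  show "uniformly_continuous_on \<H> h"
  proof (rule uniformly_continuous_on_glue_norm[OF M(1)])
    have "uniformly_continuous_on (K (M + 1)) H" using K by (intro compact_uniformly_continuous)
    then show "uniformly_continuous_on {z \<in> \<H>. norm z \<le> M + 1} h"
      by (rule uc_cong) (use HH Hh in \<open>auto simp: K_def\<close>)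
  qed
  show "uniformly_continuous_on (h ` \<H>) (inv_into \<H> h)"
  proof (rule uniformly_continuous_on_glue_norm[OF M(2)])
    \<comment> \<open>Since h tends to infinity, points w of modulus at most M + 1 have their
      preimages in one half-disc of radius R, which makes compactness applicable to the
      inverse.\<close>
    obtain R where R: "\<And>z. z \<in> \<H> \<Longrightarrow> R < norm z \<Longrightarrow> M + 1 < norm (h z)" using inf by blast
    define k where "k = inv_into (K R) H"
    have kH: "k (H z) = z" if "z \<in> K R" for z using K(3) that by (simp add: k_def)
    have "continuous_on (H ` K R) k"
      by (rule continuous_on_inv[OF K(2,1)]) (use kH in auto)
    then have "uniformly_continuous_on (H ` K R) k"
      using K by (intro compact_uniformly_continuous compact_continuous_image)
    moreover have "w \<in> H ` K R \<and> inv_into \<H> h w = k w" if w: "w \<in> h ` \<H>" "norm w \<le> M + 1" for w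
    proof -
      obtain z where z: "z \<in> \<H>" "w = h z" using w by auto
      then have "norm z \<le> R" using R[of z] w by force
      then have "z \<in> K R" using z HH by (auto simp: K_def)
      moreover have "w = H z" using Hh z by simp
      moreover have "inv_into \<H> h w = z" using z inj by simp
      ultimately show ?thesis using kH by auto
    qed
    ultimately show "uniformly_continuous_on {w \<in> h ` \<H>. norm w \<le> M + 1} (inv_into \<H> h)"
      by (elim uc_cong) auto
  qed
qed

section \<open>Univalence of the Loewner family\<close>

lemma inverse_uniformly_continuous_separation:
  assumes "inj_on h S" "uniformly_continuous_on (h ` S) (inv_into S h)" "0 < \<rho>"
  obtains \<mu> where "0 < \<mu>" "\<And>x y. x \<in> S \<Longrightarrow> y \<in> S \<Longrightarrow> \<rho> \<le> dist x y \<Longrightarrow> \<mu> \<le> dist (h x) (h y)"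
proof -
  obtain \<mu> where \<mu>: "0 < \<mu>" "\<And>u v. u \<in> h ` S \<Longrightarrow> v \<in> h ` S \<Longrightarrow> dist v u < \<mu> \<Longrightarrow> dist (inv_into S h v) (inv_into S h u) < \<rho>"
    using assms(2,3) unfolding uniformly_continuous_on_def by metis
  have "\<mu> \<le> dist (h x) (h y)" if "x \<in> S" "y \<in> S" "\<rho> \<le> dist x y" for x y
    using \<mu>(2)[of "h y" "h x"] that assms(1) by (force simp: not_less[symmetric])
  with \<mu>(1) that show ?thesis by blast
qed

text \<open>The difference quotient F of h at z has no zero: off z by injectivity, at z because h'
  does not vanish. On the circle of radius r it is at least \<mu>/r in modulus, and the maximum
  principle for 1/F (the Cauchy inequality of order 0) carries this to the centre, where F is
  h'.\<close>

lemma deriv_lower_bound: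
  assumes h: "univalent_on h \<H>" and V: "uniformly_continuous_on (h ` \<H>) (inv_into \<H> h)" and "0 < \<delta>"
  obtains c where "0 < c" "\<And>z. \<delta> \<le> Re z \<Longrightarrow> c \<le> norm (deriv h z)"
proof -
  have hol: "h holomorphic_on \<H>" and inj: "inj_on h \<H>" using h by (auto simp: univalent_on_def)
  define r where "r = \<delta> / 2"
  have r: "0 < r" using \<open>0 < \<delta>\<close> by (simp add: r_def)
  obtain \<mu> where \<mu>: "0 < \<mu>" "\<And>x y. x \<in> \<H> \<Longrightarrow> y \<in> \<H> \<Longrightarrow> r \<le> dist x y \<Longrightarrow> \<mu> \<le> dist (h x) (h y)"
    using inverse_uniformly_continuous_separation[OF inj V r] by blast
  have "\<mu> / r \<le> norm (deriv h z)" if z: "\<delta> \<le> Re z" for z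
  proof -
    have zH: "z \<in> \<H>" using z \<open>0 < \<delta>\<close> by (simp add: right_half_plane_def)
    define F where "F = (\<lambda>w. if w = z then deriv h z else (h w - h z) / (w - z))"
    have holF: "F holomorphic_on \<H>"
      unfolding F_def by (rule pole_lemma_open[OF hol]) simp
    have F0: "F w \<noteq> 0" if "w \<in> \<H>" for w
      using deriv_univalent_nonzero[OF h _ zH] inj_onD[OF inj _ that zH] by (auto simp: F_def)
    have holF': "(\<lambda>w. 1 / F w) holomorphic_on \<H>"
      using F0 by (intro holomorphic_intros holF) auto
    have sub: "cball z r \<subseteq> \<H>"
      using z \<open>0 < \<delta>\<close> by (intro cball_subset_right_half_plane) (simp add: r_def)
    have "norm ((deriv ^^ 0) (\<lambda>w. 1 / F w) z) \<le> fact 0 * (r / \<mu>) / r ^ 0"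
    proof (rule Cauchy_inequality[OF _ _ r])
      show "(\<lambda>w. 1 / F w) holomorphic_on ball z r"
        using sub ball_subset_cball holomorphic_on_subset[OF holF'] by blast
      show "continuous_on (cball z r) (\<lambda>w. 1 / F w)"
        using sub holomorphic_on_imp_continuous_on[OF holF'] continuous_on_subset by blast
      fix w assume w: "norm (z - w) = r"
      then have "w \<in> cball z r" by (simp add: dist_norm)
      then have wH: "w \<in> \<H>" using sub by blast
      have "\<mu> \<le> norm (h w - h z)"
        using \<mu>(2)[OF wH zH] w by (simp add: dist_norm norm_minus_commute)
      moreover have "w \<noteq> z" using w r by auto
      ultimately show "norm (1 / F w) \<le> r / \<mu>"
        using w \<mu>(1) r by (simp add: F_def norm_divide norm_minus_commute frac_le)
    qed
    then have "1 / norm (deriv h z) \<le> r / \<mu>" by (simp add: F_def norm_divide)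
    moreover have "0 < norm (deriv h z)" using deriv_univalent_nonzero[OF h _ zH] by simp
    ultimately show ?thesis using r \<mu>(1) by (simp add: field_simps)
  qed
  moreover have "0 < \<mu> / r" using \<mu>(1) r by simp
  ultimately show ?thesis using that by blast
qed

text \<open>Uniform continuity bounds h w - h z on the circle |w - z| = s/2, and Cauchy's estimate
  turns this into a bound for s |h'|. The weight is s instead of Re z, so that the bound is small on
  small scales at every distance from the boundary.\<close>

lemma deriv_upper_bound:
  assumes hol: "h holomorphic_on \<H>" and U: "uniformly_continuous_on \<H> h" and "0 < e"
  obtains d where "0 < d" "\<And>z s. 0 < s \<Longrightarrow> s \<le> d \<Longrightarrow> s \<le> Re z \<Longrightarrow> s * norm (deriv h z) \<le> e"
proof -
  obtain d where d: "0 < d" "\<And>x y. x \<in> \<H> \<Longrightarrow> y \<in> \<H> \<Longrightarrow> dist y x < d \<Longrightarrow> dist (h y) (h x) < e / 2"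
    using U \<open>0 < e\<close> unfolding uniformly_continuous_on_def by (metis half_gt_zero)
  have "s * norm (deriv h z) \<le> e" if s: "0 < s" "s \<le> d" "s \<le> Re z" for z s
  proof -
    have "s / 2 * norm (deriv h z) \<le> e / 2"
    proof (rule Cauchy_estimate_ball[OF hol])
      fix w assume w: "norm (z - w) = s / 2"
      have "\<bar>Re (z - w)\<bar> \<le> s / 2" using abs_Re_le_cmod[of "z - w"] w by simp
      then have "0 < Re w" using s unfolding minus_complex.sel by linarith
      then have "dist (h w) (h z) < e / 2"
        using s w by (intro d(2)) (auto simp: right_half_plane_def dist_norm norm_minus_commute)
      then show "norm (h w - h z) \<le> e / 2" by (simp add: dist_norm)
    qed (use s in auto)
    then show ?thesis by simp
  qed
  with d(1) that show ?thesis by blast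
qed

text \<open>Here the Riccati argument runs over all heights at once: uniform continuity of h gives
  the upper bound for |h'| and that of the inverse the lower bound, both independent of Im z. For Re
  z \<ge> \<eta>, Cauchy's estimate for h' and the lower bound only give |P| \<le> C, which is why
  Re z is capped at \<rho> \<le> \<epsilon>/C.\<close>

lemma pre_Schwarzian_small:
  assumes h: "univalent_on h \<H>" and U: "uniformly_continuous_on \<H> h"
    and V: "uniformly_continuous_on (h ` \<H>) (inv_into \<H> h)"
    and S: "Schwarzian_vanishes_at_boundary h" and \<epsilon>: "0 < \<epsilon>" "\<epsilon> \<le> 1"
  obtains \<rho> where "0 < \<rho>" "\<And>z. z \<in> \<H> \<Longrightarrow> min (Re z) \<rho> * norm (pre_Schwarzian h z) \<le> \<epsilon>"
proof -
  have hol: "h holomorphic_on \<H>" using h by (auto simp: univalent_on_def)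
  have h': "deriv h z \<noteq> 0" if "z \<in> \<H>" for z using deriv_univalent_nonzero[OF h _ that] by simp
  have hol': "deriv h holomorphic_on \<H>" using hol by (intro holomorphic_deriv) auto
  obtain \<delta>1 where \<delta>1: "0 < \<delta>1" "\<And>z. 0 < Re z \<Longrightarrow> Re z \<le> \<delta>1 \<Longrightarrow> (Re z)\<^sup>2 * norm (Schwarzian h z) \<le> \<epsilon>\<^sup>2 / 64"
    using Schwarzian_vanishes_at_boundaryD[OF S, of "\<epsilon>\<^sup>2 / 64"] \<epsilon> by auto
  obtain d where d: "0 < d" "\<And>z s. 0 < s \<Longrightarrow> s \<le> d \<Longrightarrow> s \<le> Re z \<Longrightarrow> s * norm (deriv h z) \<le> 1"
    using deriv_upper_bound[OF hol U, of 1] by auto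
  define \<delta> where "\<delta> = min \<delta>1 d"
  have \<delta>: "0 < \<delta>" "\<delta> \<le> \<delta>1" "\<delta> \<le> d" using \<delta>1(1) d(1) by (auto simp: \<delta>_def)
  obtain c where c: "0 < c" "\<And>z. \<delta> \<le> Re z \<Longrightarrow> c \<le> norm (deriv h z)"
    using deriv_lower_bound[OF h V \<delta>(1)] by blast
  obtain \<eta> where \<eta>: "0 < \<eta>" "\<And>z. 0 < Re z \<Longrightarrow> Re z \<le> \<eta> \<Longrightarrow> Re z * norm (pre_Schwarzian h z) \<le> \<epsilon>"
  proof (rule riccati_smallness_half_plane[OF hol h' \<delta>(1) \<epsilon>, where C = 1 and c = c and Y = UNIV])
    show "Re z * norm (deriv h z) \<le> 1" if "0 < Re z" "Re z \<le> \<delta>" for z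
      using d(2)[of "Re z" z] that \<delta> by simp
  qed (use \<delta> \<delta>1 c in auto)
  obtain c' where c': "0 < c'" "\<And>z. \<eta> \<le> Re z \<Longrightarrow> c' \<le> norm (deriv h z)"
    using deriv_lower_bound[OF h V \<eta>(1)] by blast
  define s where "s = min d (\<eta> / 2)"
  have s: "0 < s" "s \<le> d" "s \<le> \<eta> / 2" using d(1) \<eta>(1) by (auto simp: s_def)
  define C where "C = (1 / s) / (\<eta> / 2) / c'"
  have "0 < C" using s \<eta>(1) c'(1) by (simp add: C_def)
  have C: "norm (pre_Schwarzian h z) \<le> C" if z: "\<eta> \<le> Re z" for z
  proof -
    have "\<eta> / 2 * norm (deriv (deriv h) z) \<le> 1 / s"
    proof (rule Cauchy_estimate_ball[OF hol', where a = 0])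
      fix w assume w: "norm (z - w) = \<eta> / 2"
      have "\<bar>Re (z - w)\<bar> \<le> \<eta> / 2" using abs_Re_le_cmod[of "z - w"] w by simp
      then have "s \<le> Re w" using s z unfolding minus_complex.sel by linarith
      then show "norm (deriv h w - 0) \<le> 1 / s" using d(2)[OF s(1,2)] s(1) by (simp add: field_simps)
    qed (use \<eta>(1) z in auto)
    then have "norm (deriv (deriv h) z) \<le> (1 / s) / (\<eta> / 2)"
      using \<eta>(1) by (simp only: pos_le_divide_eq[of "\<eta> / 2"] half_gt_zero mult.commute)
    then show ?thesis
      unfolding pre_Schwarzian_def norm_divide C_def using c' z s \<eta>(1) by (intro frac_le) auto
  qed
  define \<rho> where "\<rho> = min \<eta> (\<epsilon> / C)"
  have "0 < \<rho>" using \<eta>(1) \<epsilon> \<open>0 < C\<close> by (simp add: \<rho>_def)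
  moreover have "min (Re z) \<rho> * norm (pre_Schwarzian h z) \<le> \<epsilon>" if z: "z \<in> \<H>" for z
  proof (cases "Re z \<le> \<eta>")
    case True
    have "min (Re z) \<rho> * norm (pre_Schwarzian h z) \<le> Re z * norm (pre_Schwarzian h z)"
      by (intro mult_right_mono) auto
    also have "\<dots> \<le> \<epsilon>" using \<eta>(2)[of z] z True by (simp add: right_half_plane_def)
    finally show ?thesis .
  next
    case False
    have "min (Re z) \<rho> * norm (pre_Schwarzian h z) \<le> (\<epsilon> / C) * C"
      using C[of z] False \<epsilon> \<open>0 < C\<close> by (intro mult_mono) (auto simp: \<rho>_def)
    then show ?thesis using \<open>0 < C\<close> by simp
  qed
  ultimately show ?thesis using that by blast
qed

text \<open>The boundary condition on the Schwarzian speaks about small Re z only, while t^2 S must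
  be small for every Re z \<ge> t. So it is recovered from P: on the circle of radius t/2, |P| \<le>
  2\<epsilon>/t, hence t^2 |P'| \<le> 4\<epsilon> by Cauchy, and half the square of P adds at most
  \<epsilon>/2.\<close>

lemma Schwarzian_small:
  assumes P: "pre_Schwarzian h holomorphic_on \<H>"
    and bound: "\<And>z. z \<in> \<H> \<Longrightarrow> min (Re z) \<rho> * norm (pre_Schwarzian h z) \<le> \<epsilon>"
    and \<epsilon>: "\<epsilon> \<le> 1" and t: "0 < t" "t \<le> \<rho>" "t \<le> Re z"
  shows "t * norm (pre_Schwarzian h z) \<le> \<epsilon>" "t\<^sup>2 * norm (Schwarzian h z) \<le> 5 * \<epsilon>"
proof -
  have le: "s * norm (pre_Schwarzian h w) \<le> \<epsilon>" if "0 < s" "s \<le> \<rho>" "s \<le> Re w" for s w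
  proof -
    have "s * norm (pre_Schwarzian h w) \<le> min (Re w) \<rho> * norm (pre_Schwarzian h w)"
      using that by (intro mult_right_mono) auto
    also have "\<dots> \<le> \<epsilon>" using bound[of w] that by (simp add: right_half_plane_def)
    finally show ?thesis .
  qed
  show p: "t * norm (pre_Schwarzian h z) \<le> \<epsilon>" using le t by blast
  have "0 \<le> t * norm (pre_Schwarzian h z)" using t by simp
  then have "0 \<le> \<epsilon>" using p by linarith
  have "t / 2 * norm (deriv (pre_Schwarzian h) z) \<le> \<epsilon> / (t / 2)"
  proof (rule Cauchy_estimate_ball[OF P, where a = 0])
    fix w assume w: "norm (z - w) = t / 2"
    have "\<bar>Re (z - w)\<bar> \<le> t / 2" using abs_Re_le_cmod[of "z - w"] w by simp
    then have "t / 2 \<le> Re w" using t unfolding minus_complex.sel by linarith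
    then have "t / 2 * norm (pre_Schwarzian h w) \<le> \<epsilon>" using t by (intro le) auto
    then show "norm (pre_Schwarzian h w - 0) \<le> \<epsilon> / (t / 2)" using t by (simp add: field_simps)
  qed (use t in auto)
  then have d: "t\<^sup>2 * norm (deriv (pre_Schwarzian h) z) \<le> 4 * \<epsilon>"
    using t by (simp add: field_simps power2_eq_square)
  have "(t * norm (pre_Schwarzian h z))\<^sup>2 \<le> \<epsilon>\<^sup>2"
    using p t by (intro power_mono) auto
  also have "\<epsilon>\<^sup>2 \<le> \<epsilon>" using \<epsilon> \<open>0 \<le> \<epsilon>\<close> by (simp add: power2_eq_square mult_left_le)
  finally have p2: "t\<^sup>2 * (norm (pre_Schwarzian h z))\<^sup>2 \<le> \<epsilon>" by (simp add: power_mult_distrib)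
  have "norm (Schwarzian h z) \<le> norm (deriv (pre_Schwarzian h) z) + (norm (pre_Schwarzian h z))\<^sup>2 / 2"
    unfolding Schwarzian_def by (rule order_trans[OF norm_triangle_ineq4]) (simp add: norm_divide norm_power)
  then have "t\<^sup>2 * norm (Schwarzian h z) \<le> t\<^sup>2 * (norm (deriv (pre_Schwarzian h) z) + (norm (pre_Schwarzian h z))\<^sup>2 / 2)"
    by (intro mult_left_mono) auto
  also have "\<dots> \<le> 5 * \<epsilon>" using d p2 \<open>0 \<le> \<epsilon>\<close> by (simp add: distrib_left)
  finally show "t\<^sup>2 * norm (Schwarzian h z) \<le> 5 * \<epsilon>" .
qed

text \<open>The result has the shape \<open>A w * B w\<close> expected by the near-isometry
  estimates: A is the shifted derivative of h, and B is close to 1 when t P and t^2 S are small. The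
  algebra rests on h'' = P h'.\<close>

lemma has_field_derivative_Loewner_family:
  assumes hol: "h holomorphic_on \<H>" and h': "\<And>z. z \<in> \<H> \<Longrightarrow> deriv h z \<noteq> 0"
    and z: "z + of_real t \<in> \<H>" and nz: "1 + of_real t * pre_Schwarzian h (z + of_real t) \<noteq> 0"
  shows "(Loewner_family h t has_field_derivative
      deriv h (z + of_real t) * ((1 + 2 * (of_real t)\<^sup>2 * Schwarzian h (z + of_real t))
        / (1 + of_real t * pre_Schwarzian h (z + of_real t))\<^sup>2)) (at z)"
proof -
  define \<zeta> where "\<zeta> = z + complex_of_real t"
  define T where "T = complex_of_real t"
  have sh: "((\<lambda>z. g (z + T)) has_field_derivative deriv g \<zeta>) (at z)" if "g holomorphic_on \<H>" for g
    using holomorphic_derivI[OF that _ z] DERIV_shift[of g "deriv g \<zeta>" z T] by (simp add: \<zeta>_def T_def)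
  define H1 where "H1 = (\<lambda>z. deriv h (z + T))"
  define P where "P = (\<lambda>z. pre_Schwarzian h (z + T))"
  have D: "((\<lambda>z. h (z + T)) has_field_derivative H1 z) (at z)"
      "(H1 has_field_derivative P z * H1 z) (at z)"
      "(P has_field_derivative deriv (pre_Schwarzian h) \<zeta>) (at z)"
    using sh[OF hol] sh[OF holomorphic_deriv[OF hol]] sh[OF holomorphic_pre_Schwarzian[OF hol _ h']] h'[OF z]
    by (simp_all add: H1_def P_def \<zeta>_def T_def pre_Schwarzian_def)
  define k where "k = (\<lambda>z. 1 + T * P z)"
  have k: "(k has_field_derivative T * deriv (pre_Schwarzian h) \<zeta>) (at z)"
    unfolding k_def using D by (auto intro!: derivative_eq_intros)
  have k0: "k z \<noteq> 0" using nz by (simp add: k_def P_def T_def)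
  have "((\<lambda>z. h (z + T) - 2 * T * H1 z / k z) has_field_derivative
      H1 z - (2 * T * (P z * H1 z) * k z - 2 * T * H1 z * (T * deriv (pre_Schwarzian h) \<zeta>)) / (k z * k z)) (at z)"
    using D k k0 by (auto intro!: derivative_eq_intros)
  moreover have "H1 z - (2 * T * (P z * H1 z) * k z - 2 * T * H1 z * (T * deriv (pre_Schwarzian h) \<zeta>)) / (k z * k z)
     = H1 z * ((1 + 2 * T\<^sup>2 * (deriv (pre_Schwarzian h) \<zeta> - (P z)\<^sup>2 / 2)) / (k z)\<^sup>2)"
  proof -
    have alg: "q - (2 * T * (p * q) * x - 2 * T * q * (T * y)) / (x * x) = q * ((1 + 2 * T\<^sup>2 * (y - p\<^sup>2 / 2)) / x\<^sup>2)"
      if "x \<noteq> 0" "x = 1 + T * p" for x p q y :: complex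
    proof -
      have "q - (2 * T * (p * q) * x - 2 * T * q * (T * y)) / (x * x)
          = (q * (x * x) - (2 * T * (p * q) * x - 2 * T * q * (T * y))) / (x * x)"
        using that(1) by (simp add: diff_divide_distrib)
      also have "q * (x * x) - (2 * T * (p * q) * x - 2 * T * q * (T * y)) = q * (1 + 2 * T\<^sup>2 * (y - p\<^sup>2 / 2))"
        unfolding that(2) by (simp add: algebra_simps power2_eq_square)
      finally show ?thesis by (simp add: power2_eq_square)
    qed
    show ?thesis by (rule alg) (use k0 in \<open>auto simp: k_def\<close>)
  qed
  moreover have "Loewner_family h t = (\<lambda>z. h (z + T) - 2 * T * H1 z / k z)"
    by (simp add: fun_eq_iff Loewner_family_def H1_def k_def P_def T_def)
  ultimately show ?thesis
    by (simp add: H1_def k_def P_def T_def \<zeta>_def Schwarzian_def)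
qed

text \<open>The constants are matched to their use: |t P| \<le> 1/1000 comes with t^2 |S| \<le>
  5/1000, hence |2 t^2 S| \<le> 1/100, and 1/32 is the tolerance of the near-isometry
  estimate.\<close>

lemma perturbed_factor_near_one:
  fixes p s :: complex
  assumes p: "norm p \<le> 1/1000" and s: "norm s \<le> 1/100"
  shows "1 + p \<noteq> 0" "norm ((1 + s) / (1 + p)\<^sup>2 - 1) \<le> 1/32"
proof -
  have "1 - norm p \<le> norm (1 + p)"
    using norm_triangle_ineq2[of 1 "- p"] by simp
  then have n: "999/1000 \<le> norm (1 + p)" using p by linarith
  then show nz: "1 + p \<noteq> 0" by auto
  have "(999/1000)\<^sup>2 \<le> (norm (1 + p))\<^sup>2" using n by (intro power_mono) auto
  then have n2: "1/2 \<le> norm ((1 + p)\<^sup>2)" by (simp add: norm_power norm_mult power2_eq_square)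
  have "(norm p)\<^sup>2 \<le> (1/1000)\<^sup>2" using p by (intro power_mono) auto
  then have "norm (p\<^sup>2) \<le> 1/1000" by (simp add: norm_power norm_mult power2_eq_square)
  moreover have "norm (s - 2 * p - p\<^sup>2) \<le> norm s + norm (2 * p) + norm (p\<^sup>2)"
    by (meson norm_triangle_le_diff norm_triangle_ineq4 add_mono order_refl)
  ultimately have "norm (s - 2 * p - p\<^sup>2) \<le> 1/64"
    using p s by (simp add: norm_mult)
  then have "norm (s - 2 * p - p\<^sup>2) / norm ((1 + p)\<^sup>2) \<le> (1/64) / (1/2)"
    using n2 by (intro frac_le) auto
  moreover have "(1 + s) / (1 + p)\<^sup>2 - 1 = (s - 2 * p - p\<^sup>2) / (1 + p)\<^sup>2"
  proof -
    have "(1 + s) / (1 + p)\<^sup>2 - 1 = ((1 + s) - (1 + p)\<^sup>2) / (1 + p)\<^sup>2"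
      using nz by (simp add: diff_divide_distrib)
    also have "(1 + s) - (1 + p)\<^sup>2 = s - 2 * p - p\<^sup>2" by (simp add: power2_eq_square algebra_simps)
    finally show ?thesis .
  qed
  ultimately show "norm ((1 + s) / (1 + p)\<^sup>2 - 1) \<le> 1/32" by (simp add: norm_divide)
qed

text \<open>The length \<rho> separates near pairs of points from far ones and is fixed before t,
  since the separation \<mu> depends on it. Then t is restricted twice: by \<rho>, to keep B close
  to 1, and by d, to keep \<open>Loewner_family h t\<close> close to the translate of h.\<close>

lemma univalent_Loewner_family:
  assumes h: "univalent_on h \<H>" and U: "uniformly_continuous_on \<H> h"
    and V: "uniformly_continuous_on (h ` \<H>) (inv_into \<H> h)"
    and S: "Schwarzian_vanishes_at_boundary h"
  obtains \<tau> where "0 < \<tau>" "\<And>t. 0 \<le> t \<Longrightarrow> t \<le> \<tau> \<Longrightarrow> univalent_on (Loewner_family h t) \<H>"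
proof -
  have hol: "h holomorphic_on \<H>" and inj: "inj_on h \<H>" using h by (auto simp: univalent_on_def)
  have h': "deriv h z \<noteq> 0" if "z \<in> \<H>" for z using deriv_univalent_nonzero[OF h _ that] by simp
  have holP: "pre_Schwarzian h holomorphic_on \<H>" using holomorphic_pre_Schwarzian[OF hol _ h'] by simp
  obtain \<rho> where \<rho>: "0 < \<rho>" "\<And>z. z \<in> \<H> \<Longrightarrow> min (Re z) \<rho> * norm (pre_Schwarzian h z) \<le> 1/1000"
    using pre_Schwarzian_small[OF h U V S, of "1/1000"] by auto
  obtain \<mu> where \<mu>: "0 < \<mu>" "\<And>x y. x \<in> \<H> \<Longrightarrow> y \<in> \<H> \<Longrightarrow> \<rho> \<le> dist x y \<Longrightarrow> \<mu> \<le> dist (h x) (h y)"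
    using inverse_uniformly_continuous_separation[OF inj V \<rho>(1)] by blast
  \<comment> \<open>With t |h'| \<le> \<mu>/16 and |1 + t P| \<ge> 1/2, the correction term is at
    most 2(\<mu>/16)/(1/2) = \<mu>/4, and two such errors stay below \<mu>.\<close>
  have "0 < \<mu> / 16" using \<mu>(1) by simp
  then obtain d where d: "0 < d" "\<And>z s. 0 < s \<Longrightarrow> s \<le> d \<Longrightarrow> s \<le> Re z \<Longrightarrow> s * norm (deriv h z) \<le> \<mu> / 16"
    using deriv_upper_bound[OF hol U] by blast
  have "univalent_on (Loewner_family h t) \<H>" if t: "0 \<le> t" "t \<le> min \<rho> d" for t
  proof (cases "t = 0")
    case True
    have "Loewner_family h 0 = h" by (simp add: fun_eq_iff Loewner_family_def)
    then show ?thesis using h True by simp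
  next
    case False
    then have t0: "0 < t" using t by simp
    define T where "T = complex_of_real t"
    define f where "f = Loewner_family h t"
    define A where "A = (\<lambda>z. deriv h (z + T))"
    define B where "B = (\<lambda>z. (1 + 2 * T\<^sup>2 * Schwarzian h (z + T)) / (1 + T * pre_Schwarzian h (z + T))\<^sup>2)"
    have inH: "z + T \<in> \<H>" "t \<le> Re (z + T)" if "z \<in> \<H>" for z
      using that t0 by (auto simp: T_def right_half_plane_def)
    have p: "norm (T * pre_Schwarzian h (z + T)) \<le> 1/1000"
      and s: "norm (2 * T\<^sup>2 * Schwarzian h (z + T)) \<le> 1/100" if "z \<in> \<H>" for z
    proof -
      have "t * norm (pre_Schwarzian h (z + T)) \<le> 1/1000" "t\<^sup>2 * norm (Schwarzian h (z + T)) \<le> 5 * (1/1000)"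
        using Schwarzian_small[OF holP \<rho>(2) _ t0 _ inH(2)[OF that]] t by auto
      then show "norm (T * pre_Schwarzian h (z + T)) \<le> 1/1000" "norm (2 * T\<^sup>2 * Schwarzian h (z + T)) \<le> 1/100"
        using t0 by (auto simp: T_def norm_mult norm_power)
    qed
    note nz = perturbed_factor_near_one(1)[OF p s]
    have B1: "norm (B z - 1) \<le> 1/32" if "z \<in> \<H>" for z
      unfolding B_def by (rule perturbed_factor_near_one(2)[OF p s]) fact+
    have f': "(f has_field_derivative A z * B z) (at z)" if "z \<in> \<H>" for z
      unfolding f_def A_def B_def T_def
      using has_field_derivative_Loewner_family[OF hol h', of z t] inH(1)[OF that] nz[OF that that]
      by (simp add: T_def)
    have "f holomorphic_on \<H>"
      using f' by (auto simp: holomorphic_on_open)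
    moreover have "inj_on f \<H>"
    proof (rule inj_onI, rule ccontr)
      fix z\<^sub>1 z\<^sub>2 assume z: "z\<^sub>1 \<in> \<H>" "z\<^sub>2 \<in> \<H>" and eq: "f z\<^sub>1 = f z\<^sub>2" and ne: "z\<^sub>1 \<noteq> z\<^sub>2"
      define d' where "d' = norm (z\<^sub>1 - z\<^sub>2)"
      have d'0: "0 < d'" using ne by (simp add: d'_def)
      show False
      proof (cases "d' \<le> \<rho>")
        case True
        have A': "(A has_field_derivative deriv (deriv h) (z + T)) (at z)" if "z \<in> \<H>" for z
          unfolding A_def
          by (intro DERIV_shift[THEN iffD1] holomorphic_derivI[OF holomorphic_deriv[OF hol] _ inH(1)[OF that]]) simp_all
        have An: "A z \<noteq> 0" if "z \<in> \<H>" for z using h' inH(1)[OF that] by (simp add: A_def)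
        have "norm (f z\<^sub>1 - f z\<^sub>2 - A (z\<^sub>1 + of_real d') * (z\<^sub>1 - z\<^sub>2)) \<le> norm (A (z\<^sub>1 + of_real d')) * d' / 2"
        proof (rule near_isometry_on_convex[OF d'_def z f' _ An B1 convex_right_half_plane])
          show "A holomorphic_on \<H>" using A' by (auto simp: holomorphic_on_open)
          fix w assume w: "w \<in> \<H>"
          have "min (Re w) d' * norm (deriv A w / A w) = min (Re w) d' * norm (pre_Schwarzian h (w + T))"
            using DERIV_imp_deriv[OF A'[OF w]] by (simp add: A_def pre_Schwarzian_def)
          also have "\<dots> \<le> min (Re (w + T)) \<rho> * norm (pre_Schwarzian h (w + T))"
            \<comment> \<open>Shifting by t moves points away from the boundary, so the bound for P
              at w + T is at least as strong as the one needed at w.\<close>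
            using True t0 by (intro mult_right_mono min.mono) (auto simp: T_def)
          also have "\<dots> \<le> 1/1000" by (rule \<rho>(2)[OF inH(1)[OF w]])
          finally show "min (Re w) d' * norm (deriv A w / A w) \<le> 1/32" by simp
        qed (use z in \<open>auto simp: right_half_plane_def\<close>)
        then have "norm (A (z\<^sub>1 + of_real d')) * d' \<le> norm (A (z\<^sub>1 + of_real d')) * d' / 2"
          by (simp add: eq norm_mult flip: d'_def)
        moreover have "z\<^sub>1 + of_real d' \<in> \<H>" using z(1) d'0 by (simp add: right_half_plane_def)
        then have "0 < norm (A (z\<^sub>1 + of_real d')) * d'" using An d'0 by simp
        ultimately show False by linarith
      next
        case False
        \<comment> \<open>The comparison is with h shifted by t, not with h at the same point:
          translation preserves the distance of two points, so the separation by \<mu> applies to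
          the shifted pair.\<close>
        have close: "norm (f z - h (z + T)) \<le> \<mu> / 4" if z: "z \<in> \<H>" for z
        proof -
          define k where "k = norm (1 + T * pre_Schwarzian h (z + T))"
          have "1 - norm (T * pre_Schwarzian h (z + T)) \<le> k"
            unfolding k_def using norm_triangle_ineq2[of 1 "- (T * pre_Schwarzian h (z + T))"] by simp
          then have k: "1/2 \<le> k" using p[OF z] by linarith
          have "norm (f z - h (z + T)) = 2 * (t * norm (deriv h (z + T))) / k"
            using t0 by (simp add: f_def Loewner_family_def T_def k_def norm_mult norm_divide)
          also have "\<dots> \<le> 2 * (\<mu> / 16) / (1/2)"
            using k d(2)[OF t0 _ inH(2)[OF z]] t \<mu>(1) by (intro frac_le) auto
          finally show ?thesis by simp
        qed
        have "\<mu> \<le> dist (h (z\<^sub>1 + T)) (h (z\<^sub>2 + T))"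
          using False by (intro \<mu>(2) inH z) (simp add: d'_def dist_norm)
        also have "\<dots> \<le> dist (h (z\<^sub>1 + T)) (f z\<^sub>1) + dist (f z\<^sub>2) (h (z\<^sub>2 + T))"
          using dist_triangle[of "h (z\<^sub>1 + T)" "h (z\<^sub>2 + T)" "f z\<^sub>1"] eq by simp
        also have "\<dots> \<le> \<mu> / 4 + \<mu> / 4"
          using close z by (intro add_mono) (simp_all add: dist_norm norm_minus_commute)
        finally show False using \<mu>(1) by simp
      qed
    qed
    ultimately show ?thesis by (simp add: univalent_on_def f_def)
  qed
  moreover have "0 < min \<rho> d" using \<rho>(1) d(1) by simp
  ultimately show ?thesis using that by blast
qed

theorem theorem4p3:
  fixes h :: "complex \<Rightarrow> complex" and k \<tau>\<^sub>0 :: real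
  assumes "univalent_on h \<H>"
    and "filterlim h at_infinity (inf at_infinity (principal \<H>))"
    and "Jordan_domain (Some ` (h ` \<H>))"
    and "Schwarzian_vanishes_at_boundary h"
    and "condition_A h"
    and "0 < k" and "k < 1"
    and "Loewner_admissible h k \<tau>\<^sub>0"
  shows "\<exists>\<tau>>0. \<tau> \<le> \<tau>\<^sub>0 \<and> (\<forall>t. 0 \<le> t \<and> t \<le> \<tau> \<longrightarrow> univalent_on (Loewner_family h t) \<H>)"
proof -
  note uc = uniformly_continuous_univalent[OF assms(1-5)]
  obtain \<tau> where \<tau>: "0 < \<tau>" "\<And>t. 0 \<le> t \<Longrightarrow> t \<le> \<tau> \<Longrightarrow> univalent_on (Loewner_family h t) \<H>"
    using univalent_Loewner_family[OF assms(1) uc assms(4)] by blast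
  have "0 < \<tau>\<^sub>0" using assms(8) by (simp add: Loewner_admissible_def)
  then show ?thesis
    using \<tau> by (intro exI[of _ "min \<tau> \<tau>\<^sub>0"]) auto
qed

end
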